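(* Let $(Q_n)_{n\ge 0}$ be one of the queueing characteristics listed in the context, with known initial value $Q_0$, known rate $\alpha$, and unknown input distribution function $G$. Let $G_{\mathrm{emp}}(x,N)$ be the empirical distribution function of $N$ independent observations from $G$, and put $r_i=\int_0^\infty \mathrm{e}^{-\alpha x}\frac{(\alpha x)^i}{i!}\,\mathrm{d}G_{\mathrm{emp}}(x,N)$. The point estimator $\widehat Q_n$ of $Q_n$ is defined recurrently by $$\widehat Q_1=\frac{1}{r_0}Q_0,\qquad \widehat Q_2=\frac{1-r_1}{r_0}\widehat Q_1,$$ $$\widehat Q_n=\frac1{r_0}\left[(1-r_1)\widehat Q_{n-1}-r_2\widehat Q_{n-2}-\ldots-r_{n-1}\widehat Q_1\right],\quad n\ge 3.$$ Let $P\in(0,1)$. Let $\epsilon=\epsilon_N>0$ be determined by $1-\exp(-2N\epsilon^2)=P$ and let $\gamma=\gamma_N>0$ be determined by $$1-\exp(-2N\gamma^2)-\sqrt{\pi N}\,\gamma\exp(-N\gamma^2)\left[2\Phi\left(\sqrt{2N}\,\gamma\right)-1\right]=P,$$ where $\Phi(x)=\frac1{\sqrt{2\pi}}\int_{-\infty}^x\mathrm{e}^{-y^2/2}\,\mathrm{d}y$. Define recurrently $$\widehat Q_1^{\mathrm{lower}}=\frac{1}{r_0+\epsilon}Q_0,\qquad \widehat Q_1^{\mathrm{upper}}=\frac{1}{r_0-\epsilon}Q_0,$$ $$\widehat Q_2^{\mathrm{lower}}=\frac{1-r_1-\gamma}{[r_0+\epsilon]^2}Q_0,\qquad \widehat Q_2^{\mathrm{upper}}=\frac{1-r_1+\gamma}{[r_0-\epsilon]^2}Q_0,$$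 and, for $n\ge3$, $$\widehat Q_n^{\mathrm{lower}}=\frac{1}{r_0+\epsilon}\left[(1-r_1-\gamma)\widehat Q_{n-1}^{\mathrm{lower}}-(r_2+\gamma)\widehat Q_{n-2}^{\mathrm{upper}}-\ldots-(r_{n-1}+\gamma)\widehat Q_1^{\mathrm{upper}}\right],$$ $$\widehat Q_n^{\mathrm{upper}}=\frac{1}{r_0-\epsilon}\left[(1-r_1+\gamma)\widehat Q_{n-1}^{\mathrm{upper}}-(r_2-\gamma)\widehat Q_{n-2}^{\mathrm{lower}}-\ldots-(r_{n-1}-\gamma)\widehat Q_1^{\mathrm{lower}}\right].$$ Then for every $n\ge1$ these are interval estimators for $Q_n$ with confidence probability (for large samples) not smaller than $P$, that is, $$\liminf_{N\to\infty}\mathrm{Pr}\left\{\widehat Q_n^{\mathrm{lower}}<Q_n<\widehat Q_n^{\mathrm{upper}}\right\}\ge P.$$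
   Context: Characteristics. All of them satisfy $Q_n=\sum_{i=0}^nQ_{n-i+1}\int_0^\infty \mathrm{e}^{-\alpha x}\frac{(\alpha x)^i}{i!}\,\mathrm{d}G(x)$ for $n\ge 0$, which together with $Q_0$ determines $Q_1,Q_2,\ldots$; with $\rho_i=\int_0^\infty \mathrm{e}^{-\alpha x}\frac{(\alpha x)^i}{i!}\,\mathrm{d}G(x)$ this is equivalent to $Q_1=Q_0/\rho_0$, $Q_2=\frac{1-\rho_1}{\rho_0}Q_1$, $Q_n=\frac1{\rho_0}[(1-\rho_1)Q_{n-1}-\rho_2Q_{n-2}-\ldots-\rho_{n-1}Q_1]$ for $n\ge3$. Here $G$ is the distribution function of a positive random variable. (1) $M/GI/1/n$ queue: Poisson arrivals with known rate $\lambda$, service-time distribution function $B$ with known mean $b$, and $n$ waiting places (not counting the place in service). Here $\alpha=\lambda$, $G=B$, and $Q_n$ is one of: $\mathrm{E}T_n$, the expected length of a busy period ($Q_0=b$); $\mathrm{E}\nu_n$, the expected number of customers served during a busy period ($Q_0=1$); $\mathrm{E}L_n-1$, where $L_n$ is the number of customers lost during a busy period ($Q_0=\lambda b-1$). (2) $GI/M/1/n-1$ queue: interarrival distribution function $A$, exponential service times with known parameter $\mu$, $n-1$ waiting places (not counting the place in service), stationary loss probability $\pi_n$, $\pi_0=1$. Here $\alpha=\mu$, $G=A$, $Q_n=1/\pi_n$ ($Q_0=1$). The empirical distribution function $G_{\mathrm{emp}}(x,N)$ is the fraction of the $N$ observations that are less than or equal to $x$. Conventions. If $r_0\le\epsilon$,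 the upper bounds $\widehat Q_n^{\mathrm{upper}}$ are set equal to $+\infty$. If $1-r_1-\gamma$ is negative, $\widehat Q_2^{\mathrm{lower}}$ is set equal to $0$, and in $\widehat Q_n^{\mathrm{lower}}$, $n\ge3$, the term $1-r_1-\gamma$ is set to $0$. Known fact: with $\delta_N^-=\sup_{x>0}[G(x)-G_{\mathrm{emp}}(x,N)]$ and $\delta_N^+=\sup_{x>0}[G_{\mathrm{emp}}(x,N)-G(x)]$, both $\sqrt N\delta_N^-$ and $\sqrt N\delta_N^+$ have limiting distribution function $F(z)=1-\mathrm{e}^{-2z^2}$, $z\ge0$. The equation for $\gamma$ reads $(F*F)(\gamma\sqrt N)=P$, where $F*F$ is the convolution of the distribution $F$ with itself.
   Formalization: The formal theorem assumes Q_0 > 0, i.e. λb > 1 for E L_n − 1 (automatic for the other characteristics); for Q_0 < 0 the lower bound exceeds the upper one with probability tending to 1, and for Q_0 = 0 the strict inequalities fail. *)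

theory Defs
  imports "HOL-Probability.Probability"
begin

section \<open>Loss queues driven by renewal and Poisson streams\<close>

text \<open>
  A Poisson process of rate \<open>l\<close> is given by the stream \<open>e\<close> of its independent exponential gaps:
  its points are \<open>e\<^sub>0\<close>, \<open>e\<^sub>0 + e\<^sub>1\<close>, \<dots>, and \<open>points e t\<close> is the number of points in \<open>[0, t]\<close>.
  (The null set on which infinitely many points lie in \<open>[0, t]\<close> is irrelevant.)
\<close>

definition exp_gaps :: "real \<Rightarrow> real stream measure" where
  "exp_gaps l = stream_space (density lborel (\<lambda>x. ennreal (exponential_density l x)))"

definition points :: "real stream \<Rightarrow> real \<Rightarrow> nat" where
  "points e t = card {j. (\<Sum>i\<le>j. e !! i) \<le> t}"

subsection \<open>The busy period of the M/GI/1/n queue\<close>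

text \<open>
  The busy period starts at time \<open>0\<close> with the arrival of a customer at the empty system. The stream
  \<open>s\<close> lists the service times in the order of service, the stream \<open>e\<close> the gaps between the subsequent
  arrivals. During a busy period the server never idles, so the \<open>k\<close>-th service (counting from \<open>0\<close>)
  occupies the time interval from \<open>service_end s k\<close> to \<open>service_end s (Suc k)\<close>.

  \<open>in_system n s e k\<close> is the number of customers left in the system when the first \<open>k\<close> services are
  completed (\<open>1\<close>, for the initial customer, if \<open>k = 0\<close>). If it is \<open>j > 0\<close>, then one of the \<open>j\<close> customers
  enters service and \<open>j - 1\<close> are waiting; of the new arrivals during this service only as many
  are admitted as there are free waiting places among the \<open>n\<close>, and the others are lost.
  The values for \<open>k\<close> beyond the end of the busy period are not used.
\<close>

definition service_end :: "real stream \<Rightarrow> nat \<Rightarrow> real" where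
  "service_end s k = (\<Sum>i<k. s !! i)"

definition arrivals_during :: "real stream \<Rightarrow> real stream \<Rightarrow> nat \<Rightarrow> nat" where
  "arrivals_during s e k = points e (service_end s (Suc k)) - points e (service_end s k)"

fun in_system :: "nat \<Rightarrow> real stream \<Rightarrow> real stream \<Rightarrow> nat \<Rightarrow> nat" where
  "in_system n s e 0 = 1"
| "in_system n s e (Suc k) = min (in_system n s e k - 1 + arrivals_during s e k) n"

definition served :: "nat \<Rightarrow> real stream \<Rightarrow> real stream \<Rightarrow> nat" where
  "served n s e = (LEAST k. in_system n s e k = 0)"

definition busy_length :: "nat \<Rightarrow> real stream \<Rightarrow> real stream \<Rightarrow> real" where
  "busy_length n s e = service_end s (served n s e)"

text \<open>The subtraction of \<open>n\<close> is truncated: nobody is lost if there are enough waiting places.\<close>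

definition lost :: "nat \<Rightarrow> real stream \<Rightarrow> real stream \<Rightarrow> nat" where
  "lost n s e = (\<Sum>k<served n s e. (in_system n s e k - 1 + arrivals_during s e k) - n)"

definition mgi1_space :: "real \<Rightarrow> real measure \<Rightarrow> (real stream \<times> real stream) measure" where
  "mgi1_space lam B = stream_space B \<Otimes>\<^sub>M exp_gaps lam"

definition mean_busy_length :: "real \<Rightarrow> real measure \<Rightarrow> nat \<Rightarrow> real" where
  "mean_busy_length lam B n = (LINT w|mgi1_space lam B. busy_length n (fst w) (snd w))"

definition mean_served :: "real \<Rightarrow> real measure \<Rightarrow> nat \<Rightarrow> real" where
  "mean_served lam B n = (LINT w|mgi1_space lam B. real (served n (fst w) (snd w)))"

definition mean_lost :: "real \<Rightarrow> real measure \<Rightarrow> nat \<Rightarrow> real" where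
  "mean_lost lam B n = (LINT w|mgi1_space lam B. real (lost n (fst w) (snd w)))"

subsection \<open>The stationary loss probability of the GI/M/1/n-1 queue\<close>

text \<open>
  At most \<open>n\<close> customers are in the system, one in service and \<open>n - 1\<close> waiting. An arriving customer who
  finds \<open>j\<close> customers leaves \<open>min (j + 1) n\<close> behind (it is lost if \<open>j = n\<close>). As exponential service
  times have no memory, the successive departures after an arrival, as long as the server is busy,
  are the points of a Poisson process of rate \<open>mu\<close>. Hence, if the next arrival occurs after
  time \<open>t\<close>, it finds \<open>found_next n j t e\<close> customers (truncated subtraction).
\<close>

definition found_next :: "nat \<Rightarrow> nat \<Rightarrow> real \<Rightarrow> real stream \<Rightarrow> nat" where
  "found_next n j t e = min (j + 1) n - points e t"

definition gim1_step :: "real \<Rightarrow> real measure \<Rightarrow> nat \<Rightarrow> nat \<Rightarrow> nat \<Rightarrow> real" where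
  "gim1_step mu A n j i =
     measure (A \<Otimes>\<^sub>M exp_gaps mu)
       {w \<in> space (A \<Otimes>\<^sub>M exp_gaps mu). found_next n j (fst w) (snd w) = i}"

definition gim1_stationary :: "real \<Rightarrow> real measure \<Rightarrow> nat \<Rightarrow> nat pmf \<Rightarrow> bool" where
  "gim1_stationary mu A n p \<longleftrightarrow>
     set_pmf p \<subseteq> {..n} \<and> (\<forall>i\<le>n. pmf p i = (\<Sum>j\<le>n. pmf p j * gim1_step mu A n j i))"

text \<open>\<open>x\<close> is the stationary probability that an arriving customer finds the system full;
  by convention it is \<open>1\<close> for \<open>n = 0\<close>.\<close>

definition gim1_loss_prob :: "real \<Rightarrow> real measure \<Rightarrow> nat \<Rightarrow> real \<Rightarrow> bool" where
  "gim1_loss_prob mu A n x \<longleftrightarrow>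
     (if n = 0 then x = 1 else \<exists>p. gim1_stationary mu A n p \<and> x = pmf p n)"

subsection \<open>The characteristics\<close>

text \<open>
  \<open>a\<close> is the known rate (\<open>lambda\<close> for M/GI/1/n, \<open>mu\<close> for GI/M/1/n-1) and \<open>G\<close> the law of the input
  (service times, respectively interarrival times). For M/GI/1/n the mean of \<open>G\<close> is finite.
\<close>

definition queueing_characteristic :: "real \<Rightarrow> real measure \<Rightarrow> (nat \<Rightarrow> real) \<Rightarrow> bool" where
  "queueing_characteristic a G Q \<longleftrightarrow>
     (integrable G (\<lambda>x. x) \<and> Q = mean_busy_length a G) \<or>
     (integrable G (\<lambda>x. x) \<and> Q = mean_served a G) \<or>
     (integrable G (\<lambda>x. x) \<and> Q = (\<lambda>n. mean_lost a G n - 1)) \<or>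
     (\<forall>n. \<exists>x. gim1_loss_prob a G n x \<and> Q n = 1 / x)"

section \<open>Estimators\<close>

definition emp_cdf :: "(nat \<Rightarrow> 'w \<Rightarrow> real) \<Rightarrow> nat \<Rightarrow> 'w \<Rightarrow> real \<Rightarrow> real" where
  "emp_cdf X N w x = real (card {k. k < N \<and> X k w \<le> x}) / real N"

definition emp_coeff :: "real \<Rightarrow> (nat \<Rightarrow> 'w \<Rightarrow> real) \<Rightarrow> nat \<Rightarrow> 'w \<Rightarrow> nat \<Rightarrow> real" where
  "emp_coeff a X N w i =
     (LINT x:{0..}|interval_measure (emp_cdf X N w). exp (- (a * x)) * (a * x) ^ i / fact i)"

fun point_est :: "(nat \<Rightarrow> real) \<Rightarrow> real \<Rightarrow> nat \<Rightarrow> real" where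
  "point_est r q0 n =
     (if n = 0 then q0
      else if n = 1 then 1 / r 0 * q0
      else if n = 2 then (1 - r 1) / r 0 * point_est r q0 1
      else 1 / r 0 * ((1 - r 1) * point_est r q0 (n - 1) - (\<Sum>i\<in>{2..<n}. r i * point_est r q0 (n - i))))"

text \<open>
  The bounds are extended reals, as the upper ones are \<open>\<infinity>\<close> if \<open>r 0 \<le> eps\<close>; the lower ones with \<open>n \<ge> 3\<close>
  are then computed with these infinite values. The other convention concerns negative
  \<open>1 - r 1 - gam\<close>, which is replaced by \<open>0\<close> in the lower bounds.
\<close>

fun lower_est upper_est :: "(nat \<Rightarrow> real) \<Rightarrow> real \<Rightarrow> real \<Rightarrow> real \<Rightarrow> nat \<Rightarrow> ereal" where
  "lower_est r eps gam q0 n =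
     (if n = 0 then ereal q0
      else if n = 1 then ereal (1 / (r 0 + eps) * q0)
      else if n = 2 then
        (if 1 - r 1 - gam < 0 then 0 else ereal ((1 - r 1 - gam) / (r 0 + eps) ^ 2 * q0))
      else ereal (1 / (r 0 + eps)) *
        (ereal (if 1 - r 1 - gam < 0 then 0 else 1 - r 1 - gam) * lower_est r eps gam q0 (n - 1)
          - (\<Sum>i\<in>{2..<n}. ereal (r i + gam) * upper_est r eps gam q0 (n - i))))"
| "upper_est r eps gam q0 n =
     (if n = 0 then ereal q0
      else if r 0 \<le> eps then \<infinity>
      else if n = 1 then ereal (1 / (r 0 - eps) * q0)
      else if n = 2 then ereal ((1 - r 1 + gam) / (r 0 - eps) ^ 2 * q0)
      else ereal (1 / (r 0 - eps)) *
        (ereal (1 - r 1 + gam) * upper_est r eps gam q0 (n - 1)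
          - (\<Sum>i\<in>{2..<n}. ereal (r i - gam) * lower_est r eps gam q0 (n - i))))"

declare point_est.simps [simp del] lower_est.simps [simp del] upper_est.simps [simp del]

definition Phi :: "real \<Rightarrow> real" where
  "Phi x = 1 / sqrt (2 * pi) * (LINT y:{..x}|lborel. exp (- (y ^ 2 / 2)))"

end

theory Submission
  imports Defs "HOL-Real_Asymp.Real_Asymp"
begin

text \<open>
  All characteristics satisfy \<open>Q\<^sub>n = Q\<^sub>0 h\<^sub>n\<close> with \<open>h\<^sub>n = (\<Sum>i\<le>n. \<rho>\<^sub>i h\<^sub>n\<^sub>-\<^sub>i\<^sub>+\<^sub>1)\<close> and \<open>h\<^sub>0 = 1\<close>. For the M/GI/1/n
  queue, the mean reward collected in a busy period that starts with \<open>j\<close> customers is the unique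
  solution of the first-step equations of the embedded Markov chain, and these are solved explicitly in
  terms of \<open>h\<close>. For the GI/M/1/n-1 queue, the partial sums \<open>p\<^sub>n + p\<^sub>n\<^sub>-\<^sub>1 + \<dots> + p\<^sub>n\<^sub>-\<^sub>k\<close> of the stationary
  distribution, divided by \<open>p\<^sub>n\<close>, satisfy the recurrence for \<open>h\<close>, and the last one is \<open>1 / p\<^sub>n\<close>.

  Kolmogorov--Smirnov limits are not needed for the bounds. With
  \<open>r\<^sub>i = \<rho>\<^sub>i + z\<^sub>i / sqrt N\<close>, \<open>\<epsilon> = c / sqrt N\<close> and \<open>\<gamma> = d / sqrt N\<close>, the lower and upper bounds are
  \<open>Q\<^sub>n + (D\<^sub>n(z) \<plusminus> W\<^sub>n(c, d)) / sqrt N\<close> up to \<open>o(1 / sqrt N)\<close>, where \<open>D\<^sub>n\<close> is linear and \<open>W\<^sub>n\<close> obeys the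
  recursion of \<open>D\<^sub>n\<close> with all signs made positive, so that \<open>\<bar>D\<^sub>n(z)\<bar> \<le> b W\<^sub>n(1, 1)\<close> whenever all
  \<open>\<bar>z\<^sub>i\<bar> \<le> b\<close>. Hence \<open>D\<^sub>n(z)\<close> is a normalised sum of i.i.d. variables with range of length at most
  \<open>W\<^sub>n(1, 1)\<close>, thus asymptotically normal with standard deviation at most \<open>W\<^sub>n(1, 1) / 2\<close>. As \<open>\<gamma> \<ge> \<epsilon>\<close>, the
  coverage is asymptotically at least \<open>Pr(\<bar>Z\<bar> < 2 c) \<ge> 1 - exp (- 2 c\<^sup>2) = P\<close> for standard normal \<open>Z\<close>.
\<close>

section \<open>Poisson processes\<close>

text \<open>The expansion is a statement about deterministic \<open>z\<close> and \<open>d\<close>,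
  while the fluctuations of the sample are random and \<open>d = sqrt N * \<gamma>\<close> is only
  known to lie between \<open>c\<close> and a constant. So the remainder must be uniform over a box
  of all \<open>(z, d)\<close>: the expansion is carried out along an arbitrary filter, and the
  product of \<open>sequentially\<close> with the principal filter of the box yields one threshold
  for the whole box. Fluctuations leave a large box with small probability, by the same central
  limit argument applied to single coordinates. The factor 1/2 in the bound on the standard
  deviation comes from a single observation: each weight lies in [0, 1], hence within 1/2 of the
  value 1/2, and the bound on \<open>D\<close> is applied with \<open>b = 1/2\<close>. The
  covariances of the weights do not enter. It results from a nonnegative solution of the first-step
  equations, which bounds the partial sums of the survival probabilities and so also forces
  uniqueness.\<close>

definition poisson_weight :: "real \<Rightarrow> nat \<Rightarrow> real \<Rightarrow> real" where
  "poisson_weight a i x = exp (- (a * x)) * (a * x) ^ i / fact i"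

lemma poisson_weight_nonneg: "0 \<le> a \<Longrightarrow> 0 \<le> x \<Longrightarrow> 0 \<le> poisson_weight a i x"
  by (simp add: poisson_weight_def)

lemma poisson_weight_sums: "(\<lambda>i. poisson_weight a i x) sums 1"
proof -
  have "(\<lambda>i. exp (- (a * x)) * ((a * x) ^ i /\<^sub>R fact i)) sums (exp (- (a * x)) * exp (a * x))"
    by (intro sums_mult exp_converges)
  moreover have "exp (- (a * x)) * exp (a * x) = 1"
    by (simp add: exp_minus)
  ultimately show ?thesis
    by (simp add: poisson_weight_def divide_inverse mult_ac)
qed

lemma poisson_weight_le_1: "0 \<le> a \<Longrightarrow> 0 \<le> x \<Longrightarrow> poisson_weight a i x \<le> 1"
  using sum_le_suminf[OF sums_summable[OF poisson_weight_sums], of "{i}" a x]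
  by (simp add: poisson_weight_nonneg sums_unique[OF poisson_weight_sums, symmetric])

lemma borel_measurable_poisson_weight [measurable]: "poisson_weight a i \<in> borel_measurable borel"
  unfolding poisson_weight_def by measurable

text \<open>
  The events \<open>hits i e t\<close> say that \<open>i\<close> points lie in \<open>[0, t]\<close>, in a form suited to recursion over the
  gaps; \<open>residual i e t\<close> is then the stream of gaps as seen from time \<open>t\<close>.
\<close>

primrec hits :: "nat \<Rightarrow> real stream \<Rightarrow> real \<Rightarrow> bool" where
  "hits 0 e t \<longleftrightarrow> t < shd e"
| "hits (Suc i) e t \<longleftrightarrow> shd e \<le> t \<and> hits i (stl e) (t - shd e)"

primrec residual :: "nat \<Rightarrow> real stream \<Rightarrow> real \<Rightarrow> real stream" where
  "residual 0 e t = (shd e - t) ## stl e"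
| "residual (Suc i) e t = residual i (stl e) (t - shd e)"

text \<open>Outside this event \<open>points\<close> may be the cardinality of an infinite set,
  which is 0, and partial sums need not increase, so that \<open>hits\<close> and
  \<open>points\<close> may disagree.\<close>

definition good_gaps :: "real stream \<Rightarrow> bool" where
  "good_gaps e \<longleftrightarrow> (\<forall>j. 0 < e !! j) \<and> (\<forall>t. \<exists>j. t < (\<Sum>i\<le>j. e !! i))"

lemma hits_unique: "hits i e t \<Longrightarrow> hits j e t \<Longrightarrow> i = j"
proof (induction i arbitrary: j e t)
  case 0 then show ?case by (cases j) auto
next
  case (Suc i) then show ?case by (cases j) auto
qed

lemma sum_snth_atMost_Suc: "(\<Sum>i\<le>Suc j. e !! i) = shd e + (\<Sum>i\<le>j. stl e !! i)" for e :: "real stream"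
  by (subst sum.atMost_Suc_shift) simp

lemma good_gaps_stl: assumes "good_gaps e" shows "good_gaps (stl e)"
proof -
  have "\<exists>j. t < (\<Sum>i\<le>j. stl e !! i)" for t
  proof -
    have p: "\<And>j. 0 < e !! j" using assms by (auto simp: good_gaps_def)
    obtain j where "t + shd e < (\<Sum>i\<le>j. e !! i)"
      using assms by (auto simp: good_gaps_def)
    also have "\<dots> \<le> (\<Sum>i\<le>Suc j. e !! i)" using p[of "Suc j"] by (simp del: snth.simps)
    finally have "t < (\<Sum>i\<le>j. stl e !! i)" by (simp only: sum_snth_atMost_Suc)
    then show ?thesis by blast
  qed
  moreover have "0 < stl e !! j" for j
    using assms unfolding good_gaps_def by (metis snth.simps(2))
  ultimately show ?thesis by (auto simp: good_gaps_def)
qed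

lemma finite_points: assumes "good_gaps e" shows "finite {j. (\<Sum>i\<le>j. e !! i) \<le> t}"
proof -
  obtain m where m: "t < (\<Sum>i\<le>m. e !! i)" using assms by (auto simp: good_gaps_def)
  have "j < m" if "(\<Sum>i\<le>j. e !! i) \<le> t" for j
  proof (rule ccontr)
    assume "\<not> j < m"
    then have "(\<Sum>i\<le>m. e !! i) \<le> (\<Sum>i\<le>j. e !! i)"
      using assms by (intro sum_mono2) (auto simp: good_gaps_def less_imp_le)
    with m that show False by simp
  qed
  then have "{j. (\<Sum>i\<le>j. e !! i) \<le> t} \<subseteq> {..<m}" by blast
  then show ?thesis by (rule finite_subset) simp
qed

lemma shd_le_partial_sum: assumes "good_gaps e" shows "shd e \<le> (\<Sum>i\<le>j. e !! i)"
proof -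
  have "(\<Sum>i\<le>0. e !! i) \<le> (\<Sum>i\<le>j. e !! i)"
    using assms by (intro sum_mono2) (auto simp: good_gaps_def less_imp_le)
  then show ?thesis by simp
qed

lemma points_eq_0: "good_gaps e \<Longrightarrow> t < shd e \<Longrightarrow> points e t = 0"
proof -
  assume "good_gaps e" "t < shd e"
  then have "\<not> (\<Sum>i\<le>j. e !! i) \<le> t" for j
    using shd_le_partial_sum[of e j] by linarith
  then show ?thesis by (simp add: points_def)
qed

lemma points_eq_Suc:
  assumes "good_gaps e" "shd e \<le> t"
  shows "points e t = Suc (points (stl e) (t - shd e))"
proof -
  have "{j. (\<Sum>i\<le>j. e !! i) \<le> t} = insert 0 (Suc ` {j. (\<Sum>i\<le>j. stl e !! i) \<le> t - shd e})"
    (is "?A = ?B")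
  proof (rule set_eqI)
    show "j \<in> ?A \<longleftrightarrow> j \<in> ?B" for j
    proof (cases j)
      case (Suc k)
      then show ?thesis using sum_snth_atMost_Suc[of e k] by (auto simp del: sum.atMost_Suc)
    qed (use assms in auto)
  qed
  then show ?thesis
    using finite_points[OF good_gaps_stl[OF assms(1)]]
    by (simp add: points_def card_image)
qed

lemma hits_points: "good_gaps e \<Longrightarrow> hits i e t \<Longrightarrow> points e t = i"
  by (induction i arbitrary: e t) (auto simp: points_eq_0 points_eq_Suc good_gaps_stl)

lemma hits_ex: assumes "good_gaps e" shows "\<exists>i. hits i e t"
proof -
  obtain j where "t < (\<Sum>i\<le>j. e !! i)" using assms unfolding good_gaps_def by blast
  then show ?thesis using assms
  proof (induction j arbitrary: e t)
    case 0 then have "hits 0 e t" by simp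
    then show ?case by blast
  next
    case (Suc j)
    show ?case
    proof (cases "t < shd e")
      case True then have "hits 0 e t" by simp
      then show ?thesis by blast
    next
      case False
      have "\<exists>i. hits i (stl e) (t - shd e)"
        using Suc.prems(1) unfolding sum_snth_atMost_Suc
        by (intro Suc.IH good_gaps_stl Suc.prems) simp
      then obtain i where "hits i (stl e) (t - shd e)" by blast
      with False have "hits (Suc i) e t" by simp
      then show ?thesis by blast
    qed
  qed
qed

lemma hits_iff: "good_gaps e \<Longrightarrow> hits i e t \<longleftrightarrow> points e t = i"
  using hits_points hits_ex by blast

lemma good_residual:
  assumes "good_gaps e" "0 \<le> t" "hits i e t"
  shows "good_gaps (residual i e t)"
  using assms
proof (induction i arbitrary: e t)
  case 0
  have *: "(\<Sum>i\<le>j. residual 0 e t !! i) = (\<Sum>i\<le>j. e !! i) - t" for j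
    by (induction j) auto
  have "0 < residual 0 e t !! j" for j
  proof (cases j)
    case 0 then show ?thesis using "0.prems" by simp
  next
    case (Suc k)
    have "0 < e !! j" using "0.prems" unfolding good_gaps_def by blast
    then show ?thesis using Suc by simp
  qed
  moreover have "\<exists>j. u < (\<Sum>i\<le>j. residual 0 e t !! i)" for u
    unfolding * using "0.prems"(1) unfolding good_gaps_def by (metis less_diff_eq)
  ultimately show ?case unfolding good_gaps_def by blast
qed (auto simp: good_gaps_stl)

text \<open>This additivity moves the origin of time to \<open>t\<close>: counts at later times
  become counts of the restarted stream.\<close>

lemma points_residual:
  assumes "good_gaps e" "0 \<le> t" "hits i e t" "0 \<le> u"
  shows "points e (t + u) = i + points (residual i e t) u"
  using assms
proof (induction i arbitrary: e t)
  case 0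
  have *: "(\<Sum>i\<le>j. residual 0 e t !! i) = (\<Sum>i\<le>j. e !! i) - t" for j
    by (induction j) auto
  show ?case unfolding points_def * by (simp add: algebra_simps)
next
  case (Suc i)
  have "points e (t + u) = Suc (points (stl e) (t - shd e + u))"
    using Suc.prems by (subst points_eq_Suc) (auto simp: algebra_simps)
  also have "points (stl e) (t - shd e + u) = i + points (residual i (stl e) (t - shd e)) u"
    using Suc.prems by (intro Suc.IH good_gaps_stl) auto
  finally show ?case by simp
qed

section \<open>Independent exponential gaps and the Markov property at a fixed time\<close>

abbreviation exp_law :: "real \<Rightarrow> real measure" where
  "exp_law l \<equiv> density lborel (\<lambda>x. ennreal (exponential_density l x))"

lemma sets_exp_gaps [measurable_cong]: "sets (exp_gaps l) = sets (stream_space borel)"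
  unfolding exp_gaps_def by (rule sets_stream_space_cong) simp

lemma space_exp_gaps [simp]: "space (exp_gaps l) = UNIV"
  unfolding exp_gaps_def by (simp add: space_stream_space)

lemma prob_space_exp_gaps: "0 < l \<Longrightarrow> prob_space (exp_gaps l)"
  unfolding exp_gaps_def
  by (intro prob_space.prob_space_stream_space prob_space_exponential_density)

lemma measurable_hits [measurable (raw)]:
  assumes [measurable]: "f \<in> M \<rightarrow>\<^sub>M stream_space borel" "g \<in> borel_measurable M"
  shows "Measurable.pred M (\<lambda>x. hits i (f x) (g x))"
  using assms
proof (induction i arbitrary: f g)
  case (Suc i)
  note [measurable] = Suc.prems
  have [measurable]: "Measurable.pred M (\<lambda>x. hits i (stl (f x)) (g x - shd (f x)))"
    by (rule Suc.IH) measurable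
  show ?case by simp
qed simp

lemma measurable_residual [measurable (raw)]:
  assumes "f \<in> M \<rightarrow>\<^sub>M stream_space borel" "g \<in> borel_measurable M"
  shows "(\<lambda>x. residual i (f x) (g x)) \<in> M \<rightarrow>\<^sub>M stream_space borel"
  using assms
proof (induction i arbitrary: f g)
  case (Suc i)
  note [measurable] = Suc.prems
  show ?case unfolding residual.simps by (rule Suc.IH) measurable
next
  case 0
  note [measurable] = 0
  show ?case by simp
qed

lemma measurable_points [measurable (raw)]:
  assumes [measurable]: "f \<in> M \<rightarrow>\<^sub>M stream_space borel" "g \<in> borel_measurable M"
  shows "(\<lambda>x. points (f x) (g x)) \<in> M \<rightarrow>\<^sub>M count_space UNIV"
  unfolding points_def by measurable

lemma nn_integral_exp_gaps:
  assumes "0 < l" "f \<in> borel_measurable (stream_space borel)"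
  shows "(\<integral>\<^sup>+e. f e \<partial>exp_gaps l) =
    (\<integral>\<^sup>+x. ennreal (exponential_density l x) * (\<integral>\<^sup>+e. f (x ## e) \<partial>exp_gaps l) \<partial>lborel)"
proof -
  interpret E: prob_space "exp_law l" by (rule prob_space_exponential_density) fact
  interpret S: prob_space "exp_gaps l" by (rule prob_space_exp_gaps) fact
  have [measurable]: "f \<in> borel_measurable (stream_space borel)" by fact
  have "f \<in> borel_measurable (exp_gaps l)" by measurable
  then have "(\<integral>\<^sup>+e. f e \<partial>exp_gaps l) = (\<integral>\<^sup>+x. (\<integral>\<^sup>+e. f (x ## e) \<partial>exp_gaps l) \<partial>exp_law l)"
    using E.nn_integral_stream_space[of f] by (simp add: exp_gaps_def)
  also have "\<dots> = (\<integral>\<^sup>+x. ennreal (exponential_density l x) * (\<integral>\<^sup>+e. f (x ## e) \<partial>exp_gaps l) \<partial>lborel)"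
    by (intro nn_integral_density) measurable
  finally show ?thesis .
qed

text \<open>The Markov property at a fixed time: the number of points is Poisson, and the residual
  stream is independent of it with the law of a fresh stream. For \<open>i = 0\<close> this is the
  lack of memory of the exponential law; the induction step conditions on the first gap
  \<open>x\<close> and applies the hypothesis at the remaining time \<open>t - x\<close>.\<close>

lemma nn_integral_hits_residual:
  assumes "0 < l" "0 \<le> t" "\<phi> \<in> borel_measurable (stream_space borel)"
  shows "(\<integral>\<^sup>+e. indicator {e. hits i e t} e * \<phi> (residual i e t) \<partial>exp_gaps l) =
    ennreal (poisson_weight l i t) * (\<integral>\<^sup>+e. \<phi> e \<partial>exp_gaps l)"
  using assms(2)
proof (induction i arbitrary: t)
  interpret S: prob_space "exp_gaps l" by (rule prob_space_exp_gaps) fact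
  have [measurable]: "\<phi> \<in> borel_measurable (stream_space borel)" by fact
  have m [measurable]: "(\<lambda>e. indicator {e. hits i e t} e * \<phi> (residual i e t) :: ennreal)
      \<in> borel_measurable (stream_space borel)" for i t
    by measurable
  {
    case 0
    define \<Psi> where "\<Psi> x = (\<integral>\<^sup>+e. \<phi> (x ## e) \<partial>exp_gaps l)" for x
    have [measurable]: "\<Psi> \<in> borel_measurable borel" unfolding \<Psi>_def by measurable
    have "(\<integral>\<^sup>+e. indicator {e. hits 0 e t} e * \<phi> (residual 0 e t) \<partial>exp_gaps l) =
      (\<integral>\<^sup>+x. ennreal (exponential_density l x) * (\<integral>\<^sup>+e. indicator {t<..} x * \<phi> ((x - t) ## e) \<partial>exp_gaps l) \<partial>lborel)"
      unfolding nn_integral_exp_gaps[OF \<open>0 < l\<close> m] by (auto simp: indicator_def intro!: nn_integral_cong)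
    also have "\<dots> = (\<integral>\<^sup>+x. ennreal (exponential_density l x) * (indicator {t<..} x * \<Psi> (x - t)) \<partial>lborel)"
      unfolding \<Psi>_def by (subst nn_integral_cmult) (auto, measurable)
    also have "\<dots> = (\<integral>\<^sup>+x. ennreal (exponential_density l (t + x)) * (indicator {t<..} (t + x) * \<Psi> x) \<partial>lborel)"
      by (subst nn_integral_real_affine[where c=1 and t=t]) auto
    also have "\<dots> = (\<integral>\<^sup>+x. ennreal (poisson_weight l 0 t) * (ennreal (exponential_density l x) * \<Psi> x) \<partial>lborel)"
    \<comment> \<open>At \<open>x = 0\<close> the two sides may differ: the indicator is strict, but
      the density there is \<open>l\<close>.\<close>
    proof (intro nn_integral_cong_AE, use AE_lborel_singleton[of 0] in eventually_elim)
      fix x :: real assume "x \<noteq> 0"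
      have "exponential_density l (t + x) = poisson_weight l 0 t * exponential_density l x" if "0 < x"
      proof -
        have "- (t + x) * l = - (l * t) + - x * l" by algebra
        then have "exp (- (t + x) * l) = exp (- (l * t)) * exp (- x * l)" by (simp only: exp_add)
        then show ?thesis using that \<open>0 \<le> t\<close> by (simp add: exponential_density_def poisson_weight_def)
      qed
      moreover have "0 \<le> poisson_weight l 0 t" "\<And>x. 0 \<le> exponential_density l x"
        using \<open>0 < l\<close> \<open>0 \<le> t\<close> by (simp_all add: poisson_weight_def exponential_density_nonneg)
      moreover have "exponential_density l x = 0" if "x < 0" using that by (simp add: exponential_density_def)
      ultimately show "ennreal (exponential_density l (t + x)) * (indicator {t<..} (t + x) * \<Psi> x) =
        ennreal (poisson_weight l 0 t) * (ennreal (exponential_density l x) * \<Psi> x)"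
        using \<open>x \<noteq> 0\<close> by (cases "0 < x") (auto simp: ennreal_mult mult.assoc)
    qed
    also have "\<dots> = ennreal (poisson_weight l 0 t) * (\<integral>\<^sup>+e. \<phi> e \<partial>exp_gaps l)"
      using \<open>0 < l\<close> nn_integral_exp_gaps[OF \<open>0 < l\<close>, of \<phi>] by (subst nn_integral_cmult) (simp_all add: \<Psi>_def)
    finally show ?case .
  }
  {
    case (Suc i)
    let ?I = "\<integral>\<^sup>+e. \<phi> e \<partial>exp_gaps l"
    \<comment> \<open>In the product of the exponential density at \<open>x\<close> and the Poisson
      weight at \<open>t - x\<close> the exponentials combine to the constant
      \<open>exp (- l * t)\<close>. Only a power of \<open>t - x\<close> remains, so the product is
      \<open>?f\<close>, with antiderivative \<open>?F\<close>.\<close>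
    let ?F = "\<lambda>x. - (exp (- l * t) * (l * (t - x)) ^ Suc i / fact (Suc i))"
    let ?f = "\<lambda>x. l * exp (- l * t) * (l * (t - x)) ^ i / fact i"
    have "(\<integral>\<^sup>+e. indicator {e. hits (Suc i) e t} e * \<phi> (residual (Suc i) e t) \<partial>exp_gaps l) =
      (\<integral>\<^sup>+x. ennreal (exponential_density l x) * (\<integral>\<^sup>+e. indicator {..t} x *
          (indicator {e. hits i e (t - x)} e * \<phi> (residual i e (t - x))) \<partial>exp_gaps l) \<partial>lborel)"
      unfolding nn_integral_exp_gaps[OF \<open>0 < l\<close> m] by (auto simp: indicator_def intro!: nn_integral_cong)
    also have "\<dots> = (\<integral>\<^sup>+x. ennreal (exponential_density l x) * (indicator {..t} x *
          (ennreal (poisson_weight l i (t - x)) * ?I)) \<partial>lborel)"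
    proof (intro nn_integral_cong arg_cong2[where f="(*)"] refl)
      fix x :: real
      have "(\<integral>\<^sup>+e. indicator {..t} x * (indicator {e. hits i e (t - x)} e * \<phi> (residual i e (t - x))) \<partial>exp_gaps l)
        = indicator {..t} x * (\<integral>\<^sup>+e. indicator {e. hits i e (t - x)} e * \<phi> (residual i e (t - x)) \<partial>exp_gaps l)"
        by (rule nn_integral_cmult) measurable
      then show "(\<integral>\<^sup>+e. indicator {..t} x * (indicator {e. hits i e (t - x)} e * \<phi> (residual i e (t - x))) \<partial>exp_gaps l)
        = indicator {..t} x * (ennreal (poisson_weight l i (t - x)) * ?I)"
        using Suc.IH[of "t - x"] by (auto simp: indicator_def)
    qed
    also have "\<dots> = (\<integral>\<^sup>+x. ennreal (?f x) * indicator {0..t} x * ?I \<partial>lborel)"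
    proof (intro nn_integral_cong)
      fix x :: real
      have f: "exponential_density l x * poisson_weight l i (t - x) = ?f x" if "0 \<le> x"
      proof -
        have "- l * t = - x * l + - (l * (t - x))" by algebra
        then have "exp (- l * t) = exp (- x * l) * exp (- (l * (t - x)))" by (simp only: exp_add)
        then show ?thesis using that by (simp add: exponential_density_def poisson_weight_def)
      qed
      have 0: "exponential_density l x = 0" if "x < 0" using that by (simp add: exponential_density_def)
      show "ennreal (exponential_density l x) * (indicator {..t} x * (ennreal (poisson_weight l i (t - x)) * ?I))
        = ennreal (?f x) * indicator {0..t} x * ?I"
      proof (cases "0 \<le> x \<and> x \<le> t")
        case True
        then have "ennreal (?f x) = ennreal (exponential_density l x) * ennreal (poisson_weight l i (t - x))"
          using \<open>0 < l\<close> by (subst ennreal_mult[symmetric])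
            (auto simp: f exponential_density_nonneg poisson_weight_nonneg)
        then show ?thesis using True by (simp add: mult.assoc)
      qed (auto simp: 0 indicator_def not_le)
    qed
    also have "\<dots> = (\<integral>\<^sup>+x. ennreal (?f x) * indicator {0..t} x \<partial>lborel) * ?I"
      by (rule nn_integral_multc) measurable
    also have "(\<integral>\<^sup>+x. ennreal (?f x) * indicator {0..t} x \<partial>lborel) = ennreal (?F t - ?F 0)"
    proof (rule nn_integral_FTC_Icc)
      fix x :: real
      have "((\<lambda>x. l * (t - x)) has_real_derivative - l) (at x)"
        by (auto intro!: derivative_eq_intros)
      from DERIV_power_Suc[OF this, of i]
      have "((\<lambda>x. (l * (t - x)) ^ Suc i) has_real_derivative - (l * (real (Suc i) * (l * (t - x)) ^ i))) (at x)"
        by (simp add: mult_ac)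
      then have "(?F has_real_derivative - (exp (- l * t) * (- (l * (real (Suc i) * (l * (t - x)) ^ i))) / fact (Suc i))) (at x)"
        by (intro DERIV_minus DERIV_cdivide DERIV_cmult)
      moreover have "- (exp (- l * t) * (- (l * (real (Suc i) * (l * (t - x)) ^ i))) / fact (Suc i)) = ?f x"
        by (simp add: field_simps del: of_nat_Suc)
      ultimately show "(?F has_real_derivative ?f x) (at x)" by (rule back_subst)
    qed (use \<open>0 < l\<close> \<open>0 \<le> t\<close> in auto)
    also have "?F t - ?F 0 = poisson_weight l (Suc i) t"
      by (simp add: poisson_weight_def)
    finally show ?case .
  }
qed

text \<open>The divergence of the partial sums comes from the Poisson weights adding up to 1: they
  are the probabilities of the disjoint events \<open>hits i e t\<close>, so almost surely one of
  these holds, and then some partial sum exceeds \<open>t\<close>. Natural \<open>t\<close>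
  suffice.\<close>

lemma AE_good_gaps: assumes "0 < l" shows "AE e in exp_gaps l. good_gaps e"
proof -
  interpret E: prob_space "exp_law l" by (rule prob_space_exponential_density) fact
  interpret S: prob_space "exp_gaps l" by (rule prob_space_exp_gaps) fact
  have "AE x in exp_law l. 0 < x"
    using AE_lborel_singleton[of "0::real"]
    by (subst AE_density) (auto elim!: eventually_mono simp: exponential_density_def)
  then have pos: "AE e in exp_gaps l. \<forall>j. 0 < e !! j"
    unfolding exp_gaps_def using E.AE_stream_all[of "\<lambda>x. 0 < x"] by (simp add: stream_all_def sset_range)
  have "AE e in exp_gaps l. \<exists>i. hits i e t" if "0 \<le> t" for t
  proof -
    have [measurable]: "{e. hits i e t} \<in> sets (exp_gaps l)" for i
    proof -
      have "Measurable.pred (exp_gaps l) (\<lambda>e. hits i e t)" by measurable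
      then show ?thesis by (simp add: pred_def)
    qed
    have m: "{e. \<exists>i. hits i e t} = (\<Union>i. {e. hits i e t})" by auto
    have e: "emeasure (exp_gaps l) {e. hits i e t} = ennreal (poisson_weight l i t)" for i
    proof -
      have "emeasure (exp_gaps l) {e. hits i e t} = (\<integral>\<^sup>+e. indicator {e. hits i e t} e * 1 \<partial>exp_gaps l)"
        by (simp only: mult_1_right) (simp only: nn_integral_indicator \<open>{e. hits i e t} \<in> sets (exp_gaps l)\<close>)
      also have "\<dots> = ennreal (poisson_weight l i t) * (\<integral>\<^sup>+e. 1 \<partial>exp_gaps l)"
        by (rule nn_integral_hits_residual[OF assms that]) simp
      also have "(\<integral>\<^sup>+e. 1 \<partial>exp_gaps l) = 1"
        using S.emeasure_space_1 by simp
      finally show ?thesis by simp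
    qed
    have "emeasure (exp_gaps l) {e. \<exists>i. hits i e t} = (\<Sum>i. emeasure (exp_gaps l) {e. hits i e t})"
      unfolding m by (intro suminf_emeasure[symmetric]) (auto simp: disjoint_family_on_def dest: hits_unique)
    also have "\<dots> = ennreal (\<Sum>i. poisson_weight l i t)"
      unfolding e using assms that
      by (intro suminf_ennreal2 poisson_weight_nonneg sums_summable[OF poisson_weight_sums]) auto
    also have "\<dots> = 1" by (simp add: sums_unique[OF poisson_weight_sums, symmetric])
    finally have "S.prob {e. \<exists>i. hits i e t} = 1" by (simp add: S.emeasure_eq_measure)
    then show ?thesis using S.AE_in_set_eq_1[of "{e. \<exists>i. hits i e t}"] m by auto
  qed
  then have "AE e in exp_gaps l. \<forall>n. \<exists>i. hits i e (real n)"
    by (subst AE_all_countable) auto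
  with pos show ?thesis
  proof eventually_elim
    fix e assume e: "\<forall>j. 0 < e !! j" "\<forall>n. \<exists>i. hits i e (real n)"
    have h: "\<exists>j. t < (\<Sum>i\<le>j. e !! i)" if "hits i e t" for i t and e :: "real stream"
      using that
    proof (induction i arbitrary: e t)
      case 0 then show ?case by (intro exI[of _ 0]) simp
    next
      case (Suc i)
      then obtain j where "t - shd e < (\<Sum>i\<le>j. stl e !! i)" by auto
      then show ?case by (intro exI[of _ "Suc j"]) (simp only: sum_snth_atMost_Suc)
    qed
    show "good_gaps e" unfolding good_gaps_def
    proof (intro conjI allI)
      fix t :: real
      obtain n where "t \<le> real n" using real_arch_simple by blast
      with e(2) h show "\<exists>j. t < (\<Sum>i\<le>j. e !! i)" by (meson le_less_trans)
    qed (use e in auto)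
  qed
qed

lemma hits_iff_eq_points: "good_gaps e \<Longrightarrow> hits i e t \<longleftrightarrow> i = points e t"
  using hits_iff by metis

text \<open>For good gaps exactly one \<open>hits i e t\<close> holds, so the integrand is a series
  with at most one nonzero term, and the identity for each fixed \<open>i\<close> can be
  summed.\<close>

lemma nn_integral_points_residual:
  assumes "0 < l" "0 \<le> t" "\<And>i. F i \<in> borel_measurable (stream_space borel)"
  shows "(\<integral>\<^sup>+e. F (points e t) (residual (points e t) e t) \<partial>exp_gaps l) =
    (\<Sum>i. ennreal (poisson_weight l i t) * (\<integral>\<^sup>+e. F i e \<partial>exp_gaps l))"
proof -
  note [measurable] = assms(3)
  have "(\<integral>\<^sup>+e. F (points e t) (residual (points e t) e t) \<partial>exp_gaps l) =
      (\<integral>\<^sup>+e. (\<Sum>i. indicator {e. hits i e t} e * F i (residual i e t)) \<partial>exp_gaps l)"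
  proof (intro nn_integral_cong_AE, use AE_good_gaps[OF assms(1)] in eventually_elim)
    fix e assume "good_gaps e"
    then have "(\<Sum>i. indicator {e. hits i e t} e * F i (residual i e t)) =
        (\<Sum>i\<in>{points e t}. indicator {e. hits i e t} e * F i (residual i e t))"
      by (intro suminf_finite) (auto simp: hits_iff_eq_points)
    then show "F (points e t) (residual (points e t) e t) =
        (\<Sum>i. indicator {e. hits i e t} e * F i (residual i e t))"
      using \<open>good_gaps e\<close> by (simp add: hits_iff_eq_points)
  qed
  also have "\<dots> = (\<Sum>i. \<integral>\<^sup>+e. indicator {e. hits i e t} e * F i (residual i e t) \<partial>exp_gaps l)"
    by (rule nn_integral_suminf) measurable
  also have "\<dots> = (\<Sum>i. ennreal (poisson_weight l i t) * (\<integral>\<^sup>+e. F i e \<partial>exp_gaps l))"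
    by (intro suminf_cong nn_integral_hits_residual assms)
  finally show ?thesis .
qed

section \<open>The law of the input and the number of Poisson points in a random time\<close>

locale input_law = real_distribution G for G :: "real measure" +
  fixes a :: real
  assumes rate: "0 < a" and input_pos: "AE x in G. 0 < x"
begin

sublocale gaps: prob_space "exp_gaps a"
  by (rule prob_space_exp_gaps) (rule rate)

lemma emeasure_gaps_UNIV [simp]: "emeasure (exp_gaps a) UNIV = 1"
  using gaps.emeasure_space_1 by simp

lemma emeasure_input_UNIV [simp]: "emeasure G UNIV = 1"
  using emeasure_space_1 by simp

definition rho :: "nat \<Rightarrow> real" where
  "rho i = (LINT x|G. poisson_weight a i x)"

lemma integrable_poisson_weight: "integrable G (poisson_weight a i)"
proof (rule integrable_const_bound[where B=1])
  show "AE x in G. norm (poisson_weight a i x) \<le> 1"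
    using input_pos by eventually_elim (use rate in \<open>simp add: poisson_weight_nonneg poisson_weight_le_1\<close>)
qed simp

lemma nn_integral_poisson_weight: "(\<integral>\<^sup>+x. ennreal (poisson_weight a i x) \<partial>G) = ennreal (rho i)"
  unfolding rho_def
  by (intro nn_integral_eq_integral integrable_poisson_weight)
    (use input_pos rate in \<open>auto elim!: eventually_mono simp: poisson_weight_nonneg\<close>)

lemma rho_nonneg: "0 \<le> rho i"
  unfolding rho_def
  by (intro integral_nonneg_AE) (use input_pos rate in \<open>auto elim!: eventually_mono simp: poisson_weight_nonneg\<close>)

lemma nn_integral_sum_poisson_weight:
  "(\<integral>\<^sup>+x. (\<Sum>i. ennreal (poisson_weight a i x) * f i) \<partial>G) = (\<Sum>i. ennreal (rho i) * f i)"
  by (subst nn_integral_suminf) (auto simp: nn_integral_multc nn_integral_poisson_weight)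

lemma suminf_rho: "(\<Sum>i. ennreal (rho i)) = 1"
proof -
  have "(\<Sum>i. ennreal (rho i)) = (\<integral>\<^sup>+x. (\<Sum>i. ennreal (poisson_weight a i x)) \<partial>G)"
    using nn_integral_sum_poisson_weight[of "\<lambda>_. 1"] by simp
  also have "\<dots> = (\<integral>\<^sup>+x. 1 \<partial>G)"
  proof (intro nn_integral_cong_AE, use input_pos in eventually_elim)
    fix x :: real assume "0 < x"
    then have "(\<Sum>i. ennreal (poisson_weight a i x)) = ennreal (\<Sum>i. poisson_weight a i x)"
      using rate by (intro suminf_ennreal2 poisson_weight_nonneg sums_summable[OF poisson_weight_sums]) auto
    then show "(\<Sum>i. ennreal (poisson_weight a i x)) = 1"
      by (simp add: sums_unique[OF poisson_weight_sums, symmetric])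
  qed
  finally show ?thesis by simp
qed

lemma rho_pos_0: "0 < rho 0"
proof (rule ccontr)
  assume "\<not> 0 < rho 0"
  then have "rho 0 = 0" using rho_nonneg[of 0] by simp
  then have "(\<integral>\<^sup>+x. ennreal (poisson_weight a 0 x) \<partial>G) = 0"
    by (simp add: nn_integral_poisson_weight)
  then have "AE x in G. ennreal (poisson_weight a 0 x) = 0"
    by (subst (asm) nn_integral_0_iff_AE) auto
  then have "AE x in G. False"
    by (auto elim!: eventually_mono simp: poisson_weight_def ennreal_eq_0_iff not_le)
  then show False by simp
qed

text \<open>The mixed Poisson law of the number of points in an independent time with law
  \<open>G\<close>: arrivals during a service in one queue, potential departures between arrivals in
  the other.\<close>

definition arrivals_pmf :: "nat pmf" where
  "arrivals_pmf = embed_pmf rho"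

lemma pmf_arrivals [simp]: "pmf arrivals_pmf i = rho i"
  unfolding arrivals_pmf_def
  by (rule pmf_embed_pmf) (auto simp: rho_nonneg nn_integral_count_space_nat suminf_rho)

lemma nn_integral_arrivals: "(\<integral>\<^sup>+i. f i \<partial>measure_pmf arrivals_pmf) = (\<Sum>i. ennreal (rho i) * f i)"
  by (simp add: nn_integral_measure_pmf nn_integral_count_space_nat)

lemma sum_rho_le_1: "finite A \<Longrightarrow> (\<Sum>i\<in>A. rho i) \<le> 1"
  using measure_pmf.prob_le_1[of arrivals_pmf A] by (simp add: measure_measure_pmf_finite)

lemma nn_integral_points:
  "(\<integral>\<^sup>+x. (\<integral>\<^sup>+e. f (points e x) \<partial>exp_gaps a) \<partial>G) = (\<integral>\<^sup>+i. f i \<partial>measure_pmf arrivals_pmf)"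
proof -
  have "(\<integral>\<^sup>+x. (\<integral>\<^sup>+e. f (points e x) \<partial>exp_gaps a) \<partial>G) = (\<integral>\<^sup>+x. (\<Sum>i. ennreal (poisson_weight a i x) * f i) \<partial>G)"
  proof (intro nn_integral_cong_AE, use input_pos in eventually_elim)
    fix x :: real assume "0 < x"
    then show "(\<integral>\<^sup>+e. f (points e x) \<partial>exp_gaps a) = (\<Sum>i. ennreal (poisson_weight a i x) * f i)"
      using nn_integral_points_residual[OF rate, of x "\<lambda>i _. f i"] by simp
  qed
  then show ?thesis by (simp add: nn_integral_sum_poisson_weight nn_integral_arrivals)
qed

lemma prob_points:
  "measure (G \<Otimes>\<^sub>M exp_gaps a) {w \<in> space (G \<Otimes>\<^sub>M exp_gaps a). R (points (snd w) (fst w))} =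
    measure_pmf.prob arrivals_pmf {i. R i}"
proof -
  let ?S = "{w \<in> space (G \<Otimes>\<^sub>M exp_gaps a). R (points (snd w) (fst w))}"
  have [measurable]: "Measurable.pred (count_space UNIV) R" by simp
  have S [measurable]: "?S \<in> sets (G \<Otimes>\<^sub>M exp_gaps a)" by measurable
  have "emeasure (G \<Otimes>\<^sub>M exp_gaps a) ?S = (\<integral>\<^sup>+x. (\<integral>\<^sup>+e. indicator ?S (x, e) \<partial>exp_gaps a) \<partial>G)"
    by (rule gaps.emeasure_pair_measure[OF S])
  also have "\<dots> = (\<integral>\<^sup>+x. (\<integral>\<^sup>+e. indicator {i. R i} (points e x) \<partial>exp_gaps a) \<partial>G)"
    by (intro nn_integral_cong) (auto simp: indicator_def space_pair_measure)
  also have "\<dots> = emeasure arrivals_pmf {i. R i}"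
    by (subst nn_integral_points) simp
  finally show ?thesis by (simp add: measure_def)
qed

end

section \<open>The recurrence and the GI/M/1 queue\<close>

text \<open>The recurrence solved for its term of highest index, which has coefficient
  \<open>r 0\<close>; it starts at 1, so that every solution is a multiple of it.\<close>

fun char_seq :: "(nat \<Rightarrow> real) \<Rightarrow> nat \<Rightarrow> real" where
  "char_seq r n = (if n = 0 then 1
     else (char_seq r (n - 1) - (\<Sum>i\<in>{1..<n}. r i * char_seq r (n - i))) / r 0)"

declare char_seq.simps [simp del]

lemma char_seq_0 [simp]: "char_seq r 0 = 1"
  by (simp add: char_seq.simps)

lemma sum_atMost_shift_split: "(\<Sum>i\<le>n. r i * f (Suc n - i)) =
    r 0 * f (Suc n) + (\<Sum>i\<in>{1..<Suc n}. r i * f (Suc n - i))" for r f :: "nat \<Rightarrow> real"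
proof -
  have "{..n} = insert 0 {1..<Suc n}" by auto
  then show ?thesis by simp
qed

lemma char_seq_rec: "r 0 \<noteq> 0 \<Longrightarrow> char_seq r n = (\<Sum>i\<le>n. r i * char_seq r (Suc n - i))"
  by (subst sum_atMost_shift_split, subst (2) char_seq.simps) simp

text \<open>Finitely many equations are assumed because a stationary distribution on
  \<open>{..n}\<close> supplies only those with \<open>k < n\<close>.\<close>

lemma char_seq_unique:
  assumes "r 0 \<noteq> 0" "\<And>k. k < n \<Longrightarrow> f k = (\<Sum>i\<le>k. r i * f (Suc k - i))"
  shows "k \<le> n \<Longrightarrow> f k = f 0 * char_seq r k"
proof (induction k rule: less_induct)
  case (less k)
  show ?case
  proof (cases k)
    case (Suc m)
    have "f m = r 0 * f k + (\<Sum>i\<in>{1..<k}. r i * f (k - i))"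
    proof -
      have "m < n" using less.prems Suc by linarith
      from assms(2)[OF this] show ?thesis unfolding sum_atMost_shift_split Suc .
    qed
    moreover have "f m = f 0 * char_seq r m" using less.prems Suc by (intro less.IH) auto
    moreover have "(\<Sum>i\<in>{1..<k}. r i * f (k - i)) = f 0 * (\<Sum>i\<in>{1..<k}. r i * char_seq r (k - i))"
      unfolding sum_distrib_left
    proof (intro sum.cong refl)
      fix i assume "i \<in> {1..<k}"
      then have "f (k - i) = f 0 * char_seq r (k - i)" using less.prems by (intro less.IH) auto
      then show "r i * f (k - i) = f 0 * (r i * char_seq r (k - i))" by simp
    qed
    ultimately have "r 0 * f k = f 0 * (char_seq r m - (\<Sum>i\<in>{1..<k}. r i * char_seq r (k - i)))"
      by (simp add: algebra_simps)
    moreover have "char_seq r k = (char_seq r m - (\<Sum>i\<in>{1..<k}. r i * char_seq r (k - i))) / r 0"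
      unfolding Suc by (subst char_seq.simps) simp
    then have "r 0 * char_seq r k = char_seq r m - (\<Sum>i\<in>{1..<k}. r i * char_seq r (k - i))"
      using assms(1) by simp
    ultimately have "r 0 * f k = r 0 * (f 0 * char_seq r k)"
      by (simp only: mult.left_commute)
    then show ?thesis using assms(1) by simp
  qed simp
qed

context input_law begin

lemma gim1_step_eq:
  "gim1_step a G n j i = measure_pmf.prob arrivals_pmf {m. min (j + 1) n - m = i}"
  unfolding gim1_step_def found_next_def by (rule prob_points)

text \<open>State 0 is left out: truncated subtraction collects all large numbers of departures
  there, while every other state is reached by at most one number.\<close>

lemma gim1_step_pos:
  assumes "0 < i"
  shows "gim1_step a G n j i = (if i \<le> min (j + 1) n then rho (min (j + 1) n - i) else 0)"
proof (cases "i \<le> min (j + 1) n")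
  case True
  then have "{m. min (j + 1) n - m = i} = {min (j + 1) n - i}" using assms by auto
  then show ?thesis using True by (simp add: gim1_step_eq measure_pmf_single)
next
  case False
  then have "{m. min (j + 1) n - m = i} = {}" by auto
  then show ?thesis using False by (simp only: gim1_step_eq) simp
qed

lemma gim1_loss_prob_eq:
  assumes "gim1_loss_prob a G n x"
  shows "1 / x = char_seq rho n"
proof (cases n)
  case 0 then show ?thesis using assms by (simp add: gim1_loss_prob_def)
next
  case (Suc n')
  then obtain p where p: "set_pmf p \<subseteq> {..n}" "x = pmf p n"
    "\<And>i. i \<le> n \<Longrightarrow> pmf p i = (\<Sum>j\<le>n. pmf p j * gim1_step a G n j i)"
    using assms unfolding gim1_loss_prob_def gim1_stationary_def by (metis nat.distinct(1))
  \<comment> \<open>States are counted down from the full system, so that \<open>y 0\<close> is the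
    loss probability.\<close>
  define y where "y k = pmf p (n - k)" for k
  \<comment> \<open>A lost arrival leaves \<open>n\<close> customers behind, as does one that finds
    \<open>n - 1\<close>; state \<open>n\<close> thus adds the term \<open>y 0 * rho k\<close> to
    the plain recurrence.\<close>
  have y: "y k = y 0 * rho k + (\<Sum>i\<le>k. rho i * y (Suc k - i))" if "k < n" for k
  proof -
    have "y k = (\<Sum>j\<le>n. pmf p j * gim1_step a G n j (n - k))"
      unfolding y_def by (rule p) simp
    also have "\<dots> = (\<Sum>l\<le>n. y l * gim1_step a G n (n - l) (n - k))"
      unfolding y_def by (rule sum.reindex_bij_witness[of _ "\<lambda>l. n - l" "\<lambda>l. n - l"]) auto
    also have "\<dots> = y 0 * rho k + (\<Sum>l\<in>{1..n}. y l * gim1_step a G n (n - l) (n - k))"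
    proof -
      have "{..n} = insert 0 {1..n}" by auto
      then show ?thesis using that by (simp add: gim1_step_pos)
    qed
    also have "(\<Sum>l\<in>{1..n}. y l * gim1_step a G n (n - l) (n - k)) = (\<Sum>l\<in>{1..Suc k}. y l * rho (Suc k - l))"
      using that
      by (intro sum.mono_neutral_cong_right) (auto simp: gim1_step_pos min_def Suc_diff_le intro!: arg_cong[where f=rho])
    also have "\<dots> = (\<Sum>i\<le>k. rho i * y (Suc k - i))"
      by (rule sum.reindex_bij_witness[of _ "\<lambda>i. Suc k - i" "\<lambda>l. Suc k - l"]) auto
    finally show ?thesis .
  qed
  define Y where "Y k = (\<Sum>l\<le>k. y l)" for k
  have Y: "Y k = (\<Sum>i\<le>k. rho i * Y (Suc k - i))" if "k < n" for k
    using that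
  proof (induction k)
    case 0 then show ?case using y[of 0] by (simp add: Y_def algebra_simps)
  next
    case (Suc k)
    have "Y (Suc k) = Y k + y (Suc k)" by (simp add: Y_def)
    also have "\<dots> = (\<Sum>i\<le>k. rho i * Y (Suc k - i)) + y 0 * rho (Suc k) + (\<Sum>i\<le>Suc k. rho i * y (Suc (Suc k) - i))"
      using Suc y[of "Suc k"] by simp
    \<comment> \<open>Since \<open>y 0 + y 1 = Y 1\<close>, the extra term of \<open>y\<close>
      becomes the missing last summand of the recurrence for \<open>Y\<close>.\<close>
    also have "\<dots> = (\<Sum>i\<le>k. rho i * (Y (Suc k - i) + y (Suc (Suc k) - i))) + rho (Suc k) * (y 0 + y 1)"
      by (simp add: sum.distrib algebra_simps)
    also have "(\<Sum>i\<le>k. rho i * (Y (Suc k - i) + y (Suc (Suc k) - i))) = (\<Sum>i\<le>k. rho i * Y (Suc (Suc k) - i))"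
      by (intro sum.cong) (auto simp: Y_def Suc_diff_le)
    finally show ?case by (simp add: Y_def)
  qed
  have "Y n = y 0 * char_seq rho n"
    using char_seq_unique[of rho n Y n] Y rho_pos_0 by (simp add: Y_def)
  moreover have "Y n = 1"
  proof -
    have "Y n = (\<Sum>l\<le>n. pmf p l)"
      unfolding y_def Y_def by (rule sum.reindex_bij_witness[of _ "\<lambda>l. n - l" "\<lambda>l. n - l"]) auto
    also have "\<dots> = 1" using p(1) by (intro sum_pmf_eq_1) auto
    finally show ?thesis .
  qed
  ultimately have "x * char_seq rho n = 1" by (simp add: p y_def)
  then show ?thesis by (metis divide_eq_eq mult.commute mult_zero_left zero_neq_one)
qed

end

section \<open>The busy period of the M/GI/1 queue\<close>

context input_law begin

lemma integrable_arrivals_min: "integrable (measure_pmf arrivals_pmf) (\<lambda>i. f (min (j + i) n) :: real)"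
proof (rule measure_pmf.integrable_const_bound[where B="Max ((\<lambda>l. \<bar>f l\<bar>) ` {..n})"])
  show "AE i in measure_pmf arrivals_pmf. norm (f (min (j + i) n)) \<le> Max ((\<lambda>l. \<bar>f l\<bar>) ` {..n})"
    by (auto intro!: AE_pmfI)
qed simp

text \<open>The transition operator of the numbers of customers left at service ends, stopped at 0:
  with \<open>Suc j\<close> customers present one departs and \<open>j + i\<close> remain, cut off
  at \<open>n\<close>. The value 0 in state 0 ends the collection of rewards there.\<close>

primrec embedded_step :: "nat \<Rightarrow> (nat \<Rightarrow> real) \<Rightarrow> nat \<Rightarrow> real" where
  "embedded_step n f 0 = 0"
| "embedded_step n f (Suc j) = measure_pmf.expectation arrivals_pmf (\<lambda>i. f (min (j + i) n))"

lemma embedded_step_diff: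
  "embedded_step n (\<lambda>j. f j - g j) j = embedded_step n f j - embedded_step n g j"
  by (cases j) (simp_all add: integrable_arrivals_min)

lemma embedded_step_mono:
  "(\<And>j. j \<le> n \<Longrightarrow> f j \<le> g j) \<Longrightarrow> embedded_step n f j \<le> embedded_step n g j"
  by (cases j) (auto intro!: integral_mono integrable_arrivals_min)

lemma embedded_step_cmult: "embedded_step n (\<lambda>j. c * f j) j = c * embedded_step n f j"
  by (cases j) simp_all

lemma embedded_step_cong:
  assumes "\<And>j. j \<le> n \<Longrightarrow> f j = g j" shows "embedded_step n f j = embedded_step n g j"
  using assms by (cases j) simp_all

lemma embedded_step_sum:
  "(\<Sum>k\<in>A. embedded_step n (f k) j) = embedded_step n (\<lambda>j. \<Sum>k\<in>A. f k j) j"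
  by (cases j) (simp_all add: integrable_arrivals_min)

text \<open>The mean reward of service number \<open>k\<close>, counted from 0, in a busy period
  started with \<open>j\<close> customers, if a service begun with \<open>j\<close> customers has
  mean reward \<open>c j\<close>.\<close>

primrec mean_stage :: "nat \<Rightarrow> (nat \<Rightarrow> real) \<Rightarrow> nat \<Rightarrow> nat \<Rightarrow> real" where
  "mean_stage n c 0 j = (if j = 0 then 0 else c j)"
| "mean_stage n c (Suc k) j = embedded_step n (mean_stage n c k) j"

lemma mean_stage_at_0 [simp]: "mean_stage n c k 0 = 0"
  by (cases k) auto

lemma mean_stage_nonneg: "(\<And>j. 0 < j \<Longrightarrow> 0 \<le> c j) \<Longrightarrow> 0 \<le> mean_stage n c k j"
proof (induction k arbitrary: j)
  case (Suc k)
  have "embedded_step n (\<lambda>j. 0 * 0) j \<le> embedded_step n (mean_stage n c k) j"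
    by (rule embedded_step_mono) (use Suc in auto)
  then show ?case by (cases j) auto
qed auto

text \<open>The error after \<open>m\<close> stages solves the homogeneous equation.\<close>

lemma mean_stage_sum:
  assumes "g 0 = 0" "\<And>j. 0 < j \<Longrightarrow> j \<le> max n 1 \<Longrightarrow> g j = c j + embedded_step n g j"
  shows "j \<le> max n 1 \<Longrightarrow> (\<Sum>k<m. mean_stage n c k j) = g j - mean_stage n g m j"
proof (induction m arbitrary: j)
  case (Suc m)
  show ?case
  proof (cases "j = 0")
    case False
    have "(\<Sum>k<Suc m. mean_stage n c k j) = c j + (\<Sum>k<m. mean_stage n c (Suc k) j)"
      using False by (subst sum.lessThan_Suc_shift) simp
    also have "(\<Sum>k<m. mean_stage n c (Suc k) j) = embedded_step n (\<lambda>j. \<Sum>k<m. mean_stage n c k j) j"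
      by (simp add: embedded_step_sum)
    also have "\<dots> = embedded_step n (\<lambda>j. g j - mean_stage n g m j) j"
      by (intro embedded_step_cong Suc) auto
    finally show ?thesis using assms(2)[of j] False Suc.prems by (simp add: embedded_step_diff)
  qed (simp add: assms)
qed (simp add: assms(1))

definition partial_char_sum :: "nat \<Rightarrow> real" where "partial_char_sum n = (\<Sum>m\<in>{1..n}. char_seq rho m)"

lemma partial_char_sum_Suc: "partial_char_sum (Suc n) = partial_char_sum n + char_seq rho (Suc n)" by (simp add: partial_char_sum_def)
lemma partial_char_sum_0 [simp]: "partial_char_sum 0 = 0" by (simp add: partial_char_sum_def)

text \<open>This is \<open>char_seq_rec\<close> summed over the indices up to \<open>m\<close>, with
  the two sums exchanged; the 1 is \<open>char_seq rho 0\<close>, and the term with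
  \<open>i = Suc m\<close> is zero.\<close>

lemma partial_char_sum_rec: "(\<Sum>i\<le>Suc m. rho i * partial_char_sum (Suc m - i)) = 1 + partial_char_sum m"
proof (induction m)
  case 0
  have "1 = rho 0 * char_seq rho 1"
    using char_seq_rec[of rho 0] rho_pos_0 by simp
  then show ?case by (simp add: partial_char_sum_def)
next
  case (Suc m)
  have "(\<Sum>i\<le>Suc (Suc m). rho i * partial_char_sum (Suc (Suc m) - i)) = (\<Sum>i\<le>Suc m. rho i * partial_char_sum (Suc (Suc m) - i))"
    by simp
  also have "\<dots> = (\<Sum>i\<le>Suc m. rho i * (partial_char_sum (Suc m - i) + char_seq rho (Suc (Suc m) - i)))"
    by (intro sum.cong refl) (simp add: Suc_diff_le partial_char_sum_Suc)
  also have "\<dots> = 1 + partial_char_sum m + (\<Sum>i\<le>Suc m. rho i * char_seq rho (Suc (Suc m) - i))"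
    by (simp only: distrib_left sum.distrib Suc)
  also have "(\<Sum>i\<le>Suc m. rho i * char_seq rho (Suc (Suc m) - i)) = char_seq rho (Suc m)"
    using char_seq_rec[of rho "Suc m"] rho_pos_0 by simp
  finally show ?case by (simp add: partial_char_sum_Suc)
qed

lemma expectation_arrivals_finite_support:
  fixes f :: "nat \<Rightarrow> real"
  assumes "\<And>i. m < i \<Longrightarrow> f i = 0"
  shows "measure_pmf.expectation arrivals_pmf f = (\<Sum>i\<le>m. rho i * f i)"
  by (subst integral_measure_pmf[of "{..m}"]) (use assms in \<open>auto simp: not_less[symmetric]\<close>)

text \<open>
  The mean number of services until \<open>j\<close> customers are gone. The case \<open>n = 0\<close> is separate because the
  initial state \<open>1\<close> then exceeds \<open>n\<close>.
\<close>

definition mean_clear :: "nat \<Rightarrow> nat \<Rightarrow> real" where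
  "mean_clear n j = (if n = 0 then real (min j 1) else partial_char_sum n - partial_char_sum (n - j))"

lemma mean_clear_0 [simp]: "mean_clear n 0 = 0"
  by (simp add: mean_clear_def)

lemma mean_clear_1: "mean_clear n 1 = char_seq rho n"
  by (cases n) (auto simp: mean_clear_def partial_char_sum_Suc)

text \<open>One step changes \<open>n - j\<close> into \<open>Suc (n - j) - i\<close>, and truncated
  subtraction gives 0 exactly when the system is full. The mean over \<open>i\<close> is then a
  finite sum, evaluated by \<open>partial_char_sum_rec\<close>.\<close>

lemma mean_clear_eq:
  assumes "0 < j" "j \<le> max n 1"
  shows "mean_clear n j = 1 + embedded_step n (mean_clear n) j"
proof (cases "n = 0")
  case True
  then have "j = Suc 0" using assms by simp
  then show ?thesis using True by (simp add: mean_clear_def)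
next
  case False
  define m where "m = n - j"
  have j: "0 < j" "j \<le> n" using assms False by auto
  have f: "mean_clear n (min (j - 1 + i) n) = partial_char_sum n - partial_char_sum (Suc m - i)" for i
  proof -
    have "n - min (j - 1 + i) n = Suc m - i" unfolding m_def using j by auto
    then show ?thesis using False by (simp add: mean_clear_def)
  qed
  have fin: "measure_pmf.expectation arrivals_pmf (\<lambda>i. partial_char_sum (Suc m - i)) = 1 + partial_char_sum m"
    by (subst expectation_arrivals_finite_support[of "Suc m"]) (auto simp: partial_char_sum_rec simp del: sum.atMost_Suc)
  have int: "integrable (measure_pmf arrivals_pmf) (\<lambda>i. partial_char_sum (Suc m - i))"
    using integrable_arrivals_min[of "\<lambda>l. partial_char_sum (Suc m - l)" 0 "Suc m"] by (simp add: min_def)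
      (smt (verit) Bochner_Integration.integrable_cong diff_is_0_eq' diff_self_eq_0 nat_le_linear)
  have "embedded_step n (mean_clear n) j = measure_pmf.expectation arrivals_pmf (\<lambda>i. partial_char_sum n - partial_char_sum (Suc m - i))"
    using j f by (cases j) auto
  also have "\<dots> = partial_char_sum n - (1 + partial_char_sum m)"
    using int fin by simp
  finally show ?thesis using False by (simp add: mean_clear_def m_def)
qed

text \<open>\<open>mean_stage n (\<lambda>_. 1) m j\<close> is the probability that the busy period
  is still running after \<open>m\<close> services; a bounded function contributes at stage
  \<open>m\<close> at most its bound times this probability.\<close>

lemma mean_stage_bound:
  assumes "\<And>j. 0 < j \<Longrightarrow> j \<le> max n 1 \<Longrightarrow> \<bar>g j\<bar> \<le> B" "j \<le> max n 1"
  shows "\<bar>mean_stage n g m j\<bar> \<le> B * mean_stage n (\<lambda>_. 1) m j"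
  using assms(2)
proof (induction m arbitrary: j)
  case (Suc m)
  have u: "embedded_step n (mean_stage n g m) j \<le> embedded_step n (\<lambda>j. B * mean_stage n (\<lambda>_. 1) m j) j"
    by (rule embedded_step_mono) (use Suc.IH in \<open>simp add: abs_le_iff\<close>)
  have l: "embedded_step n (\<lambda>j. (- B) * mean_stage n (\<lambda>_. 1) m j) j \<le> embedded_step n (mean_stage n g m) j"
  proof (rule embedded_step_mono)
    fix j assume "j \<le> n"
    then have "\<bar>mean_stage n g m j\<bar> \<le> B * mean_stage n (\<lambda>_. 1) m j" by (intro Suc.IH) simp
    then show "(- B) * mean_stage n (\<lambda>_. 1) m j \<le> mean_stage n g m j" by simp
  qed
  show ?case using u l unfolding embedded_step_cmult by (simp add: abs_le_iff)
qed (use assms(1) in auto)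

text \<open>In the recurrence the values other than \<open>char_seq rho (Suc n)\<close> are at most
  \<open>char_seq rho n\<close> by induction, and their coefficients add up to at most
  \<open>1 - rho 0\<close>; what remains is \<open>rho 0\<close> times the first claim.\<close>

lemma char_seq_rho_mono: "char_seq rho n \<le> char_seq rho (Suc n) \<and> 1 \<le> char_seq rho n"
proof (induction n rule: less_induct)
  case (less n)
  have le: "char_seq rho k \<le> char_seq rho n" if "k \<le> n" for k
  proof -
    have "char_seq rho k \<le> char_seq rho (k + d)" if "k + d \<le> n" for d
      using that
    proof (induction d)
      case (Suc d)
      then show ?case using less[of "k + d"] by simp
    qed simp
    from this[of "n - k"] that show ?thesis by simp
  qed
  have one: "1 \<le> char_seq rho n" using le[of 0] by simp
  have "char_seq rho n = rho 0 * char_seq rho (Suc n) + (\<Sum>i\<in>{1..<Suc n}. rho i * char_seq rho (Suc n - i))"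
    using char_seq_rec[of rho n] rho_pos_0 unfolding sum_atMost_shift_split by simp
  also have "(\<Sum>i\<in>{1..<Suc n}. rho i * char_seq rho (Suc n - i)) \<le> (\<Sum>i\<in>{1..<Suc n}. rho i * char_seq rho n)"
    by (intro sum_mono mult_left_mono le rho_nonneg) auto
  also have "\<dots> = (\<Sum>i\<in>{1..<Suc n}. rho i) * char_seq rho n" by (rule sum_distrib_right[symmetric])
  also have "\<dots> \<le> (1 - rho 0) * char_seq rho n"
  proof (intro mult_right_mono)
    have "(\<Sum>i\<in>insert 0 {1..<Suc n}. rho i) \<le> 1" by (rule sum_rho_le_1) simp
    then show "(\<Sum>i\<in>{1..<Suc n}. rho i) \<le> 1 - rho 0" by simp
  qed (use one in simp)
  finally have "rho 0 * char_seq rho n \<le> rho 0 * char_seq rho (Suc n)" by (simp add: algebra_simps)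
  then show ?case using rho_pos_0 one by simp
qed

lemma partial_char_sum_mono: "m \<le> n \<Longrightarrow> partial_char_sum m \<le> partial_char_sum n"
  unfolding partial_char_sum_def using char_seq_rho_mono by (intro sum_mono2) (auto intro: order_trans[of 0 1])

lemma mean_clear_nonneg: "0 \<le> mean_clear n j"
  using partial_char_sum_mono[of "n - j" n] by (simp add: mean_clear_def)

text \<open>The survival probabilities have partial sums bounded by \<open>mean_clear\<close>, hence
  are summable and tend to 0, and the error \<open>mean_stage n g m j\<close> is dominated by a
  multiple of them. In particular the first-step equations have only one solution.\<close>

lemma mean_stage_sums:
  assumes "g 0 = 0" "\<And>j. 0 < j \<Longrightarrow> j \<le> max n 1 \<Longrightarrow> g j = c j + embedded_step n g j" "j \<le> max n 1"
  shows "(\<lambda>k. mean_stage n c k j) sums g j"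
proof -
  have "(\<Sum>k<m. mean_stage n (\<lambda>_. 1) k j) \<le> mean_clear n j" for m
  proof -
    have "(\<Sum>k<m. mean_stage n (\<lambda>_. 1) k j) = mean_clear n j - mean_stage n (mean_clear n) m j"
      by (rule mean_stage_sum) (use assms(3) mean_clear_eq in auto)
    also have "\<dots> \<le> mean_clear n j" by (simp add: mean_stage_nonneg mean_clear_nonneg)
    finally show ?thesis .
  qed
  then have "summable (\<lambda>k. mean_stage n (\<lambda>_. 1) k j)"
    by (intro summableI_nonneg_bounded[where x="mean_clear n j"] mean_stage_nonneg) auto
  then have z: "(\<lambda>k. mean_stage n (\<lambda>_. 1) k j) \<longlonglongrightarrow> 0" by (rule summable_LIMSEQ_zero)
  define B where "B = Max ((\<lambda>j. \<bar>g j\<bar>) ` {..max n 1})"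
  have "\<bar>g j\<bar> \<le> B" if "j \<le> max n 1" for j
    unfolding B_def by (rule Max_ge) (use that in auto)
  then have "norm (mean_stage n g m j) \<le> B * mean_stage n (\<lambda>_. 1) m j" for m
    using mean_stage_bound[of n g B j m] assms(3) by simp
  then have "(\<lambda>m. mean_stage n g m j) \<longlonglongrightarrow> 0"
    by (intro Lim_null_comparison[OF _ tendsto_mult_right_zero[OF z, of B]]) auto
  then have "(\<lambda>m. g j - mean_stage n g m j) \<longlonglongrightarrow> g j - 0" by (intro tendsto_intros)
  then show ?thesis
    unfolding sums_def using mean_stage_sum[of g n c j, OF assms(1,2)] assms(3) by simp
qed

end

section \<open>Rewards along a single path\<close>

lemma good_gaps_iff: "good_gaps e \<longleftrightarrow> (\<forall>j. 0 < e !! j) \<and> (\<forall>m::nat. \<exists>j. real m < (\<Sum>i\<le>j. e !! i))"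
proof -
  have "\<exists>j. t < (\<Sum>i\<le>j. e !! i)" if "\<forall>m::nat. \<exists>j. real m < (\<Sum>i\<le>j. e !! i)" for t
  proof -
    obtain m where "t \<le> real m" using real_arch_simple by blast
    with that show ?thesis by (meson le_less_trans)
  qed
  then show ?thesis unfolding good_gaps_def by blast
qed

text \<open>Restricting the times to natural numbers leaves countable quantifiers only.\<close>

lemma measurable_good_gaps [measurable]: "Measurable.pred (stream_space borel) good_gaps"
proof -
  have "Measurable.pred (stream_space borel)
      (\<lambda>e :: real stream. (\<forall>j. 0 < e !! j) \<and> (\<forall>m::nat. \<exists>j. real m < (\<Sum>i\<le>j. e !! i)))"
    by measurable
  then show ?thesis by (simp add: good_gaps_iff[abs_def])
qed

text \<open>
  The reward of the \<open>k\<close>-th service, with the arrival stream restarted at the end of every service, so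
  that the strong Markov property becomes a recursion (see \<open>stage_reward_eq\<close> for the original form).
\<close>

primrec stage_reward ::
    "nat \<Rightarrow> (nat \<Rightarrow> real \<Rightarrow> nat \<Rightarrow> real) \<Rightarrow> nat \<Rightarrow> nat \<Rightarrow> real stream \<Rightarrow> real stream \<Rightarrow> ennreal" where
  "stage_reward n c 0 j s e = (if j = 0 then 0 else ennreal (c j (shd s) (points e (shd s))))"
| "stage_reward n c (Suc k) j s e = (if j = 0 then 0 else
     stage_reward n c k (min (j - 1 + points e (shd s)) n) (stl s) (residual (points e (shd s)) e (shd s)))"

lemma measurable_stage_reward [measurable (raw)]:
  assumes c: "\<And>j i. (\<lambda>x. c j x i) \<in> borel_measurable borel"
    and "f \<in> M \<rightarrow>\<^sub>M stream_space borel" "g \<in> M \<rightarrow>\<^sub>M stream_space borel"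
  shows "(\<lambda>x. stage_reward n c k j (f x) (g x)) \<in> borel_measurable M"
  using assms(2,3)
proof (induction k arbitrary: j f g)
  case 0
  note [measurable] = 0
  have "(\<lambda>x. c j (shd (f x)) (points (g x) (shd (f x)))) \<in> borel_measurable M"
  proof (rule measurable_compose_countable[where g="\<lambda>x. points (g x) (shd (f x))"])
    show "(\<lambda>x. c j (shd (f x)) i) \<in> borel_measurable M" for i
      by (rule measurable_compose[OF _ c]) measurable
  qed measurable
  then show ?case by (cases "j = 0") simp_all
next
  case (Suc k)
  note [measurable] = Suc.prems
  have "(\<lambda>x. stage_reward n c k (min (j - 1 + points (g x) (shd (f x))) n) (stl (f x))
      (residual (points (g x) (shd (f x))) (g x) (shd (f x)))) \<in> borel_measurable M"
  proof (rule measurable_compose_countable[where g="\<lambda>x. points (g x) (shd (f x))"])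
    show "(\<lambda>x. stage_reward n c k (min (j - 1 + i) n) (stl (f x)) (residual i (g x) (shd (f x))))
        \<in> borel_measurable M" for i
      by (rule Suc.IH) measurable
  qed measurable
  then show ?case by (cases "j = 0") simp_all
qed

text \<open>\<open>in_system\<close> with an arbitrary initial number, as required when the process
  is restarted after a service.\<close>

primrec left_behind :: "nat \<Rightarrow> nat \<Rightarrow> real stream \<Rightarrow> real stream \<Rightarrow> nat \<Rightarrow> nat" where
  "left_behind n j s e 0 = j"
| "left_behind n j s e (Suc k) = min (left_behind n j s e k - 1 + arrivals_during s e k) n"

lemma in_system_eq: "in_system n s e k = left_behind n 1 s e k"
  by (induction k) auto

lemma arrivals_during_0: "good_gaps e \<Longrightarrow> arrivals_during s e 0 = points e (shd s)"
proof -
  assume e: "good_gaps e"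
  then have "0 < shd e" unfolding good_gaps_def by (metis snth.simps(1))
  then show ?thesis using points_eq_0[OF e, of 0] by (simp add: arrivals_during_def service_end_def)
qed

lemma service_end_Suc: "service_end s (Suc k) = shd s + service_end (stl s) k"
  unfolding service_end_def by (subst sum.lessThan_Suc_shift) simp

lemma service_end_nonneg: "(\<And>i. 0 < s !! i) \<Longrightarrow> 0 \<le> service_end s k"
  unfolding service_end_def by (intro sum_nonneg) (simp add: less_imp_le)

lemma snth_stl_pos: "(\<And>i. 0 < s !! i) \<Longrightarrow> 0 < stl s !! i" for s :: "real stream"
  using snth.simps(2) by metis

lemma snth_pos_shd: "(\<And>i. 0 < s !! i) \<Longrightarrow> 0 < shd s" for s :: "real stream"
  by (metis snth.simps(1))

text \<open>Neither service end lies before the first one, so \<open>points_residual\<close> splits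
  off the same number \<open>points e (shd s)\<close> from both counts, and it cancels in the
  difference.\<close>

lemma arrivals_during_Suc:
  assumes "good_gaps e" and s: "\<And>i. 0 < s !! i"
  shows "arrivals_during s e (Suc k) = arrivals_during (stl s) (residual (points e (shd s)) e (shd s)) k"
proof -
  have p: "points e (shd s + u) = points e (shd s) + points (residual (points e (shd s)) e (shd s)) u"
    if "0 \<le> u" for u
    by (rule points_residual) (use assms snth_pos_shd[OF s] that in \<open>auto simp: hits_iff less_imp_le\<close>)
  show ?thesis
    unfolding arrivals_during_def service_end_Suc[of s]
    using p[OF service_end_nonneg[OF snth_stl_pos[OF s], of k]]
      p[OF service_end_nonneg[OF snth_stl_pos[OF s], of "Suc k"]] by simp
qed

lemma left_behind_Suc:
  assumes "good_gaps e" "\<And>i. 0 < s !! i"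
  shows "left_behind n j s e (Suc k) =
    left_behind n (min (j - 1 + points e (shd s)) n) (stl s) (residual (points e (shd s)) e (shd s)) k"
proof (induction k)
  case 0 then show ?case using arrivals_during_0[OF assms(1)] by simp
next
  case (Suc k)
  then show ?case using arrivals_during_Suc[OF assms] by simp
qed

text \<open>Links the restarted recursion to the queue as defined. The condition expresses that the
  busy period has not ended before service \<open>k\<close>; the induction runs over all initial
  numbers and streams because each step changes them.\<close>

lemma stage_reward_eq:
  assumes "good_gaps e" "\<And>i. 0 < s !! i"
  shows "stage_reward n c k j s e = (if \<forall>l\<le>k. left_behind n j s e l \<noteq> 0
    then ennreal (c (left_behind n j s e k) (s !! k) (arrivals_during s e k)) else 0)"
  using assms
proof (induction k arbitrary: j s e)
  case 0 then show ?case by (simp add: arrivals_during_0)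
next
  case (Suc k)
  let ?e = "residual (points e (shd s)) e (shd s)"
  let ?j = "min (j - 1 + points e (shd s)) n"
  have good: "good_gaps ?e"
    by (rule good_residual) (use Suc.prems snth_pos_shd[OF Suc.prems(2)] in \<open>auto simp: hits_iff less_imp_le\<close>)
  have "stage_reward n c k ?j (stl s) ?e = (if \<forall>l\<le>k. left_behind n ?j (stl s) ?e l \<noteq> 0
      then ennreal (c (left_behind n ?j (stl s) ?e k) (stl s !! k) (arrivals_during (stl s) ?e k)) else 0)"
    by (rule Suc.IH[OF good snth_stl_pos[OF Suc.prems(2)]])
  note IH = this
  have alive: "(\<forall>l\<le>Suc k. left_behind n j s e l \<noteq> 0) \<longleftrightarrow>
      j \<noteq> 0 \<and> (\<forall>l\<le>k. left_behind n ?j (stl s) ?e l \<noteq> 0)"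
    unfolding left_behind_Suc[OF Suc.prems, symmetric]
    by (metis Suc_le_mono le0 left_behind.simps(1) not0_implies_Suc)
  have state: "left_behind n j s e (Suc k) = left_behind n ?j (stl s) ?e k"
    by (rule left_behind_Suc[OF Suc.prems])
  have arr: "arrivals_during s e (Suc k) = arrivals_during (stl s) ?e k"
    by (rule arrivals_during_Suc[OF Suc.prems])
  have "stage_reward n c (Suc k) j s e = (if j = 0 then 0 else stage_reward n c k ?j (stl s) ?e)"
    by (simp only: stage_reward.simps)
  then show ?case
    unfolding IH alive state arr snth.simps(2) by (cases "j = 0") (simp_all only: simp_thms if_True if_False)
qed

section \<open>Mean rewards over a busy period\<close>

context input_law begin

lemma nn_integral_mgi1_space:
  assumes "f \<in> borel_measurable (stream_space borel \<Otimes>\<^sub>M stream_space borel)"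
  shows "(\<integral>\<^sup>+w. f w \<partial>mgi1_space a G) = (\<integral>\<^sup>+s. (\<integral>\<^sup>+e. f (s, e) \<partial>exp_gaps a) \<partial>stream_space G)"
proof -
  have [measurable]: "f \<in> borel_measurable (stream_space borel \<Otimes>\<^sub>M stream_space borel)" by fact
  have [measurable_cong]: "sets (stream_space G) = sets (stream_space borel)"
    by (rule sets_stream_space_cong) simp
  have "f \<in> borel_measurable (stream_space G \<Otimes>\<^sub>M exp_gaps a)" by measurable
  then show ?thesis unfolding mgi1_space_def by (rule gaps.nn_integral_fst[symmetric])
qed

text \<open>Condition on the first service time \<open>x\<close>. By
  \<open>nn_integral_points_residual\<close> the arrivals in it are Poisson and the remaining gaps
  form a fresh independent stream, so the inner integral is the previous stage started from the new
  number; integrating the Poisson weights over \<open>G\<close> gives \<open>rho\<close>, that is,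
  one \<open>embedded_step\<close>.\<close>

lemma nn_integral_stage_reward:
  assumes c [measurable]: "\<And>j i. (\<lambda>x. c j x i) \<in> borel_measurable borel"
    and cbar: "\<And>j. 0 < j \<Longrightarrow> (\<integral>\<^sup>+x. (\<Sum>i. ennreal (poisson_weight a i x) * ennreal (c j x i)) \<partial>G) = ennreal (cbar j)"
    and cbar_nonneg: "\<And>j. 0 \<le> cbar j"
  shows "(\<integral>\<^sup>+s. (\<integral>\<^sup>+e. stage_reward n c k j s e \<partial>exp_gaps a) \<partial>stream_space G) = ennreal (mean_stage n cbar k j)"
proof -
  have [measurable_cong]: "sets (stream_space G) = sets (stream_space borel)"
    by (rule sets_stream_space_cong) simp
  interpret S: prob_space "stream_space G" by (rule prob_space_stream_space)
  show ?thesis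
  proof (induction k arbitrary: j)
    case 0
    show ?case
    proof (cases "j = 0")
      case False
      have "(\<integral>\<^sup>+s. (\<integral>\<^sup>+e. stage_reward n c 0 j s e \<partial>exp_gaps a) \<partial>stream_space G) =
        (\<integral>\<^sup>+x. (\<integral>\<^sup>+s. (\<integral>\<^sup>+e. stage_reward n c 0 j (x ## s) e \<partial>exp_gaps a) \<partial>stream_space G) \<partial>G)"
        by (rule nn_integral_stream_space) measurable
      also have "\<dots> = (\<integral>\<^sup>+x. (\<Sum>i. ennreal (poisson_weight a i x) * ennreal (c j x i)) \<partial>G)"
      proof (intro nn_integral_cong_AE, use input_pos in eventually_elim)
        fix x :: real assume "0 < x"
        then show "(\<integral>\<^sup>+s. (\<integral>\<^sup>+e. stage_reward n c 0 j (x ## s) e \<partial>exp_gaps a) \<partial>stream_space G) =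
          (\<Sum>i. ennreal (poisson_weight a i x) * ennreal (c j x i))"
          using False nn_integral_points_residual[OF rate, of x "\<lambda>i _. ennreal (c j x i)"] by (simp add: S.emeasure_space_1)
      qed
      finally show ?thesis using False cbar[of j] by simp
    qed simp
  next
    case (Suc k)
    show ?case
    proof (cases "j = 0")
      case False
      let ?E = "\<lambda>j. ennreal (mean_stage n cbar k j)"
      have "(\<integral>\<^sup>+s. (\<integral>\<^sup>+e. stage_reward n c (Suc k) j s e \<partial>exp_gaps a) \<partial>stream_space G) =
        (\<integral>\<^sup>+x. (\<integral>\<^sup>+s. (\<integral>\<^sup>+e. stage_reward n c (Suc k) j (x ## s) e \<partial>exp_gaps a) \<partial>stream_space G) \<partial>G)"
        by (rule nn_integral_stream_space) measurable
      also have "\<dots> = (\<integral>\<^sup>+x. (\<Sum>i. ennreal (poisson_weight a i x) * ?E (min (j - 1 + i) n)) \<partial>G)"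
      proof (intro nn_integral_cong_AE, use input_pos in eventually_elim)
        fix x :: real assume "0 < x"
        have "(\<integral>\<^sup>+e. stage_reward n c (Suc k) j (x ## s) e \<partial>exp_gaps a) =
            (\<Sum>i. ennreal (poisson_weight a i x) * (\<integral>\<^sup>+e. stage_reward n c k (min (j - 1 + i) n) s e \<partial>exp_gaps a))" for s
        proof -
          have "(\<lambda>e. stage_reward n c k i s e) \<in> borel_measurable (stream_space borel)" for i
            by (rule measurable_stage_reward[OF c]) (simp_all add: space_stream_space)
          from nn_integral_points_residual[OF rate _ this, of x "\<lambda>i. min (j - 1 + i) n"]
          show ?thesis using False \<open>0 < x\<close> by simp
        qed
        then have "(\<integral>\<^sup>+s. (\<integral>\<^sup>+e. stage_reward n c (Suc k) j (x ## s) e \<partial>exp_gaps a) \<partial>stream_space G) =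
          (\<integral>\<^sup>+s. (\<Sum>i. ennreal (poisson_weight a i x) * (\<integral>\<^sup>+e. stage_reward n c k (min (j - 1 + i) n) s e \<partial>exp_gaps a)) \<partial>stream_space G)"
          by (simp only:)
        also have "\<dots> = (\<Sum>i. \<integral>\<^sup>+s. ennreal (poisson_weight a i x) * (\<integral>\<^sup>+e. stage_reward n c k (min (j - 1 + i) n) s e \<partial>exp_gaps a) \<partial>stream_space G)"
          by (rule nn_integral_suminf) measurable
        also have "\<dots> = (\<Sum>i. ennreal (poisson_weight a i x) * ?E (min (j - 1 + i) n))"
        proof (rule suminf_cong)
          fix i
          have "(\<integral>\<^sup>+s. ennreal (poisson_weight a i x) * (\<integral>\<^sup>+e. stage_reward n c k (min (j - 1 + i) n) s e \<partial>exp_gaps a) \<partial>stream_space G)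
            = ennreal (poisson_weight a i x) * (\<integral>\<^sup>+s. (\<integral>\<^sup>+e. stage_reward n c k (min (j - 1 + i) n) s e \<partial>exp_gaps a) \<partial>stream_space G)"
            by (rule nn_integral_cmult) measurable
          then show "(\<integral>\<^sup>+s. ennreal (poisson_weight a i x) * (\<integral>\<^sup>+e. stage_reward n c k (min (j - 1 + i) n) s e \<partial>exp_gaps a) \<partial>stream_space G)
            = ennreal (poisson_weight a i x) * ?E (min (j - 1 + i) n)" by (simp only: Suc)
        qed
        finally show "(\<integral>\<^sup>+s. (\<integral>\<^sup>+e. stage_reward n c (Suc k) j (x ## s) e \<partial>exp_gaps a) \<partial>stream_space G) =
          (\<Sum>i. ennreal (poisson_weight a i x) * ?E (min (j - 1 + i) n))" .
      qed
      also have "\<dots> = (\<integral>\<^sup>+i. ?E (min (j - 1 + i) n) \<partial>measure_pmf arrivals_pmf)"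
        by (simp add: nn_integral_sum_poisson_weight nn_integral_arrivals)
      also have "\<dots> = ennreal (measure_pmf.expectation arrivals_pmf (\<lambda>i. mean_stage n cbar k (min (j - 1 + i) n)))"
        by (intro nn_integral_eq_integral integrable_arrivals_min) (simp add: mean_stage_nonneg cbar_nonneg)
      also have "\<dots> = ennreal (mean_stage n cbar (Suc k) j)"
        using False by (cases j) simp_all
      finally show ?thesis .
    qed simp
  qed
qed

lemma AE_mgi1_space:
  "AE w in mgi1_space a G. good_gaps (snd w) \<and> (\<forall>i. 0 < fst w !! i)"
proof -
  have [measurable_cong]: "sets (stream_space G) = sets (stream_space borel)"
    by (rule sets_stream_space_cong) simp
  interpret S: prob_space "stream_space G" by (rule prob_space_stream_space)
  have pos: "AE s in stream_space G. \<forall>i. 0 < s !! i"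
    using AE_stream_all[of "\<lambda>x. 0 < x"] input_pos by (simp add: stream_all_def sset_range)
  interpret pair_prob_space "stream_space G" "exp_gaps a" ..
  from pos have "AE s in stream_space G. AE e in exp_gaps a. good_gaps (snd (s, e)) \<and> (\<forall>i. 0 < fst (s, e) !! i)"
    by eventually_elim (use AE_good_gaps[OF rate] in \<open>auto elim: eventually_mono\<close>)
  moreover have "{w \<in> space (stream_space G \<Otimes>\<^sub>M exp_gaps a). good_gaps (snd w) \<and> (\<forall>i. 0 < fst w !! i)}
      \<in> sets (stream_space G \<Otimes>\<^sub>M exp_gaps a)"
    by measurable
  ultimately show ?thesis unfolding mgi1_space_def by (rule AE_pair_measure[rotated])
qed

text \<open>All stages are nonnegative, so sum and integral are exchanged without integrability;
  \<open>mean_stage_sums\<close> then adds up the stage means.\<close>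

lemma nn_integral_total_reward:
  assumes c [measurable]: "\<And>j i. (\<lambda>x. c j x i) \<in> borel_measurable borel"
    and cbar: "\<And>j. 0 < j \<Longrightarrow> (\<integral>\<^sup>+x. (\<Sum>i. ennreal (poisson_weight a i x) * ennreal (c j x i)) \<partial>G) = ennreal (cbar j)"
    and cbar_nonneg: "\<And>j. 0 \<le> cbar j"
    and g: "g 0 = 0" "\<And>j. 0 < j \<Longrightarrow> j \<le> max n 1 \<Longrightarrow> g j = cbar j + embedded_step n g j"
  shows "(\<integral>\<^sup>+w. (\<Sum>k. stage_reward n c k 1 (fst w) (snd w)) \<partial>mgi1_space a G) = ennreal (g 1)"
proof -
  have m [measurable_cong]: "sets (mgi1_space a G) = sets (stream_space borel \<Otimes>\<^sub>M stream_space borel)"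
    unfolding mgi1_space_def by (intro sets_pair_measure_cong sets_exp_gaps sets_stream_space_cong) simp
  have "(\<integral>\<^sup>+w. (\<Sum>k. stage_reward n c k 1 (fst w) (snd w)) \<partial>mgi1_space a G) =
    (\<Sum>k. \<integral>\<^sup>+w. stage_reward n c k 1 (fst w) (snd w) \<partial>mgi1_space a G)"
    by (rule nn_integral_suminf) measurable
  also have "\<dots> = (\<Sum>k. ennreal (mean_stage n cbar k 1))"
  proof (rule suminf_cong)
    fix k
    have "(\<integral>\<^sup>+w. stage_reward n c k 1 (fst w) (snd w) \<partial>mgi1_space a G) =
        (\<integral>\<^sup>+s. (\<integral>\<^sup>+e. stage_reward n c k 1 s e \<partial>exp_gaps a) \<partial>stream_space G)"
      by (subst nn_integral_mgi1_space) simp_all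
    then show "(\<integral>\<^sup>+w. stage_reward n c k 1 (fst w) (snd w) \<partial>mgi1_space a G) = ennreal (mean_stage n cbar k 1)"
      using nn_integral_stage_reward[OF assms(1-3)] by simp
  qed
  also have "\<dots> = ennreal (g 1)"
  proof -
    have "(\<lambda>k. mean_stage n cbar k 1) sums g 1"
      by (rule mean_stage_sums[OF g]) simp_all
    then show ?thesis
      by (subst suminf_ennreal2) (auto simp: sums_iff intro!: mean_stage_nonneg cbar_nonneg)
  qed
  finally show ?thesis .
qed

end

lemma measurable_nat_binop:
  fixes f g :: "'b \<Rightarrow> nat" and h :: "nat \<Rightarrow> nat \<Rightarrow> 'c"
  assumes "f \<in> M \<rightarrow>\<^sub>M count_space UNIV" "g \<in> M \<rightarrow>\<^sub>M count_space UNIV"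
  shows "(\<lambda>x. h (f x) (g x)) \<in> M \<rightarrow>\<^sub>M count_space UNIV"
  by (rule measurable_compose_countable[OF _ assms(1)], rule measurable_compose_countable[OF _ assms(2)]) simp

lemma measurable_service_end [measurable]:
  "(\<lambda>s. service_end s k) \<in> borel_measurable (stream_space borel)"
  unfolding service_end_def by measurable

lemma measurable_arrivals_during [measurable]:
  "(\<lambda>w. arrivals_during (fst w) (snd w) k) \<in> stream_space borel \<Otimes>\<^sub>M stream_space borel \<rightarrow>\<^sub>M count_space UNIV"
  unfolding arrivals_during_def by (rule measurable_nat_binop) measurable

lemma measurable_in_system [measurable]:
  "(\<lambda>w. in_system n (fst w) (snd w) k) \<in> stream_space borel \<Otimes>\<^sub>M stream_space borel \<rightarrow>\<^sub>M count_space UNIV"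
proof (induction k)
  case (Suc k)
  show ?case unfolding in_system.simps
    by (rule measurable_nat_binop[OF Suc measurable_arrivals_during, where h="\<lambda>x y. min (x - 1 + y) n"])
qed simp

lemma measurable_served [measurable]:
  "(\<lambda>w. served n (fst w) (snd w)) \<in> stream_space borel \<Otimes>\<^sub>M stream_space borel \<rightarrow>\<^sub>M count_space UNIV"
  unfolding served_def by measurable

text \<open>The hypothesis on \<open>k0\<close> makes the \<open>LEAST\<close> in
  \<open>served\<close> an actual zero of the number in the system; from there on all stages carry
  reward 0.\<close>

lemma suminf_stage_reward:
  assumes "good_gaps e" "\<And>i. 0 < s !! i" "in_system n s e k0 = 0"
    and "\<And>j x i. 0 \<le> x \<Longrightarrow> 0 \<le> c j x i"
  shows "(\<Sum>k. stage_reward n c k 1 s e) =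
    ennreal (\<Sum>k<served n s e. c (in_system n s e k) (s !! k) (arrivals_during s e k))"
proof -
  have z: "in_system n s e (served n s e) = 0"
    unfolding served_def using assms(3) by (rule LeastI)
  have nz: "in_system n s e l \<noteq> 0" if "l < served n s e" for l
    using not_less_Least[of l "\<lambda>k. in_system n s e k = 0"] that by (simp add: served_def)
  have "(\<Sum>k. stage_reward n c k 1 s e) = (\<Sum>k<served n s e. stage_reward n c k 1 s e)"
  proof (rule suminf_finite)
    fix k assume "k \<notin> {..<served n s e}"
    then have "served n s e \<le> k" by simp
    with z show "stage_reward n c k 1 s e = 0"
      unfolding stage_reward_eq[OF assms(1,2)] in_system_eq by auto
  qed simp
  also have "\<dots> = (\<Sum>k<served n s e. ennreal (c (in_system n s e k) (s !! k) (arrivals_during s e k)))"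
  proof (rule sum.cong[OF refl])
    fix k assume "k \<in> {..<served n s e}"
    then have "\<forall>l\<le>k. left_behind n 1 s e l \<noteq> 0" using nz unfolding in_system_eq by auto
    then show "stage_reward n c k 1 s e = ennreal (c (in_system n s e k) (s !! k) (arrivals_during s e k))"
      unfolding stage_reward_eq[OF assms(1,2)] in_system_eq by (rule if_P)
  qed
  also have "\<dots> = ennreal (\<Sum>k<served n s e. c (in_system n s e k) (s !! k) (arrivals_during s e k))"
    by (intro sum_ennreal assms(4) less_imp_le assms(2))
  finally show ?thesis .
qed

context input_law begin

lemma sets_mgi1_space [measurable_cong]:
  "sets (mgi1_space a G) = sets (stream_space borel \<Otimes>\<^sub>M stream_space borel)"
  unfolding mgi1_space_def by (intro sets_pair_measure_cong sets_exp_gaps sets_stream_space_cong) simp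

text \<open>Reward 1 per service counts the services; finiteness of its mean is what shows that the
  busy period ends.\<close>

lemma mean_stage_total_one:
  "(\<integral>\<^sup>+w. (\<Sum>k. stage_reward n (\<lambda>_ _ _. 1) k 1 (fst w) (snd w)) \<partial>mgi1_space a G) = ennreal (mean_clear n 1)"
proof (rule nn_integral_total_reward)
  show "(\<integral>\<^sup>+x. (\<Sum>i. ennreal (poisson_weight a i x) * ennreal 1) \<partial>G) = ennreal 1" for j
    using nn_integral_sum_poisson_weight[of "\<lambda>_. 1"] suminf_rho by simp
qed (use mean_clear_eq in auto)

text \<open>On a path whose busy period never ended every stage would have reward 1 and the total
  would be infinite, which a finite mean excludes almost surely.\<close>

lemma AE_busy_period_ends:
  "AE w in mgi1_space a G. \<exists>k. in_system n (fst w) (snd w) k = 0"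
proof -
  have "AE w in mgi1_space a G. (\<Sum>k. stage_reward n (\<lambda>_ _ _. 1) k 1 (fst w) (snd w)) \<noteq> \<infinity>"
    by (rule nn_integral_PInf_AE) (measurable, simp add: mean_stage_total_one[simplified])
  with AE_mgi1_space show ?thesis
  proof eventually_elim
    case (elim w)
    show ?case
    proof (rule ccontr)
      assume "\<not> ?thesis"
      then have "stage_reward n (\<lambda>_ _ _. 1) k 1 (fst w) (snd w) = 1" for k
        using stage_reward_eq[of "snd w" "fst w" n "\<lambda>_ _ _. 1" k 1] elim(1) in_system_eq by auto
      then have "(\<Sum>k. stage_reward n (\<lambda>_ _ _. 1) k 1 (fst w) (snd w)) = (\<Sum>k. 1)" by (simp only:)
      moreover have "(\<Sum>k::nat. 1 :: ennreal) = \<infinity>"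
        using nn_integral_count_space_nat[of "\<lambda>_. 1"] by simp
      ultimately show False using elim(2) by (simp only: simp_thms)
    qed
  qed
qed

text \<open>Almost surely the busy period ends and the finite sum equals the series of stages, so
  the integral is read off from the extended one; \<open>0 \<le> g 1\<close> makes this reading
  exact.\<close>

lemma mean_total_reward:
  assumes c: "\<And>j i. (\<lambda>x. c j x i) \<in> borel_measurable borel" "\<And>j x i. 0 \<le> x \<Longrightarrow> 0 \<le> c j x i"
    and cbar: "\<And>j. 0 < j \<Longrightarrow> (\<integral>\<^sup>+x. (\<Sum>i. ennreal (poisson_weight a i x) * ennreal (c j x i)) \<partial>G) = ennreal (cbar j)"
      "\<And>j. 0 \<le> cbar j"
    and g: "g 0 = 0" "\<And>j. 0 < j \<Longrightarrow> j \<le> max n 1 \<Longrightarrow> g j = cbar j + embedded_step n g j" "0 \<le> g 1"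
  shows "(LINT w|mgi1_space a G. (\<Sum>k<served n (fst w) (snd w). c (in_system n (fst w) (snd w) k)
      (fst w !! k) (arrivals_during (fst w) (snd w) k))) = g 1"
proof -
  let ?f = "\<lambda>w. (\<Sum>k<served n (fst w) (snd w). c (in_system n (fst w) (snd w) k)
      (fst w !! k) (arrivals_during (fst w) (snd w) k))"
  have meas: "?f \<in> borel_measurable (mgi1_space a G)"
  proof (rule measurable_compose_countable[where g="\<lambda>w. served n (fst w) (snd w)"])
    show "(\<lambda>w. \<Sum>k<m. c (in_system n (fst w) (snd w) k) (fst w !! k) (arrivals_during (fst w) (snd w) k))
        \<in> borel_measurable (mgi1_space a G)" for m
    proof (rule borel_measurable_sum)
      fix k
      show "(\<lambda>w. c (in_system n (fst w) (snd w) k) (fst w !! k) (arrivals_during (fst w) (snd w) k))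
          \<in> borel_measurable (mgi1_space a G)"
      proof (rule measurable_compose_countable[where g="\<lambda>w. in_system n (fst w) (snd w) k"],
          rule measurable_compose_countable[where g="\<lambda>w. arrivals_during (fst w) (snd w) k"])
        show "(\<lambda>w. c j (fst w !! k) i) \<in> borel_measurable (mgi1_space a G)" for j i
          by (rule measurable_compose[OF _ c(1)]) measurable
      qed measurable
    qed
  qed measurable
  have AE: "AE w in mgi1_space a G. 0 \<le> ?f w \<and>
      ennreal (?f w) = (\<Sum>k. stage_reward n c k 1 (fst w) (snd w))"
    using AE_mgi1_space AE_busy_period_ends[of n]
  proof eventually_elim
    case (elim w)
    then obtain k0 where "in_system n (fst w) (snd w) k0 = 0" by blast
    then have "(\<Sum>k. stage_reward n c k 1 (fst w) (snd w)) = ennreal (?f w)"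
      using elim by (intro suminf_stage_reward c(2)) auto
    moreover have "0 \<le> ?f w" using elim by (intro sum_nonneg c(2)) (auto intro: less_imp_le)
    ultimately show ?case by simp
  qed
  have "(LINT w|mgi1_space a G. ?f w) = enn2real (\<integral>\<^sup>+w. ennreal (?f w) \<partial>mgi1_space a G)"
    by (rule integral_eq_nn_integral[OF meas]) (use AE in \<open>auto elim: eventually_mono\<close>)
  also have "(\<integral>\<^sup>+w. ennreal (?f w) \<partial>mgi1_space a G) =
      (\<integral>\<^sup>+w. (\<Sum>k. stage_reward n c k 1 (fst w) (snd w)) \<partial>mgi1_space a G)"
    by (rule nn_integral_cong_AE) (use AE in \<open>auto elim: eventually_mono\<close>)
  also have "\<dots> = ennreal (g 1)" by (rule nn_integral_total_reward[OF c(1) cbar g(1,2)])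
  finally show ?thesis using g(3) by simp
qed

section \<open>The characteristics of the M/GI/1 queue\<close>

lemma mean_served_eq: "mean_served a G n = char_seq rho n"
proof -
  have "mean_served a G n = mean_clear n 1"
    unfolding mean_served_def
    using mean_total_reward[of "\<lambda>_ _ _. 1" "\<lambda>_. 1" "mean_clear n" n]
      nn_integral_sum_poisson_weight[of "\<lambda>_. 1"] suminf_rho mean_clear_eq mean_clear_nonneg[of n 1]
    by simp
  then show ?thesis by (simp only: mean_clear_1)
qed

lemma mean_busy_length_eq:
  assumes "integrable G (\<lambda>x. x)"
  shows "mean_busy_length a G n = expectation (\<lambda>x. x) * char_seq rho n"
proof -
  let ?b = "expectation (\<lambda>x. x)"
  have b: "0 \<le> ?b" using input_pos by (intro integral_nonneg_AE) (auto elim: eventually_mono)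
  have "mean_busy_length a G n = ?b * mean_clear n 1"
    unfolding mean_busy_length_def busy_length_def service_end_def
  proof (rule mean_total_reward[of "\<lambda>_ x _. x" "\<lambda>_. ?b" "\<lambda>j. ?b * mean_clear n j"])
    have "(\<integral>\<^sup>+x. (\<Sum>i. ennreal (poisson_weight a i x) * ennreal x) \<partial>G) = (\<integral>\<^sup>+x. ennreal x \<partial>G)"
    proof (intro nn_integral_cong_AE, use input_pos in eventually_elim)
      fix x :: real assume "0 < x"
      then have "(\<Sum>i. ennreal (poisson_weight a i x)) = ennreal (\<Sum>i. poisson_weight a i x)"
        using rate by (intro suminf_ennreal2 poisson_weight_nonneg sums_summable[OF poisson_weight_sums]) auto
      then show "(\<Sum>i. ennreal (poisson_weight a i x) * ennreal x) = ennreal x"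
        by (simp add: sums_unique[OF poisson_weight_sums, symmetric])
    qed
    also have "\<dots> = ennreal ?b"
      using assms input_pos by (intro nn_integral_eq_integral) (auto elim: eventually_mono)
    finally show "(\<integral>\<^sup>+x. (\<Sum>i. ennreal (poisson_weight a i x) * ennreal x) \<partial>G) = ennreal ?b" .
    show "?b * mean_clear n j = ?b + embedded_step n (\<lambda>j. ?b * mean_clear n j) j"
      if "0 < j" "j \<le> max n 1" for j
      unfolding embedded_step_cmult using mean_clear_eq[OF that] by (simp add: algebra_simps)
  qed (use b mean_clear_nonneg[of n 1] in auto)
  then show ?thesis by (simp only: mean_clear_1)
qed

text \<open>Given the time \<open>x\<close>, the Poisson mean \<open>a * x\<close> results from the
  shift \<open>poisson_weight a (Suc i) x * real (Suc i) = a * x * poisson_weight a i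
  x\<close>.\<close>

lemma mean_arrivals:
  assumes "integrable G (\<lambda>x. x)"
  shows "(\<integral>\<^sup>+i. ennreal (real i) \<partial>measure_pmf arrivals_pmf) = ennreal (a * expectation (\<lambda>x. x))"
proof -
  have "(\<integral>\<^sup>+i. ennreal (real i) \<partial>measure_pmf arrivals_pmf) =
      (\<integral>\<^sup>+x. (\<Sum>i. ennreal (poisson_weight a i x) * ennreal (real i)) \<partial>G)"
    by (simp add: nn_integral_arrivals nn_integral_sum_poisson_weight)
  also have "\<dots> = (\<integral>\<^sup>+x. ennreal (a * x) \<partial>G)"
  proof (intro nn_integral_cong_AE, use input_pos in eventually_elim)
    fix x :: real assume x: "0 < x"
    have "poisson_weight a (Suc i) x * real (Suc i) = a * x * poisson_weight a i x" for i
      by (simp add: poisson_weight_def field_simps del: of_nat_Suc)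
    then have "(\<lambda>i. poisson_weight a (Suc i) x * real (Suc i)) sums (a * x * 1)"
      using sums_mult[OF poisson_weight_sums[of a x], of "a * x"] by simp
    then have s: "(\<lambda>i. poisson_weight a i x * real i) sums (a * x)"
      by (subst (asm) sums_Suc_iff) simp
    have "(\<Sum>i. ennreal (poisson_weight a i x) * ennreal (real i)) = (\<Sum>i. ennreal (poisson_weight a i x * real i))"
      using rate x by (simp add: ennreal_mult poisson_weight_nonneg)
    also have "\<dots> = ennreal (\<Sum>i. poisson_weight a i x * real i)"
      using rate x s by (intro suminf_ennreal2) (auto simp: sums_iff poisson_weight_nonneg)
    finally show "(\<Sum>i. ennreal (poisson_weight a i x) * ennreal (real i)) = ennreal (a * x)"
      using s by (simp add: sums_iff)
  qed
  also have "\<dots> = ennreal (expectation (\<lambda>x. a * x))"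
    using assms input_pos rate by (intro nn_integral_eq_integral) (auto elim!: eventually_mono)
  finally show ?thesis by simp
qed

lemma mean_lost_eq:
  assumes "integrable G (\<lambda>x. x)"
  shows "mean_lost a G n = (a * expectation (\<lambda>x. x) - 1) * char_seq rho n + 1"
proof -
  let ?b = "expectation (\<lambda>x. x)"
  have b: "0 \<le> ?b" using input_pos by (intro integral_nonneg_AE) (auto elim: eventually_mono)
  have int: "integrable (measure_pmf arrivals_pmf) (\<lambda>i. real i)"
    by (rule integrableI_nonneg) (auto simp: mean_arrivals[OF assms])
  have exp: "measure_pmf.expectation arrivals_pmf (\<lambda>i. real i) = a * ?b"
    using mean_arrivals[OF assms] b rate by (subst integral_eq_nn_integral) auto
  have intl: "integrable (measure_pmf arrivals_pmf) (\<lambda>i. real (j - 1 + i - n))" for j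
    by (rule Bochner_Integration.integrable_bound[where f="\<lambda>i. real j + real i"]) (use int in auto)
  define c where "c j = measure_pmf.expectation arrivals_pmf (\<lambda>i. real (j - 1 + i - n))" for j
  \<comment> \<open>Balance over a busy period started with \<open>j\<close> customers:
    \<open>j\<close> plus the arrivals equals the served plus the lost, and on average
    \<open>a * ?b\<close> customers arrive per service.\<close>
  define g where "g j = (a * ?b - 1) * mean_clear n j + real j" for j
  have c0: "0 \<le> c j" for j by (simp add: c_def)
  have g0: "g 0 = 0" by (simp add: g_def)
  have eq: "g j = c j + embedded_step n g j" if j: "0 < j" "j \<le> max n 1" for j
  proof -
    obtain l where l: "j = Suc l" using j by (cases j) auto
    have "c j + embedded_step n real j =
        measure_pmf.expectation arrivals_pmf (\<lambda>i. real (j - 1 + i - n) + real (min (l + i) n))"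
      unfolding c_def l using intl[of "Suc l"] integrable_arrivals_min[of real l n] by simp
    \<comment> \<open>The overflow beyond \<open>n\<close> and the number cut off at
      \<open>n\<close> add up to the uncut number.\<close>
    also have "(\<lambda>i. real (j - 1 + i - n) + real (min (l + i) n)) = (\<lambda>i. real l + real i)"
      unfolding l by (auto simp: min_def)
    also have "measure_pmf.expectation arrivals_pmf (\<lambda>i. real l + real i) = real l + a * ?b"
      using int by (simp add: exp)
    finally have "c j + embedded_step n real j = real j - 1 + a * ?b" by (simp add: l)
    moreover have "embedded_step n g j = (a * ?b - 1) * embedded_step n (mean_clear n) j + embedded_step n real j"
      unfolding g_def l using integrable_arrivals_min[of "mean_clear n" l n] integrable_arrivals_min[of real l n] by simp
    moreover have "mean_clear n j = 1 + embedded_step n (mean_clear n) j" by (rule mean_clear_eq[OF j])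
    ultimately show ?thesis unfolding g_def by (simp add: algebra_simps)
  qed
  \<comment> \<open>The factor \<open>a * ?b - 1\<close> in \<open>g\<close> may be negative, so
    nonnegativity of \<open>g 1\<close> is taken from the series of nonnegative stage means.\<close>
  have "(\<lambda>k. mean_stage n c k 1) sums g 1"
    by (rule mean_stage_sums[OF g0 eq]) auto
  then have g1: "0 \<le> g 1"
    by (rule sums_le[OF _ sums_zero, rotated]) (simp add: mean_stage_nonneg c0)
  have "mean_lost a G n = g 1"
    unfolding mean_lost_def lost_def of_nat_sum
  proof (rule mean_total_reward[of "\<lambda>j _ i. real (j - 1 + i - n)" c])
    show "(\<integral>\<^sup>+x. (\<Sum>i. ennreal (poisson_weight a i x) * ennreal (real (j - 1 + i - n))) \<partial>G) = ennreal (c j)" for j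
      unfolding nn_integral_sum_poisson_weight nn_integral_arrivals[symmetric] c_def
      by (intro nn_integral_eq_integral intl) simp
  qed (use eq c0 g0 g1 in auto)
  then show ?thesis by (simp add: g_def mean_clear_1[simplified])
qed

lemma characteristic_eq:
  assumes "queueing_characteristic a G Q"
  shows "Q n = Q 0 * char_seq rho n"
  using assms unfolding queueing_characteristic_def
proof (elim disjE)
  assume "\<forall>n. \<exists>x. gim1_loss_prob a G n x \<and> Q n = 1 / x"
  then have "Q k = char_seq rho k" for k by (metis gim1_loss_prob_eq)
  then show ?thesis by simp
qed (auto simp: mean_served_eq mean_busy_length_eq mean_lost_eq)

end

section \<open>First-order expansion of the estimators\<close>

text \<open>\<open>F = x + h D + o(h)\<close> with a bounded \<open>D\<close> that may vary along
  the filter and need not converge; a derivative in a fixed direction would not cover fluctuating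
  coefficients.\<close>

definition first_order :: "'b filter \<Rightarrow> ('b \<Rightarrow> real) \<Rightarrow> ('b \<Rightarrow> real) \<Rightarrow> real \<Rightarrow> ('b \<Rightarrow> real) \<Rightarrow> bool" where
  "first_order \<Phi> h F x D \<longleftrightarrow> (\<exists>B. \<forall>\<^sub>F p in \<Phi>. \<bar>D p\<bar> \<le> B) \<and> ((\<lambda>p. (F p - x) / h p - D p) \<longlongrightarrow> 0) \<Phi>"

lemma tendsto_bounded_mult_0:
  fixes D f :: "'b \<Rightarrow> real"
  assumes "\<forall>\<^sub>F p in \<Phi>. \<bar>D p\<bar> \<le> B" "(f \<longlongrightarrow> 0) \<Phi>"
  shows "((\<lambda>p. D p * f p) \<longlongrightarrow> 0) \<Phi>"
proof (rule Lim_null_comparison)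
  show "\<forall>\<^sub>F p in \<Phi>. norm (D p * f p) \<le> B * \<bar>f p\<bar>"
    using assms(1) by eventually_elim (simp add: abs_mult mult_right_mono)
  show "((\<lambda>p. B * \<bar>f p\<bar>) \<longlongrightarrow> 0) \<Phi>"
    using tendsto_mult_right_zero[OF tendsto_rabs_zero[OF assms(2)], of B] .
qed

context
  fixes \<Phi> :: "'b filter" and h :: "'b \<Rightarrow> real"
  assumes h0: "(h \<longlongrightarrow> 0) \<Phi>" and h_pos: "\<forall>\<^sub>F p in \<Phi>. 0 < h p"
begin

lemma first_order_tendsto: assumes "first_order \<Phi> h F x D" shows "(F \<longlongrightarrow> x) \<Phi>"
proof -
  obtain B where B: "\<forall>\<^sub>F p in \<Phi>. \<bar>D p\<bar> \<le> B" using assms by (auto simp: first_order_def)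
  have "((\<lambda>p. h p * ((F p - x) / h p - D p) + D p * h p + x) \<longlongrightarrow> 0 * 0 + 0 + x) \<Phi>"
    using assms by (intro tendsto_intros h0 tendsto_bounded_mult_0[OF B]) (auto simp: first_order_def)
  then have "((\<lambda>p. h p * ((F p - x) / h p - D p) + D p * h p + x) \<longlongrightarrow> x) \<Phi>" by simp
  then show ?thesis
  proof (rule Lim_transform_eventually)
    show "\<forall>\<^sub>F p in \<Phi>. h p * ((F p - x) / h p - D p) + D p * h p + x = F p"
      using h_pos by eventually_elim (simp add: field_simps)
  qed
qed

lemma first_order_affine:
  assumes "\<forall>\<^sub>F p in \<Phi>. \<bar>D p\<bar> \<le> B"
  shows "first_order \<Phi> h (\<lambda>p. x + h p * D p) x D"
proof -
  have "((\<lambda>p. (x + h p * D p - x) / h p - D p) \<longlongrightarrow> 0) \<Phi>"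
    by (rule Lim_transform_eventually[OF tendsto_const]) (use h_pos in eventually_elim, simp)
  then show ?thesis using assms by (auto simp: first_order_def)
qed

lemma first_order_const: "first_order \<Phi> h (\<lambda>_. x) x (\<lambda>_. 0)"
  unfolding first_order_def by (intro conjI exI[of _ 0]) simp_all

lemma first_order_add:
  assumes "first_order \<Phi> h F x D" "first_order \<Phi> h G y E"
  shows "first_order \<Phi> h (\<lambda>p. F p + G p) (x + y) (\<lambda>p. D p + E p)"
proof -
  obtain B C where B: "\<forall>\<^sub>F p in \<Phi>. \<bar>D p\<bar> \<le> B" and C: "\<forall>\<^sub>F p in \<Phi>. \<bar>E p\<bar> \<le> C"
    using assms by (auto simp: first_order_def)
  have "\<forall>\<^sub>F p in \<Phi>. \<bar>D p + E p\<bar> \<le> B + C" using B C by eventually_elim linarith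
  moreover have "((\<lambda>p. ((F p - x) / h p - D p) + ((G p - y) / h p - E p)) \<longlongrightarrow> 0) \<Phi>"
    using assms by (intro tendsto_add_zero) (auto simp: first_order_def)
  moreover have "(\<lambda>p. ((F p - x) / h p - D p) + ((G p - y) / h p - E p)) =
      (\<lambda>p. (F p + G p - (x + y)) / h p - (D p + E p))"
    by (auto simp: diff_divide_distrib add_divide_distrib)
  ultimately show ?thesis by (auto simp: first_order_def)
qed

lemma first_order_mult:
  assumes "first_order \<Phi> h F x D" "first_order \<Phi> h G y E"
  shows "first_order \<Phi> h (\<lambda>p. F p * G p) (x * y) (\<lambda>p. D p * y + x * E p)"
proof -
  obtain B C where B: "\<forall>\<^sub>F p in \<Phi>. \<bar>D p\<bar> \<le> B" and C: "\<forall>\<^sub>F p in \<Phi>. \<bar>E p\<bar> \<le> C"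
    using assms by (auto simp: first_order_def)
  have "\<forall>\<^sub>F p in \<Phi>. \<bar>D p * y + x * E p\<bar> \<le> B * \<bar>y\<bar> + \<bar>x\<bar> * C"
    using B C
  proof eventually_elim
    case (elim p)
    have "\<bar>D p * y + x * E p\<bar> \<le> \<bar>D p\<bar> * \<bar>y\<bar> + \<bar>x\<bar> * \<bar>E p\<bar>" by (metis abs_mult abs_triangle_ineq)
    also have "\<dots> \<le> B * \<bar>y\<bar> + \<bar>x\<bar> * C" using elim by (intro add_mono mult_mono) auto
    finally show ?case .
  qed
  \<comment> \<open>The error of the product is split so that each part has a factor tending to 0;
    in the middle part \<open>D\<close> is bounded and \<open>G\<close> tends to
    \<open>y\<close>.\<close>
  moreover have "((\<lambda>p. ((F p - x) / h p - D p) * G p + D p * (G p - y) + x * ((G p - y) / h p - E p))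
      \<longlongrightarrow> 0 * y + 0 + x * 0) \<Phi>"
    using assms first_order_tendsto[OF assms(2)]
    by (intro tendsto_intros tendsto_bounded_mult_0[OF B]) (auto simp: first_order_def LIM_zero)
  then have "((\<lambda>p. ((F p - x) / h p - D p) * G p + D p * (G p - y) + x * ((G p - y) / h p - E p)) \<longlongrightarrow> 0) \<Phi>"
    by simp
  then have "((\<lambda>p. (F p * G p - x * y) / h p - (D p * y + x * E p)) \<longlongrightarrow> 0) \<Phi>"
  proof (rule Lim_transform_eventually)
    show "\<forall>\<^sub>F p in \<Phi>. ((F p - x) / h p - D p) * G p + D p * (G p - y) + x * ((G p - y) / h p - E p) =
        (F p * G p - x * y) / h p - (D p * y + x * E p)"
      using h_pos by eventually_elim (simp add: field_simps)
  qed
  ultimately show ?thesis by (auto simp: first_order_def)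
qed

lemma first_order_minus:
  "first_order \<Phi> h F x D \<Longrightarrow> first_order \<Phi> h (\<lambda>p. - F p) (- x) (\<lambda>p. - D p)"
  using first_order_mult[OF first_order_const[of "-1"], of F x D] by simp

lemma first_order_diff:
  "first_order \<Phi> h F x D \<Longrightarrow> first_order \<Phi> h G y E \<Longrightarrow> first_order \<Phi> h (\<lambda>p. F p - G p) (x - y) (\<lambda>p. D p - E p)"
  using first_order_add[of F x D "\<lambda>p. - G p" "- y" "\<lambda>p. - E p"] first_order_minus[of G y E] by simp

lemma first_order_sum:
  assumes "\<And>i. i \<in> A \<Longrightarrow> first_order \<Phi> h (F i) (x i) (D i)"
  shows "first_order \<Phi> h (\<lambda>p. \<Sum>i\<in>A. F i p) (\<Sum>i\<in>A. x i) (\<lambda>p. \<Sum>i\<in>A. D i p)"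
  using assms
proof (induction A rule: infinite_finite_induct)
  case (insert i A)
  then show ?case by (simp add: first_order_add)
qed (simp_all add: first_order_const)

lemma first_order_inverse:
  assumes "first_order \<Phi> h G y E" "y \<noteq> 0"
  shows "first_order \<Phi> h (\<lambda>p. 1 / G p) (1 / y) (\<lambda>p. - E p / y\<^sup>2)"
proof -
  obtain C where C: "\<forall>\<^sub>F p in \<Phi>. \<bar>E p\<bar> \<le> C"
    using assms by (auto simp: first_order_def)
  have "\<forall>\<^sub>F p in \<Phi>. \<bar>- E p / y\<^sup>2\<bar> \<le> C / y\<^sup>2"
    using C by eventually_elim (simp add: divide_right_mono)
  moreover have G: "(G \<longlongrightarrow> y) \<Phi>" by (rule first_order_tendsto[OF assms(1)])
  have "((\<lambda>p. - ((G p - y) / h p - E p) / (y * G p) + E p * (1 / y\<^sup>2 - 1 / (y * G p))) \<longlongrightarrow> - 0 / (y * y) + 0) \<Phi>"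
  proof (intro tendsto_add tendsto_bounded_mult_0[OF C])
    show "((\<lambda>p. - ((G p - y) / h p - E p) / (y * G p)) \<longlongrightarrow> - 0 / (y * y)) \<Phi>"
      using assms G by (intro tendsto_intros) (auto simp: first_order_def)
    have "((\<lambda>p. 1 / y\<^sup>2 - 1 / (y * G p)) \<longlongrightarrow> 1 / y\<^sup>2 - 1 / (y * y)) \<Phi>"
      using assms G by (intro tendsto_intros) auto
    then show "((\<lambda>p. 1 / y\<^sup>2 - 1 / (y * G p)) \<longlongrightarrow> 0) \<Phi>" by (simp add: power2_eq_square)
  qed
  then have "((\<lambda>p. - ((G p - y) / h p - E p) / (y * G p) + E p * (1 / y\<^sup>2 - 1 / (y * G p))) \<longlongrightarrow> 0) \<Phi>" by simp
  then have "((\<lambda>p. (1 / G p - 1 / y) / h p - (- E p / y\<^sup>2)) \<longlongrightarrow> 0) \<Phi>"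
  proof (rule Lim_transform_eventually)
    have "\<forall>\<^sub>F p in \<Phi>. G p \<noteq> 0" by (rule tendsto_imp_eventually_ne[OF G assms(2)])
    then show "\<forall>\<^sub>F p in \<Phi>. - ((G p - y) / h p - E p) / (y * G p) + E p * (1 / y\<^sup>2 - 1 / (y * G p)) =
        (1 / G p - 1 / y) / h p - (- E p / y\<^sup>2)"
      using h_pos by eventually_elim (use assms(2) in \<open>simp add: field_simps power2_eq_square\<close>)
  qed
  ultimately show ?thesis by (auto simp: first_order_def)
qed

end

text \<open>The bounds without the two conventions. The case \<open>n = 2\<close> is part of the
  general recursion, whose sum is then empty.\<close>

fun lower_real upper_real :: "(nat \<Rightarrow> real) \<Rightarrow> real \<Rightarrow> real \<Rightarrow> real \<Rightarrow> nat \<Rightarrow> real" where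
  "lower_real r eps gam q0 n =
     (if n = 0 then q0 else if n = 1 then 1 / (r 0 + eps) * q0
      else 1 / (r 0 + eps) * ((1 - r 1 - gam) * lower_real r eps gam q0 (n - 1)
          - (\<Sum>i\<in>{2..<n}. (r i + gam) * upper_real r eps gam q0 (n - i))))"
| "upper_real r eps gam q0 n =
     (if n = 0 then q0 else if n = 1 then 1 / (r 0 - eps) * q0
      else 1 / (r 0 - eps) * ((1 - r 1 + gam) * upper_real r eps gam q0 (n - 1)
          - (\<Sum>i\<in>{2..<n}. (r i - gam) * lower_real r eps gam q0 (n - i))))"

declare lower_real.simps [simp del] upper_real.simps [simp del]

text \<open>Under these inequalities neither convention applies, so all bounds are finite and real
  arithmetic suffices.\<close>

lemma est_eq_real:
  assumes "eps < r 0" "0 \<le> 1 - r 1 - gam"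
  shows "lower_est r eps gam q n = ereal (lower_real r eps gam q n) \<and>
    upper_est r eps gam q n = ereal (upper_real r eps gam q n)"
proof (induction n rule: less_induct)
  case (less n)
  consider "n = 0" | "n = 1" | "n = 2" | "3 \<le> n" by linarith
  then show ?case
  proof cases
    case 3
    have "lower_real r eps gam q 1 = 1 / (r 0 + eps) * q" "upper_real r eps gam q 1 = 1 / (r 0 - eps) * q"
      by (simp_all add: lower_real.simps upper_real.simps)
    then show ?thesis using assms 3
      by (subst lower_est.simps, subst upper_est.simps, subst lower_real.simps, subst upper_real.simps)
        (simp add: power2_eq_square)
  next
    case 4
    have s: "(\<Sum>i\<in>{2..<n}. ereal (r i + gam) * upper_est r eps gam q (n - i)) =
        ereal (\<Sum>i\<in>{2..<n}. (r i + gam) * upper_real r eps gam q (n - i))"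
      "(\<Sum>i\<in>{2..<n}. ereal (r i - gam) * lower_est r eps gam q (n - i)) =
        ereal (\<Sum>i\<in>{2..<n}. (r i - gam) * lower_real r eps gam q (n - i))"
      unfolding sum_ereal[symmetric] using less by (auto intro!: sum.cong)
    have p: "lower_est r eps gam q (n - 1) = ereal (lower_real r eps gam q (n - 1))"
      "upper_est r eps gam q (n - 1) = ereal (upper_real r eps gam q (n - 1))"
      using less[of "n - 1"] 4 by auto
    have "n \<noteq> 0" "n \<noteq> 1" "n \<noteq> 2" using 4 by auto
    then show ?thesis using assms
      by (subst lower_est.simps, subst upper_est.simps, subst lower_real.simps, subst upper_real.simps)
        (simp only: s p if_False not_less not_le if_not_P simp_thms times_ereal.simps ereal_minus(1))
  qed (use assms in \<open>simp_all add: lower_est.simps upper_est.simps lower_real.simps upper_real.simps\<close>)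
qed

text \<open>The derivative of the solution in the direction \<open>z\<close>, with
  \<open>Q 0\<close> fixed: differentiate \<open>r 0 * Q n = (1 - r 1) * Q (n - 1) - ...\<close> and
  solve for the derivative of \<open>Q n\<close>.\<close>

fun linear_error :: "(nat \<Rightarrow> real) \<Rightarrow> (nat \<Rightarrow> real) \<Rightarrow> (nat \<Rightarrow> real) \<Rightarrow> nat \<Rightarrow> real" where
  "linear_error r Q z n =
     (if n = 0 then 0 else if n = 1 then - (z 0 * Q 1) / r 0
      else ((1 - r 1) * linear_error r Q z (n - 1) - z 1 * Q (n - 1)
        - (\<Sum>i\<in>{2..<n}. r i * linear_error r Q z (n - i) + z i * Q (n - i)) - z 0 * Q n) / r 0)"

text \<open>Half of the distance between the bounds to first order. The subtracted terms contain the
  opposite bounds, so widths add up; \<open>c\<close> stands for the change of \<open>r 0\<close>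
  and \<open>d\<close> for the changes of the other coefficients.\<close>

fun half_width :: "(nat \<Rightarrow> real) \<Rightarrow> (nat \<Rightarrow> real) \<Rightarrow> real \<Rightarrow> real \<Rightarrow> nat \<Rightarrow> real" where
  "half_width r Q c d n =
     (if n = 0 then 0 else if n = 1 then c * Q 1 / r 0
      else ((1 - r 1) * half_width r Q c d (n - 1) + d * Q (n - 1)
        + (\<Sum>i\<in>{2..<n}. r i * half_width r Q c d (n - i) + d * Q (n - i)) + c * Q n) / r 0)"

declare linear_error.simps [simp del] half_width.simps [simp del]

section \<open>Comparison of the linear error with the half width\<close>

locale recurrence =
  fixes r Q :: "nat \<Rightarrow> real"
  assumes r_pos: "0 < r 0" and r_nonneg: "\<And>i. 0 \<le> r i" and r_1: "r 1 < 1"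
    and Q_pos: "\<And>n. 0 < Q n" and Q_rec: "\<And>n. Q n = (\<Sum>i\<le>n. r i * Q (Suc n - i))"
begin

lemma Q_1: "r 0 * Q 1 = Q 0" using Q_rec[of 0] by simp

lemma Q_step: assumes "2 \<le> n" shows "r 0 * Q n = (1 - r 1) * Q (n - 1) - (\<Sum>i\<in>{2..<n}. r i * Q (n - i))"
proof -
  obtain m where m: "n = Suc m" "1 \<le> m" using assms by (cases n) auto
  have "{..m} = insert 0 (insert 1 {2..<n})" using m by auto
  then have "(\<Sum>i\<le>m. r i * Q (Suc m - i)) = r 0 * Q n + (r 1 * Q (n - 1) + (\<Sum>i\<in>{2..<n}. r i * Q (n - i)))"
    using m by simp
  then show ?thesis using Q_rec[of m] m by (simp add: algebra_simps)
qed

lemma half_width_scale: "half_width r Q (b * c) (b * d) n = b * half_width r Q c d n"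
proof (induction n rule: less_induct)
  case (less n)
  have "(\<Sum>i\<in>{2..<n}. r i * half_width r Q (b * c) (b * d) (n - i) + b * d * Q (n - i)) =
      b * (\<Sum>i\<in>{2..<n}. r i * half_width r Q c d (n - i) + d * Q (n - i))"
    unfolding sum_distrib_left using less by (intro sum.cong) (auto simp: algebra_simps)
  moreover have "half_width r Q (b * c) (b * d) (n - 1) = b * half_width r Q c d (n - 1)" if "n \<noteq> 0"
    using less[of "n - 1"] that by simp
  ultimately show ?case
    by (subst (1 2) half_width.simps) (simp add: algebra_simps)
qed

text \<open>Used to replace \<open>d\<close> by the smaller \<open>c\<close>, after which
  \<open>half_width_scale\<close> takes out the common factor.\<close>

lemma half_width_mono:
  assumes "d \<le> d'" shows "half_width r Q c d n \<le> half_width r Q c d' n"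
proof (induction n rule: less_induct)
  case (less n)
  have "(\<Sum>i\<in>{2..<n}. r i * half_width r Q c d (n - i) + d * Q (n - i)) \<le>
      (\<Sum>i\<in>{2..<n}. r i * half_width r Q c d' (n - i) + d' * Q (n - i))"
    using assms r_nonneg Q_pos less
    by (intro sum_mono add_mono mult_left_mono mult_right_mono) (auto intro: less_imp_le)
  moreover have "(1 - r 1) * half_width r Q c d (n - 1) \<le> (1 - r 1) * half_width r Q c d' (n - 1)" if "n \<noteq> 0"
    using less[of "n - 1"] that r_1 by (intro mult_left_mono) auto
  moreover have "d * Q (n - 1) \<le> d' * Q (n - 1)" using assms Q_pos by (intro mult_right_mono) (auto intro: less_imp_le)
  ultimately show ?case
    using r_pos by (subst (1 2) half_width.simps) (auto intro!: divide_right_mono)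
qed

lemma half_width_pos: assumes "0 < c" "0 < d" "1 \<le> n" shows "0 < half_width r Q c d n"
  using assms(3)
proof (induction n rule: less_induct)
  case (less n)
  show ?case
  proof (cases "n = 1")
    case False
    have "0 \<le> (\<Sum>i\<in>{2..<n}. r i * half_width r Q c d (n - i) + d * Q (n - i))"
      using assms r_nonneg Q_pos less
      by (intro sum_nonneg add_nonneg_nonneg mult_nonneg_nonneg) (auto intro: less_imp_le)
    moreover have "0 \<le> (1 - r 1) * half_width r Q c d (n - 1)"
    proof -
      have "0 < half_width r Q c d (n - 1)" by (rule less.IH) (use less.prems False in auto)
      then show ?thesis using r_1 by simp
    qed
    moreover have "0 < d * Q (n - 1)" "0 < c * Q n" using assms Q_pos by auto
    ultimately show ?thesis using less.prems False r_pos
      by (subst half_width.simps) (auto intro!: divide_pos_pos)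
  qed (use assms Q_pos r_pos in \<open>simp add: half_width.simps\<close>)
qed

lemma abs_linear_error_le:
  assumes "\<And>i. i < n \<Longrightarrow> \<bar>z i\<bar> \<le> b" "m \<le> n"
  shows "\<bar>linear_error r Q z m\<bar> \<le> half_width r Q b b m"
  using assms(2)
proof (induction m rule: less_induct)
  case (less m)
  have zQ: "\<bar>z i * Q l\<bar> \<le> b * Q l" if "i < m" for i l
    using assms(1)[of i] that less.prems Q_pos[of l] by (simp add: abs_mult mult_right_mono)
  consider "m = 0" | "m = 1" | "2 \<le> m" by linarith
  then show ?case
  proof cases
    case 2
    then show ?thesis using zQ[of 0 1] r_pos
      by (simp add: linear_error.simps half_width.simps abs_mult divide_right_mono)
  next
    case 3
    have "\<bar>\<Sum>i\<in>{2..<m}. r i * linear_error r Q z (m - i) + z i * Q (m - i)\<bar> \<le>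
        (\<Sum>i\<in>{2..<m}. r i * half_width r Q b b (m - i) + b * Q (m - i))"
    proof (intro order_trans[OF sum_abs] sum_mono)
      fix i assume i: "i \<in> {2..<m}"
      have "\<bar>r i * linear_error r Q z (m - i) + z i * Q (m - i)\<bar> \<le> r i * \<bar>linear_error r Q z (m - i)\<bar> + \<bar>z i * Q (m - i)\<bar>"
        using r_nonneg[of i] abs_triangle_ineq[of "r i * linear_error r Q z (m - i)" "z i * Q (m - i)"]
        by (simp add: abs_mult)
      also have "\<dots> \<le> r i * half_width r Q b b (m - i) + b * Q (m - i)"
        using less i zQ r_nonneg by (intro add_mono mult_left_mono) auto
      finally show "\<bar>r i * linear_error r Q z (m - i) + z i * Q (m - i)\<bar> \<le> r i * half_width r Q b b (m - i) + b * Q (m - i)" .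
    qed
    moreover have "\<bar>(1 - r 1) * linear_error r Q z (m - 1)\<bar> \<le> (1 - r 1) * half_width r Q b b (m - 1)"
      using less.IH[of "m - 1"] less.prems 3 r_1 by (simp add: abs_mult mult_left_mono)
    moreover have "\<bar>z 1 * Q (m - 1)\<bar> \<le> b * Q (m - 1)" "\<bar>z 0 * Q m\<bar> \<le> b * Q m"
      using 3 by (auto intro!: zQ)
    ultimately have "\<bar>(1 - r 1) * linear_error r Q z (m - 1) - z 1 * Q (m - 1)
        - (\<Sum>i\<in>{2..<m}. r i * linear_error r Q z (m - i) + z i * Q (m - i)) - z 0 * Q m\<bar> \<le>
      (1 - r 1) * half_width r Q b b (m - 1) + b * Q (m - 1)
        + (\<Sum>i\<in>{2..<m}. r i * half_width r Q b b (m - i) + b * Q (m - i)) + b * Q m"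
      by linarith
    then show ?thesis using 3 r_pos
      by (subst linear_error.simps, subst half_width.simps) (simp add: divide_right_mono)
  qed (simp add: linear_error.simps half_width.simps)
qed

text \<open>Functionals that are linear in the first \<open>n\<close> coordinates are closed under
  sums and multiples, and the recursion uses nothing else. The coefficients turn the error into a
  sum over observations.\<close>

lemma linear_error_repr: "m \<le> n \<Longrightarrow> \<exists>b. \<forall>z. linear_error r Q z m = (\<Sum>i<n. b i * z i)"
proof -
  define lin where "lin F \<longleftrightarrow> (\<exists>b. \<forall>z. F z = (\<Sum>i<n. b i * z i))" for F :: "(nat \<Rightarrow> real) \<Rightarrow> real"
  have coord: "lin (\<lambda>z. z i)" if "i < n" for i
    unfolding lin_def by (rule exI[of _ "\<lambda>j. of_bool (j = i)"]) (use that in \<open>simp add: of_bool_def if_distrib if_distribR sum.delta cong: if_cong\<close>)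
  have zero: "lin (\<lambda>z. 0)" unfolding lin_def by (rule exI[of _ "\<lambda>_. 0"]) simp
  have add: "lin (\<lambda>z. F z + G z)" if F: "lin F" and G: "lin G" for F G
  proof -
    obtain b c where "\<forall>z. F z = (\<Sum>i<n. b i * z i)" "\<forall>z. G z = (\<Sum>i<n. c i * z i)"
      using F G unfolding lin_def by blast
    then show ?thesis unfolding lin_def
      by (intro exI[of _ "\<lambda>i. b i + c i"]) (simp add: distrib_right sum.distrib)
  qed
  have scale: "lin (\<lambda>z. c * F z)" if F: "lin F" for F c
  proof -
    obtain b where "\<forall>z. F z = (\<Sum>i<n. b i * z i)" using F unfolding lin_def by blast
    then show ?thesis unfolding lin_def
      by (intro exI[of _ "\<lambda>i. c * b i"]) (simp add: sum_distrib_left mult.assoc)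
  qed
  have sum: "lin (\<lambda>z. \<Sum>i\<in>A. F i z)" if "finite A" "\<And>i. i \<in> A \<Longrightarrow> lin (F i)" for F and A :: "nat set"
    using that by (induction A rule: finite_induct) (auto intro: zero add)
  have "m \<le> n \<Longrightarrow> lin (\<lambda>z. linear_error r Q z m)"
  proof (induction m rule: less_induct)
    case (less m)
    consider "m = 0" | "m = 1" | "2 \<le> m" by linarith
    then show ?case
    proof cases
      case 1 then show ?thesis using zero by (simp add: linear_error.simps)
    next
      case 2
      then have "lin (\<lambda>z. (- Q 1 / r 0) * z 0)" using less.prems by (intro scale coord) simp
      then show ?thesis using 2 by (simp add: linear_error.simps mult.commute)
    next
      case 3
      have "lin (\<lambda>z. (1 / r 0) * ((1 - r 1) * linear_error r Q z (m - 1) + (- Q (m - 1)) * z 1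
        + (-1) * (\<Sum>i\<in>{2..<m}. r i * linear_error r Q z (m - i) + Q (m - i) * z i) + (- Q m) * z 0))"
        using 3 less.prems by (intro scale add sum coord less.IH) auto
      moreover have "linear_error r Q z m = (1 / r 0) * ((1 - r 1) * linear_error r Q z (m - 1) + (- Q (m - 1)) * z 1
        + (-1) * (\<Sum>i\<in>{2..<m}. r i * linear_error r Q z (m - i) + Q (m - i) * z i) + (- Q m) * z 0)" for z
        using 3 by (subst linear_error.simps) (simp add: mult.commute)
      ultimately show ?thesis by (simp only:)
    qed
  qed
  then show "m \<le> n \<Longrightarrow> ?thesis" unfolding lin_def .
qed

section \<open>Expansion of the bounds along a filter\<close>

context
  fixes \<Phi> :: "'b filter" and h c d :: "'b \<Rightarrow> real" and z :: "'b \<Rightarrow> nat \<Rightarrow> real"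
    and n :: nat and K :: real
  assumes h0: "(h \<longlongrightarrow> 0) \<Phi>" and h_pos: "\<forall>\<^sub>F p in \<Phi>. 0 < h p"
    and z: "\<And>i. i < n \<Longrightarrow> \<forall>\<^sub>F p in \<Phi>. \<bar>z p i\<bar> \<le> K"
    and c: "\<forall>\<^sub>F p in \<Phi>. \<bar>c p\<bar> \<le> K" and d: "\<forall>\<^sub>F p in \<Phi>. \<bar>d p\<bar> \<le> K"
begin

lemma first_order_coeff:
  assumes "i < n"
  shows "first_order \<Phi> h (\<lambda>p. r i + h p * z p i) (r i) (\<lambda>p. z p i)"
  using first_order_affine[OF h0 h_pos, of "\<lambda>p. z p i"] z[OF assms] by blast

lemma first_order_radius:
  "first_order \<Phi> h (\<lambda>p. h p * c p) 0 c" "first_order \<Phi> h (\<lambda>p. h p * d p) 0 d"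
  using first_order_affine[OF h0 h_pos c, of 0] first_order_affine[OF h0 h_pos d, of 0] by simp_all

text \<open>Joint induction, since each bound contains the opposite one. The constant terms agree by
  \<open>Q_step\<close>; the linear terms from the product rule are the difference and the sum of
  the recursions of \<open>linear_error\<close> and \<open>half_width\<close>.\<close>

lemma first_order_estimates:
  assumes "1 \<le> m" "m \<le> n"
  shows "first_order \<Phi> h (\<lambda>p. lower_real (\<lambda>i. r i + h p * z p i) (h p * c p) (h p * d p) (Q 0) m) (Q m)
      (\<lambda>p. linear_error r Q (z p) m - half_width r Q (c p) (d p) m) \<and>
    first_order \<Phi> h (\<lambda>p. upper_real (\<lambda>i. r i + h p * z p i) (h p * c p) (h p * d p) (Q 0) m) (Q m)
      (\<lambda>p. linear_error r Q (z p) m + half_width r Q (c p) (d p) m)"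
  using assms
proof (induction m rule: less_induct)
  case (less m)
  note fo_diff = first_order_diff[OF h0 h_pos] and fo_add = first_order_add[OF h0 h_pos]
    and fo_mult = first_order_mult[OF h0 h_pos] and fo_inverse = first_order_inverse[OF h0 h_pos]
    and fo_sum = first_order_sum[OF h0 h_pos] and fo_const = first_order_const[OF h0 h_pos]
  have n: "0 < n" using less.prems by simp
  let ?r = "\<lambda>p i. r i + h p * z p i"
  let ?L = "\<lambda>m p. lower_real (?r p) (h p * c p) (h p * d p) (Q 0) m"
  let ?U = "\<lambda>m p. upper_real (?r p) (h p * c p) (h p * d p) (Q 0) m"
  let ?D = "\<lambda>m p. linear_error r Q (z p) m"
  let ?W = "\<lambda>m p. half_width r Q (c p) (d p) m"
  have r0: "r 0 \<noteq> 0" using r_pos by simp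
  \<comment> \<open>Zeros as in \<open>r 0 + 0\<close> are kept in the form in which the rules for
    sums and differences produce them, so that these rules apply by unification.\<close>
  have inv_p: "first_order \<Phi> h (\<lambda>p. 1 / (?r p 0 + h p * c p)) (1 / (r 0 + 0)) (\<lambda>p. - (z p 0 + c p) / (r 0 + 0)\<^sup>2)"
    using r0 by (intro fo_inverse fo_add first_order_coeff n first_order_radius) simp
  have inv_m: "first_order \<Phi> h (\<lambda>p. 1 / (?r p 0 - h p * c p)) (1 / (r 0 - 0)) (\<lambda>p. - (z p 0 - c p) / (r 0 - 0)\<^sup>2)"
    using r0 by (intro fo_inverse fo_diff first_order_coeff n first_order_radius) simp
  show ?case
  proof (cases "m = 1")
    case True
    have Q0: "Q 0 = r 0 * Q 1" by (rule Q_1[symmetric])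
    have "(\<lambda>p. - (z p 0 + c p) / (r 0 + 0)\<^sup>2 * Q 0 + 1 / (r 0 + 0) * 0) = (\<lambda>p. ?D m p - ?W m p)"
      "(\<lambda>p. - (z p 0 - c p) / (r 0 - 0)\<^sup>2 * Q 0 + 1 / (r 0 - 0) * 0) = (\<lambda>p. ?D m p + ?W m p)"
      unfolding True Q0 using r0 by (auto simp: linear_error.simps half_width.simps field_simps power2_eq_square)
    moreover have "1 / (r 0 + 0) * Q 0 = Q m" "1 / (r 0 - 0) * Q 0 = Q m"
      unfolding True Q0 using r0 by simp_all
    ultimately show ?thesis
      using fo_mult[OF inv_p fo_const[of "Q 0"]] fo_mult[OF inv_m fo_const[of "Q 0"]]
      by (simp only: True lower_real.simps[of _ _ _ _ 1] upper_real.simps[of _ _ _ _ 1]) simp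
  next
    case False
    then have m: "2 \<le> m" using less.prems by simp
    have IH: "first_order \<Phi> h (?L k) (Q k) (\<lambda>p. ?D k p - ?W k p)"
      "first_order \<Phi> h (?U k) (Q k) (\<lambda>p. ?D k p + ?W k p)" if "1 \<le> k" "k < m" for k
      using less.IH[of k] that less.prems by simp_all
    let ?BL = "\<lambda>p. (1 - ?r p 1 - h p * d p) * ?L (m - 1) p - (\<Sum>i\<in>{2..<m}. (?r p i + h p * d p) * ?U (m - i) p)"
    let ?BU = "\<lambda>p. (1 - ?r p 1 + h p * d p) * ?U (m - 1) p - (\<Sum>i\<in>{2..<m}. (?r p i - h p * d p) * ?L (m - i) p)"
    have BL: "first_order \<Phi> h ?BL ((1 - r 1 - 0) * Q (m - 1) - (\<Sum>i\<in>{2..<m}. (r i + 0) * Q (m - i)))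
        (\<lambda>p. (0 - z p 1 - d p) * Q (m - 1) + (1 - r 1 - 0) * (?D (m - 1) p - ?W (m - 1) p) -
          (\<Sum>i\<in>{2..<m}. (z p i + d p) * Q (m - i) + (r i + 0) * (?D (m - i) p + ?W (m - i) p)))"
      using m less.prems
      by (intro fo_diff fo_mult fo_sum fo_add fo_const first_order_coeff first_order_radius IH) auto
    have BU: "first_order \<Phi> h ?BU ((1 - r 1 + 0) * Q (m - 1) - (\<Sum>i\<in>{2..<m}. (r i - 0) * Q (m - i)))
        (\<lambda>p. (0 - z p 1 + d p) * Q (m - 1) + (1 - r 1 + 0) * (?D (m - 1) p + ?W (m - 1) p) -
          (\<Sum>i\<in>{2..<m}. (z p i - d p) * Q (m - i) + (r i - 0) * (?D (m - i) p - ?W (m - i) p)))"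
      using m less.prems
      by (intro fo_diff fo_mult fo_sum fo_add fo_const first_order_coeff first_order_radius IH) auto
    have v: "(1 - r 1 - 0) * Q (m - 1) - (\<Sum>i\<in>{2..<m}. (r i + 0) * Q (m - i)) = r 0 * Q m"
      "(1 - r 1 + 0) * Q (m - 1) - (\<Sum>i\<in>{2..<m}. (r i - 0) * Q (m - i)) = r 0 * Q m"
      using Q_step[OF m] by simp_all
    have D: "r 0 * ?D m p = (1 - r 1) * ?D (m - 1) p - z p 1 * Q (m - 1)
        - (\<Sum>i\<in>{2..<m}. r i * ?D (m - i) p + z p i * Q (m - i)) - z p 0 * Q m" for p
      using m r0 by (subst linear_error.simps) simp
    have W: "r 0 * ?W m p = (1 - r 1) * ?W (m - 1) p + d p * Q (m - 1)
        + (\<Sum>i\<in>{2..<m}. r i * ?W (m - i) p + d p * Q (m - i)) + c p * Q m" for p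
      using m r0 by (subst half_width.simps) simp
    have "- (z p 0 + c p) / (r 0 + 0)\<^sup>2 * (r 0 * Q m) + 1 / (r 0 + 0) *
        ((0 - z p 1 - d p) * Q (m - 1) + (1 - r 1 - 0) * (?D (m - 1) p - ?W (m - 1) p) -
          (\<Sum>i\<in>{2..<m}. (z p i + d p) * Q (m - i) + (r i + 0) * (?D (m - i) p + ?W (m - i) p))) =
        (r 0 * ?D m p - r 0 * ?W m p) / r 0" for p
      unfolding D W using r0 by (simp add: field_simps power2_eq_square sum.distrib)
    then have L: "(\<lambda>p. - (z p 0 + c p) / (r 0 + 0)\<^sup>2 * (r 0 * Q m) + 1 / (r 0 + 0) *
        ((0 - z p 1 - d p) * Q (m - 1) + (1 - r 1 - 0) * (?D (m - 1) p - ?W (m - 1) p) -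
          (\<Sum>i\<in>{2..<m}. (z p i + d p) * Q (m - i) + (r i + 0) * (?D (m - i) p + ?W (m - i) p)))) =
        (\<lambda>p. ?D m p - ?W m p)"
      using r0 by (simp add: diff_divide_distrib)
    have "- (z p 0 - c p) / (r 0 - 0)\<^sup>2 * (r 0 * Q m) + 1 / (r 0 - 0) *
        ((0 - z p 1 + d p) * Q (m - 1) + (1 - r 1 + 0) * (?D (m - 1) p + ?W (m - 1) p) -
          (\<Sum>i\<in>{2..<m}. (z p i - d p) * Q (m - i) + (r i - 0) * (?D (m - i) p - ?W (m - i) p))) =
        (r 0 * ?D m p + r 0 * ?W m p) / r 0" for p
      unfolding D W using r0 by (simp add: field_simps power2_eq_square sum.distrib sum_subtractf)
    then have U: "(\<lambda>p. - (z p 0 - c p) / (r 0 - 0)\<^sup>2 * (r 0 * Q m) + 1 / (r 0 - 0) *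
        ((0 - z p 1 + d p) * Q (m - 1) + (1 - r 1 + 0) * (?D (m - 1) p + ?W (m - 1) p) -
          (\<Sum>i\<in>{2..<m}. (z p i - d p) * Q (m - i) + (r i - 0) * (?D (m - i) p - ?W (m - i) p)))) =
        (\<lambda>p. ?D m p + ?W m p)"
      using r0 by (simp add: add_divide_distrib)
    have lr: "(\<lambda>p. 1 / (?r p 0 + h p * c p) * ?BL p) = ?L m" "(\<lambda>p. 1 / (?r p 0 - h p * c p) * ?BU p) = ?U m"
      using m by (auto simp: fun_eq_iff lower_real.simps[of _ _ _ _ m] upper_real.simps[of _ _ _ _ m])
    have q: "1 / (r 0 + 0) * (r 0 * Q m) = Q m" "1 / (r 0 - 0) * (r 0 * Q m) = Q m" using r0 by simp_all
    show ?thesis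
      using fo_mult[OF inv_p BL] fo_mult[OF inv_m BU] unfolding v L U lr q by simp
  qed
qed

text \<open>The margin \<open>\<eta>\<close> absorbs the remainder: divided by \<open>h\<close>, the
  deviations of the bounds from \<open>Q n\<close> are within \<open>\<eta>\<close> of
  \<open>?D - ?W\<close> and \<open>?D + ?W\<close>, and the premise keeps these more than
  \<open>\<eta>\<close> below and above 0.\<close>

lemma eventually_between:
  assumes "1 \<le> n" "0 < \<eta>"
  shows "\<forall>\<^sub>F p in \<Phi>. \<bar>linear_error r Q (z p) n\<bar> < half_width r Q (c p) (d p) n - \<eta> \<longrightarrow>
    lower_est (\<lambda>i. r i + h p * z p i) (h p * c p) (h p * d p) (Q 0) n < ereal (Q n) \<and>
    ereal (Q n) < upper_est (\<lambda>i. r i + h p * z p i) (h p * c p) (h p * d p) (Q 0) n"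
proof (cases "\<Phi> = bot")
  case False
  let ?r = "\<lambda>p i. r i + h p * z p i"
  let ?L = "\<lambda>p. lower_real (?r p) (h p * c p) (h p * d p) (Q 0) n"
  let ?U = "\<lambda>p. upper_real (?r p) (h p * c p) (h p * d p) (Q 0) n"
  let ?D = "\<lambda>p. linear_error r Q (z p) n"
  let ?W = "\<lambda>p. half_width r Q (c p) (d p) n"
  have L: "\<forall>\<^sub>F p in \<Phi>. \<bar>(?L p - Q n) / h p - (?D p - ?W p)\<bar> < \<eta>"
    using first_order_estimates[of n] assms unfolding first_order_def
    by (auto dest!: tendstoD[OF _ assms(2)] simp: dist_real_def)
  have U: "\<forall>\<^sub>F p in \<Phi>. \<bar>(?U p - Q n) / h p - (?D p + ?W p)\<bar> < \<eta>"
    using first_order_estimates[of n] assms unfolding first_order_def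
    by (auto dest!: tendstoD[OF _ assms(2)] simp: dist_real_def)
  have "((\<lambda>p. ?r p 0 - h p * c p) \<longlongrightarrow> r 0 - 0) \<Phi>"
    using assms(1) by (intro first_order_tendsto[OF h0 h_pos first_order_diff[OF h0 h_pos first_order_coeff first_order_radius(1)]]) simp
  then have e0: "\<forall>\<^sub>F p in \<Phi>. 0 < ?r p 0 - h p * c p"
    by (rule order_tendstoD) (use r_pos in simp)
  \<comment> \<open>For \<open>n = 1\<close> the coordinate \<open>z p 1\<close> is not controlled,
    but the bounds do not contain it.\<close>
  have e1: "\<forall>\<^sub>F p in \<Phi>. 1 < n \<longrightarrow> 0 < 1 - ?r p 1 - h p * d p"
  proof (cases "1 < n")
    case True
    have "((\<lambda>p. 1 - ?r p 1 - h p * d p) \<longlongrightarrow> 1 - r 1 - 0) \<Phi>"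
      by (intro first_order_tendsto[OF h0 h_pos first_order_diff[OF h0 h_pos first_order_diff[OF h0 h_pos first_order_const[OF h0 h_pos] first_order_coeff[OF True]] first_order_radius(2)]])
    then have "\<forall>\<^sub>F p in \<Phi>. 0 < 1 - ?r p 1 - h p * d p"
      by (rule order_tendstoD) (use r_1 in simp)
    then show ?thesis by eventually_elim simp
  qed simp
  show ?thesis using L U e0 e1 h_pos
  proof eventually_elim
    case (elim p)
    have eq: "lower_est (?r p) (h p * c p) (h p * d p) (Q 0) n = ereal (?L p)"
      "upper_est (?r p) (h p * c p) (h p * d p) (Q 0) n = ereal (?U p)"
    proof -
      have "lower_est (?r p) (h p * c p) (h p * d p) (Q 0) n = ereal (?L p) \<and>
        upper_est (?r p) (h p * c p) (h p * d p) (Q 0) n = ereal (?U p)"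
      proof (cases "n = 1")
        case True
        then show ?thesis using elim(3)
          by (simp add: lower_est.simps upper_est.simps lower_real.simps upper_real.simps)
      next
        case False
        then show ?thesis using elim(3,4) assms(1) by (intro est_eq_real) auto
      qed
      then show "lower_est (?r p) (h p * c p) (h p * d p) (Q 0) n = ereal (?L p)"
        "upper_est (?r p) (h p * c p) (h p * d p) (Q 0) n = ereal (?U p)" by auto
    qed
    show ?case
    proof
      assume D: "\<bar>?D p\<bar> < ?W p - \<eta>"
      have "(?L p - Q n) / h p < 0" "0 < (?U p - Q n) / h p"
        using D elim(1,2) by linarith+
      then show "lower_est (?r p) (h p * c p) (h p * d p) (Q 0) n < ereal (Q n) \<and>
          ereal (Q n) < upper_est (?r p) (h p * c p) (h p * d p) (Q 0) n"
        unfolding eq using elim(5) by (simp add: divide_less_0_iff zero_less_divide_iff)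
    qed
  qed
qed simp

end

end

section \<open>Sampling\<close>

text \<open>\<open>emp_cdf\<close> is the distribution function of the image of the uniform law on
  \<open>{..<N}\<close> under \<open>k \<mapsto> X k w\<close>. As a law on the line is determined
  by its distribution function, \<open>interval_measure\<close> returns this image, and the integral
  is a mean.\<close>

lemma emp_coeff_eq:
  assumes "1 \<le> N"
  shows "emp_coeff a X N w i = (\<Sum>k<N. indicator {0..} (X k w) * poisson_weight a i (X k w)) / real N"
proof -
  have S: "{..<N} \<noteq> {}" "finite {..<N}" using assms by (auto simp: lessThan_empty_iff)
  let ?p = "pmf_of_set {..<N}"
  let ?\<mu> = "distr (measure_pmf ?p) borel (\<lambda>k. X k w)"
  interpret \<mu>: real_distribution ?\<mu>
    by (rule prob_space.real_distribution_distr) (simp_all add: measure_pmf.prob_space_axioms)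
  have cdf: "cdf ?\<mu> = emp_cdf X N w"
  proof
    fix x
    have "cdf ?\<mu> x = measure_pmf.prob ?p {k. X k w \<le> x}"
      unfolding cdf_def by (subst measure_distr) (auto simp: vimage_def)
    also have "\<dots> = real (card ({..<N} \<inter> {k. X k w \<le> x})) / real N"
      using S by (simp add: measure_pmf_of_set)
    finally show "cdf ?\<mu> x = emp_cdf X N w x"
      by (simp add: emp_cdf_def Int_def)
  qed
  have "interval_measure (cdf ?\<mu>) = ?\<mu>"
  proof (rule cdf_unique)
    show "real_distribution (interval_measure (cdf ?\<mu>))"
      by (intro real_distribution_interval_measure \<mu>.cdf_nondecreasing \<mu>.cdf_is_right_cont
          \<mu>.cdf_lim_at_top_prob \<mu>.cdf_lim_at_bot)
    show "cdf (interval_measure (cdf ?\<mu>)) = cdf ?\<mu>"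
      by (intro cdf_interval_measure \<mu>.cdf_nondecreasing \<mu>.cdf_is_right_cont \<mu>.cdf_lim_at_bot)
  qed (rule \<mu>.real_distribution_axioms)
  then have "emp_coeff a X N w i = (LINT x:{0..}|?\<mu>. poisson_weight a i x)"
    unfolding emp_coeff_def cdf poisson_weight_def by simp
  also have "\<dots> = (LINT x|?\<mu>. indicator {0..} x * poisson_weight a i x)"
    by (simp add: set_lebesgue_integral_def)
  also have "\<dots> = (LINT k|measure_pmf ?p. indicator {0..} (X k w) * poisson_weight a i (X k w))"
    by (rule integral_distr) (auto, measurable)
  also have "\<dots> = (\<Sum>k<N. indicator {0..} (X k w) * poisson_weight a i (X k w)) / real N"
    using S by (simp add: integral_pmf_of_set)
  finally show ?thesis .
qed

lemma measurable_est:
  assumes "\<And>i. (\<lambda>x. r x i) \<in> borel_measurable M"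
  shows "(\<lambda>x. lower_est (r x) eps gam q n) \<in> borel_measurable M \<and> (\<lambda>x. upper_est (r x) eps gam q n) \<in> borel_measurable M"
proof (induction n rule: less_induct)
  case (less n)
  note [measurable] = assms
  have L [measurable]: "(\<lambda>x. lower_est (r x) eps gam q m) \<in> borel_measurable M"
    and U [measurable]: "(\<lambda>x. upper_est (r x) eps gam q m) \<in> borel_measurable M" if "m < n" for m
    using less[OF that] by auto
  have sU: "(\<lambda>x. \<Sum>i\<in>{2..<n}. ereal (r x i + gam) * upper_est (r x) eps gam q (n - i)) \<in> borel_measurable M"
    by (intro borel_measurable_ereal_sum borel_measurable_ereal_times U) (auto, measurable)
  have sL: "(\<lambda>x. \<Sum>i\<in>{2..<n}. ereal (r x i - gam) * lower_est (r x) eps gam q (n - i)) \<in> borel_measurable M"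
    by (intro borel_measurable_ereal_sum borel_measurable_ereal_times L) (auto, measurable)
  have [measurable]: "(\<lambda>x. lower_est (r x) eps gam q (n - 1)) \<in> borel_measurable M"
    "(\<lambda>x. upper_est (r x) eps gam q (n - 1)) \<in> borel_measurable M" if "n \<noteq> 0"
    using that L[of "n - 1"] U[of "n - 1"] by auto
  have 1: "(\<lambda>x. lower_est (r x) eps gam q n) \<in> borel_measurable M"
  proof (cases "n = 0")
    case False
    with sU show ?thesis by (subst lower_est.simps) measurable
  qed (simp add: lower_est.simps)
  have 2: "(\<lambda>x. upper_est (r x) eps gam q n) \<in> borel_measurable M"
  proof (cases "n = 0")
    case False
    with sL show ?thesis by (subst upper_est.simps) measurable
  qed (simp add: upper_est.simps)
  from 1 2 show ?case by simp
qed

text \<open>The factor \<open>1 / 2\<close> comes from \<open>(u + x)\<^sup>2 \<ge> u\<^sup>2 + x\<^sup>2\<close> for \<open>u, x \<ge> 0\<close>.\<close>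

lemma nn_integral_std_normal_tail:
  assumes "0 \<le> u"
  shows "(\<integral>\<^sup>+x. ennreal (std_normal_density x) * indicator {u<..} x \<partial>lborel) \<le> ennreal (exp (- u\<^sup>2 / 2) / 2)"
    and "(\<integral>\<^sup>+x. ennreal (std_normal_density x) * indicator {..<-u} x \<partial>lborel) \<le> ennreal (exp (- u\<^sup>2 / 2) / 2)"
proof -
  define A where "A = (\<integral>\<^sup>+x. ennreal (std_normal_density x) * indicator {0<..} x \<partial>lborel)"
  have even: "std_normal_density (- x) = std_normal_density x" for x
    by (simp add: std_normal_density_def)
  have neg: "(\<integral>\<^sup>+x. ennreal (std_normal_density x) * indicator {..<-v} x \<partial>lborel) =
      (\<integral>\<^sup>+x. ennreal (std_normal_density x) * indicator {v<..} x \<partial>lborel)" for v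
    by (subst nn_integral_real_affine[where c="-1" and t=0]) (auto simp: even indicator_def intro!: nn_integral_cong)
  have "1 = (\<integral>\<^sup>+x. ennreal (std_normal_density x) \<partial>lborel)"
    using prob_space.emeasure_space_1[OF prob_space_normal_density[of 1 0]] by (simp add: emeasure_density)
  also have "\<dots> = (\<integral>\<^sup>+x. ennreal (std_normal_density x) * indicator {0<..} x +
      ennreal (std_normal_density x) * indicator {..<-0} x \<partial>lborel)"
    by (intro nn_integral_cong_AE, use AE_lborel_singleton[of "0::real"] in eventually_elim) (auto simp: indicator_def)
  also have "\<dots> = A + A" unfolding A_def by (subst nn_integral_add) (auto simp only: neg, measurable)
  finally have AA: "1 = A + A" .
  have A: "A = ennreal (1 / 2)"
  proof (cases A)
    case (real r)
    with AA have "r = 1 / 2" by (simp add: ennreal_plus[symmetric] del: ennreal_plus)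
    with real show ?thesis by (simp only:)
  qed (use AA in simp)
  have "(\<integral>\<^sup>+x. ennreal (std_normal_density x) * indicator {u<..} x \<partial>lborel) =
      (\<integral>\<^sup>+x. ennreal (std_normal_density (u + x)) * indicator {0<..} x \<partial>lborel)"
    by (subst nn_integral_real_affine[where c=1 and t=u]) (auto simp: indicator_def intro!: nn_integral_cong)
  also have "\<dots> \<le> (\<integral>\<^sup>+x. ennreal (exp (- u\<^sup>2 / 2)) * (ennreal (std_normal_density x) * indicator {0<..} x) \<partial>lborel)"
  proof (rule nn_integral_mono)
    fix x :: real
    have "std_normal_density (u + x) \<le> exp (- u\<^sup>2 / 2) * std_normal_density x" if "0 < x"
    proof -
      have "- (u + x)\<^sup>2 / 2 \<le> - u\<^sup>2 / 2 + - x\<^sup>2 / 2"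
        using mult_nonneg_nonneg[OF assms less_imp_le[OF that]] by (simp add: power2_sum field_simps)
      then have "exp (- (u + x)\<^sup>2 / 2) \<le> exp (- u\<^sup>2 / 2) * exp (- x\<^sup>2 / 2)"
        by (simp flip: exp_add)
      then show ?thesis unfolding std_normal_density_def
        by (simp add: divide_right_mono mult.commute)
    qed
    then show "ennreal (std_normal_density (u + x)) * indicator {0<..} x \<le>
        ennreal (exp (- u\<^sup>2 / 2)) * (ennreal (std_normal_density x) * indicator {0<..} x)"
      by (auto simp: indicator_def ennreal_mult'[symmetric] intro!: ennreal_leI)
  qed
  also have "\<dots> = ennreal (exp (- u\<^sup>2 / 2)) * A"
    unfolding A_def by (rule nn_integral_cmult) measurable
  finally show 1: "(\<integral>\<^sup>+x. ennreal (std_normal_density x) * indicator {u<..} x \<partial>lborel) \<le> ennreal (exp (- u\<^sup>2 / 2) / 2)"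
    unfolding A by (simp only: ennreal_mult[symmetric] exp_ge_zero divide_nonneg_nonneg zero_le_one zero_le_numeral mult_1_right times_divide_eq_right)
  then show "(\<integral>\<^sup>+x. ennreal (std_normal_density x) * indicator {..<-u} x \<partial>lborel) \<le> ennreal (exp (- u\<^sup>2 / 2) / 2)"
    by (simp only: neg)
qed

interpretation std_normal: real_distribution std_normal_distribution
  by (rule real_dist_normal_dist)

lemma std_normal_tail:
  assumes "0 \<le> u"
  shows "std_normal.prob {u<..} \<le> exp (- u\<^sup>2 / 2) / 2" "std_normal.prob {..<-u} \<le> exp (- u\<^sup>2 / 2) / 2"
proof -
  have "ennreal (std_normal.prob {u<..}) \<le> ennreal (exp (- u\<^sup>2 / 2) / 2)"
    "ennreal (std_normal.prob {..<-u}) \<le> ennreal (exp (- u\<^sup>2 / 2) / 2)"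
    unfolding std_normal.emeasure_eq_measure[symmetric]
    using nn_integral_std_normal_tail[OF assms] by (simp_all add: emeasure_density)
  then show "std_normal.prob {u<..} \<le> exp (- u\<^sup>2 / 2) / 2" "std_normal.prob {..<-u} \<le> exp (- u\<^sup>2 / 2) / 2"
    by simp_all
qed

lemma std_normal_singleton: "std_normal.prob {x} = 0"
proof -
  have "emeasure std_normal_distribution {x} = 0"
    by (subst emeasure_density) (auto simp: nn_integral_0_iff_AE intro!: eventually_mono[OF AE_lborel_singleton[of x]])
  then show ?thesis by (simp add: measure_def)
qed

lemma cdf_std_normal_ge:
  assumes "0 \<le> u" shows "1 - exp (- u\<^sup>2 / 2) / 2 \<le> cdf std_normal_distribution u"
proof -
  have "std_normal.prob {u<..} = 1 - cdf std_normal_distribution u"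
    using std_normal.prob_compl[of "{..u}"] by (simp add: cdf_def Compl_eq_Diff_UNIV[symmetric])
  then show ?thesis using std_normal_tail(1)[OF assms] by simp
qed

lemma cdf_std_normal_le:
  assumes "0 \<le> u" shows "cdf std_normal_distribution (- u) \<le> exp (- u\<^sup>2 / 2) / 2"
proof -
  have "cdf std_normal_distribution (- u) = std_normal.prob ({..<-u} \<union> {-u})"
    unfolding cdf_def ivl_disj_un(2) ..
  also have "\<dots> \<le> std_normal.prob {..<-u} + std_normal.prob {-u}"
    by (rule measure_Un_le) simp_all
  finally show ?thesis using std_normal_tail(2)[OF assms] by (simp add: std_normal_singleton)
qed

lemma Phi_eq: "Phi x = cdf std_normal_distribution x"
proof -
  have "cdf std_normal_distribution x = enn2real (\<integral>\<^sup>+y. ennreal (std_normal_density y * indicator {..x} y) \<partial>lborel)"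
    unfolding cdf_def measure_def
    by (subst emeasure_density) (auto intro!: arg_cong[where f=enn2real] nn_integral_cong simp: indicator_def)
  also have "\<dots> = (LINT y|lborel. std_normal_density y * indicator {..x} y)"
    by (rule integral_eq_nn_integral[symmetric]) auto
  also have "\<dots> = Phi x"
    unfolding Phi_def set_lebesgue_integral_def std_normal_density_def
    by (subst Bochner_Integration.integral_mult_right_zero[symmetric]) (simp add: mult_ac)
  finally show ?thesis by simp
qed

lemma Phi_bounds: "0 \<le> x \<Longrightarrow> 1 / 2 \<le> Phi x" "Phi x \<le> 1"
proof -
  assume "0 \<le> x"
  moreover have "exp (- x\<^sup>2 / 2) \<le> 1" by simp
  ultimately show "1 / 2 \<le> Phi x" using cdf_std_normal_ge[of x] unfolding Phi_eq by linarith
next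
  show "Phi x \<le> 1" unfolding Phi_eq by (rule std_normal.cdf_bounded_prob)
qed

text \<open>The central limit theorem with the variance replaced by its upper bound \<open>(w/2)\<^sup>2\<close> (Popoviciu).\<close>

lemma (in prob_space) clt_bounded_range:
  fixes Y :: "nat \<Rightarrow> 'a \<Rightarrow> real"
  assumes Y: "indep_vars (\<lambda>_. borel) Y UNIV" "\<And>k. distr M borel (Y k) = \<nu>" "\<And>k. expectation (Y k) = 0"
    and range: "\<And>k x. \<bar>Y k x - m\<bar> \<le> w / 2" and w: "0 < w" and y: "0 \<le> y" and \<delta>: "0 < \<delta>"
  shows "\<forall>\<^sub>F N in sequentially. 1 - exp (- 2 * (y / w)\<^sup>2) - \<delta> \<le>
    prob {x \<in> space M. \<bar>(\<Sum>k<N. Y k x) / sqrt (real N)\<bar> \<le> y}"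
proof -
  have [measurable]: "Y k \<in> borel_measurable M" for k using Y(1) by (auto simp: indep_vars_def)
  have bnd: "\<bar>Y k x\<bar> \<le> w / 2 + \<bar>m\<bar>" for k x using range[of k x] by linarith
  have int: "integrable M (Y k)" for k
    by (rule integrable_const_bound[where B="w / 2 + \<bar>m\<bar>"]) (auto simp: bnd)
  have int2: "integrable M (\<lambda>x. (Y k x)\<^sup>2)" for k
    by (rule integrable_const_bound[where B="(w / 2 + \<bar>m\<bar>)\<^sup>2"]) (auto simp: bnd intro!: AE_I2 order_trans[OF _ power_mono[OF bnd[of k]]])
  have [measurable_cong]: "sets \<nu> = sets borel" using Y(2)[of 0] by (metis sets_distr)
  define \<sigma> where "\<sigma> = sqrt (\<integral>x. x\<^sup>2 \<partial>\<nu>)"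
  have \<sigma>2: "expectation (\<lambda>x. (Y k x)\<^sup>2) = \<sigma>\<^sup>2" and \<sigma>0: "0 \<le> \<sigma>" for k
  proof -
    have e: "(\<integral>x. x\<^sup>2 \<partial>\<nu>) = expectation (\<lambda>x. (Y k x)\<^sup>2)" for k
      unfolding Y(2)[of k, symmetric] by (rule integral_distr) auto
    have "0 \<le> (\<integral>x. x\<^sup>2 \<partial>\<nu>)" by simp
    then show "expectation (\<lambda>x. (Y k x)\<^sup>2) = \<sigma>\<^sup>2" "0 \<le> \<sigma>" by (simp_all add: \<sigma>_def e[of k, symmetric])
  qed
  have \<sigma>w: "\<sigma> \<le> w / 2"
  proof -
    \<comment> \<open>As the mean is 0, the second moment about \<open>m\<close> is
      \<open>\<sigma>\<^sup>2 + m\<^sup>2\<close>, so the variance is at most the squared half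
      range.\<close>
    have "\<sigma>\<^sup>2 + m\<^sup>2 = expectation (\<lambda>x. (Y 0 x)\<^sup>2 - 2 * m * Y 0 x + m\<^sup>2)"
      using int int2 by (simp add: Y(3) \<sigma>2 prob_space)
    also have "\<dots> = expectation (\<lambda>x. (Y 0 x - m)\<^sup>2)"
      by (simp add: power2_diff algebra_simps)
    also have "\<dots> \<le> expectation (\<lambda>x. (w / 2)\<^sup>2)"
    proof (rule integral_mono)
      show "integrable M (\<lambda>x. (Y 0 x - m)\<^sup>2)"
        using int int2 by (simp add: power2_diff)
      show "(Y 0 x - m)\<^sup>2 \<le> (w / 2)\<^sup>2" for x
        using power_mono[OF range[of 0 x], of 2] by simp
    qed simp
    also have "\<dots> = (w / 2)\<^sup>2" by (simp add: prob_space)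
    finally have "\<sigma>\<^sup>2 \<le> (w / 2)\<^sup>2" using zero_le_power2[of m] by linarith
    then show ?thesis by (rule power2_le_imp_le) (use w in simp)
  qed
  show ?thesis
  \<comment> \<open>The central limit theorem needs positive variance; otherwise all summands vanish
    almost surely.\<close>
  proof (cases "\<sigma> = 0")
    case True
    have "AE x in M. Y k x = 0" for k
      using integral_nonneg_eq_0_iff_AE[OF int2[of k]] \<sigma>2[of k] True by simp
    then have ae: "AE x in M. \<forall>k. Y k x = 0" by (subst AE_all_countable) simp
    have "prob {x \<in> space M. \<bar>(\<Sum>k<N. Y k x) / sqrt (real N)\<bar> \<le> y} = 1" for N
      by (subst prob_eq_1, measurable) (use ae y in \<open>auto elim!: eventually_mono\<close>)
    moreover have "1 - exp (- 2 * (y / w)\<^sup>2) - \<delta> \<le> 1"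
      using \<delta> exp_gt_zero[of "- 2 * (y / w)\<^sup>2"] by linarith
    ultimately show ?thesis by (simp only: eventually_True)
  next
    case False
    then have \<sigma>: "0 < \<sigma>" using \<sigma>0 by simp
    define u where "u = y / \<sigma>"
    have u: "0 \<le> u" using y \<sigma> by (simp add: u_def)
    define Z where "Z N x = (\<Sum>k<N. Y k x) / sqrt (real N * \<sigma>\<^sup>2)" for N x
    have [measurable]: "Z N \<in> borel_measurable M" for N unfolding Z_def by measurable
    have "weak_conv_m (\<lambda>N. distr M borel (Z N)) std_normal_distribution"
      unfolding Z_def
    proof (rule central_limit_theorem_zero_mean[OF Y(1) Y(3) \<sigma> int2 _ Y(2)])
      show "variance (Y k) = \<sigma>\<^sup>2" for k by (simp add: Y(3) \<sigma>2)
    qed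
    \<comment> \<open>The normal law has no atoms, so its distribution function is continuous and
      convergence holds at every point.\<close>
    then have conv: "(\<lambda>N. cdf (distr M borel (Z N)) v) \<longlonglongrightarrow> cdf std_normal_distribution v" for v
      unfolding weak_conv_m_def weak_conv_def by (simp add: std_normal.isCont_cdf std_normal_singleton)
    have lim: "(\<lambda>N. cdf (distr M borel (Z N)) u - cdf (distr M borel (Z N)) (- u)) \<longlonglongrightarrow>
        cdf std_normal_distribution u - cdf std_normal_distribution (- u)"
      by (intro tendsto_diff conv)
    have "1 - exp (- 2 * (y / w)\<^sup>2) \<le> 1 - exp (- u\<^sup>2 / 2)"
    proof -
      \<comment> \<open>By the variance bound \<open>y / w\<close> is at most \<open>u / 2\<close>,
        hence \<open>2 * (y / w)\<^sup>2 \<le> u\<^sup>2 / 2\<close>.\<close>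
      have "2 * \<sigma> \<le> w" using \<sigma>w by simp
      then have "y / w \<le> y / (2 * \<sigma>)" using y \<sigma> by (intro divide_left_mono) auto
      then have "(y / w)\<^sup>2 \<le> (y / (2 * \<sigma>))\<^sup>2" using y w by (intro power_mono) auto
      also have "\<dots> = u\<^sup>2 / 4" by (simp add: u_def power_divide power_mult_distrib)
      finally show ?thesis by simp
    qed
    also have "\<dots> \<le> cdf std_normal_distribution u - cdf std_normal_distribution (- u)"
      using cdf_std_normal_ge[OF u] cdf_std_normal_le[OF u] by simp
    finally have "1 - exp (- 2 * (y / w)\<^sup>2) - \<delta> < cdf std_normal_distribution u - cdf std_normal_distribution (- u)"
      using \<delta> by simp
    from order_tendstoD(1)[OF lim this] eventually_ge_at_top[of 1] show ?thesis
    proof eventually_elim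
      case (elim N)
      have c: "cdf (distr M borel (Z N)) v = prob {x \<in> space M. Z N x \<le> v}" for v
        unfolding cdf_def by (subst measure_distr) (auto intro!: arg_cong[where f=prob])
      have sub: "{x \<in> space M. Z N x \<le> - u} \<subseteq> {x \<in> space M. Z N x \<le> u}" using u by auto
      have "cdf (distr M borel (Z N)) u - cdf (distr M borel (Z N)) (- u) =
          prob ({x \<in> space M. Z N x \<le> u} - {x \<in> space M. Z N x \<le> - u})"
        unfolding c by (rule finite_measure_Diff[OF _ _ sub, symmetric]) measurable
      also have "\<dots> \<le> prob {x \<in> space M. \<bar>(\<Sum>k<N. Y k x) / sqrt (real N)\<bar> \<le> y}"
      proof (rule finite_measure_mono)
        have Zs: "(\<Sum>k<N. Y k x) / sqrt (real N) = Z N x * \<sigma>" for x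
          using \<sigma> elim(2) by (simp add: Z_def real_sqrt_mult)
        show "{x \<in> space M. Z N x \<le> u} - {x \<in> space M. Z N x \<le> - u} \<subseteq>
            {x \<in> space M. \<bar>(\<Sum>k<N. Y k x) / sqrt (real N)\<bar> \<le> y}"
        proof (safe, unfold Zs)
          fix x assume "Z N x \<le> u" "\<not> Z N x \<le> - u"
          then have "\<bar>Z N x\<bar> \<le> u" by linarith
          then have "\<bar>Z N x\<bar> * \<sigma> \<le> u * \<sigma>" using \<sigma> by (intro mult_right_mono) auto
          then show "\<bar>Z N x * \<sigma>\<bar> \<le> y" using \<sigma> by (simp add: abs_mult u_def)
        qed
      qed measurable
      finally show ?case using elim(1) by simp
    qed
  qed
qed

section \<open>The radii on the scale \<open>1 / sqrt N\<close>\<close>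

lemma radius_scale:
  assumes "1 \<le> N" "0 < e" "1 - exp (- 2 * real N * e\<^sup>2) = P"
  shows "sqrt (real N) * e = sqrt (- ln (1 - P) / 2)"
proof -
  have "ln (1 - P) = - 2 * real N * e\<^sup>2" using assms(3) by (metis diff_diff_eq2 diff_add_cancel ln_exp add_diff_cancel_left')
  then have "- ln (1 - P) / 2 = (sqrt (real N) * e)\<^sup>2" by (simp add: power_mult_distrib)
  then show ?thesis using assms by simp
qed

text \<open>The term subtracted in the equation for \<open>g\<close> is nonnegative, because
  \<open>Phi\<close> is at least 1/2 on the positive half line; so the exponential part of that
  equation must be at least \<open>P\<close>, its value at \<open>e\<close>.\<close>

lemma gamma_ge:
  assumes "1 \<le> N" "0 < e" "0 < g" "1 - exp (- 2 * real N * e\<^sup>2) = P"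
    "1 - exp (- 2 * real N * g\<^sup>2)
        - sqrt (pi * real N) * g * exp (- real N * g\<^sup>2) * (2 * Phi (sqrt (2 * real N) * g) - 1) = P"
  shows "e \<le> g"
proof -
  have "1 / 2 \<le> Phi (sqrt (2 * real N) * g)" using assms by (intro Phi_bounds) simp
  then have "0 \<le> sqrt (pi * real N) * g * exp (- real N * g\<^sup>2) * (2 * Phi (sqrt (2 * real N) * g) - 1)"
    using assms by (intro mult_nonneg_nonneg) auto
  then have "exp (- 2 * real N * g\<^sup>2) \<le> exp (- 2 * real N * e\<^sup>2)" using assms(4,5) by linarith
  then have "e\<^sup>2 \<le> g\<^sup>2" using assms(1) by simp
  then show ?thesis by (rule power2_le_imp_le) (use assms in simp)
qed

text \<open>In terms of \<open>t = sqrt N * g\<close> the equation does not contain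
  \<open>N\<close>. As \<open>t\<close> grows its left side tends to 1, above \<open>P\<close>,
  because \<open>Phi \<le> 1\<close> bounds the subtracted term by
  \<open>sqrt pi * t * exp (- t\<^sup>2)\<close>; this caps \<open>t\<close> by one constant for all
  \<open>N\<close>.\<close>

lemma gamma_bounded:
  assumes "P < 1"
  shows "\<exists>T. \<forall>N g. 1 \<le> N \<longrightarrow> 0 < g \<longrightarrow> 1 - exp (- 2 * real N * g\<^sup>2)
        - sqrt (pi * real N) * g * exp (- real N * g\<^sup>2) * (2 * Phi (sqrt (2 * real N) * g) - 1) = P \<longrightarrow>
      sqrt (real N) * g \<le> T"
proof -
  have "((\<lambda>t. exp (- 2 * t\<^sup>2) + sqrt pi * t * exp (- t\<^sup>2)) \<longlongrightarrow> 0) at_top"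
    by real_asymp
  then have "\<forall>\<^sub>F t in at_top. exp (- 2 * t\<^sup>2) + sqrt pi * t * exp (- t\<^sup>2) < 1 - P"
    by (rule order_tendstoD) (use assms in simp)
  then obtain T where T: "\<And>t. T \<le> t \<Longrightarrow> exp (- 2 * t\<^sup>2) + sqrt pi * t * exp (- t\<^sup>2) < 1 - P"
    unfolding eventually_at_top_linorder by blast
  show ?thesis
  proof (intro exI[of _ T] allI impI, rule ccontr)
    fix N :: nat and g :: real
    assume N: "1 \<le> N" and g: "0 < g" and eq: "1 - exp (- 2 * real N * g\<^sup>2)
        - sqrt (pi * real N) * g * exp (- real N * g\<^sup>2) * (2 * Phi (sqrt (2 * real N) * g) - 1) = P"
      and "\<not> sqrt (real N) * g \<le> T"
    define t where "t = sqrt (real N) * g"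
    have t: "T \<le> t" "0 \<le> t" "t\<^sup>2 = real N * g\<^sup>2"
      using \<open>\<not> sqrt (real N) * g \<le> T\<close> g by (simp_all add: t_def power_mult_distrib)
    have "sqrt (pi * real N) * g * exp (- real N * g\<^sup>2) * (2 * Phi (sqrt (2 * real N) * g) - 1) \<le>
        sqrt (pi * real N) * g * exp (- real N * g\<^sup>2) * 1"
      using g Phi_bounds(2)[of "sqrt (2 * real N) * g"] by (intro mult_left_mono) auto
    also have "\<dots> = sqrt pi * t * exp (- t\<^sup>2)"
    proof -
      have "- t\<^sup>2 = - real N * g\<^sup>2" using t(3) by simp
      then show ?thesis by (simp only: real_sqrt_mult t_def mult_1_right mult.assoc)
    qed
    finally have "sqrt (pi * real N) * g * exp (- real N * g\<^sup>2) *
        (2 * Phi (sqrt (2 * real N) * g) - 1) \<le> sqrt pi * t * exp (- t\<^sup>2)" .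
    moreover have "exp (- 2 * t\<^sup>2) = exp (- 2 * real N * g\<^sup>2)" using t(3) by simp
    ultimately have "1 - P \<le> exp (- 2 * t\<^sup>2) + sqrt pi * t * exp (- t\<^sup>2)"
      using eq by linarith
    with T[OF t(1)] show False by simp
  qed
qed

section \<open>Fluctuations of the empirical coefficients\<close>

context input_law begin

text \<open>The indicator keeps the weight in [0, 1] at every real number and not just almost
  surely, as \<open>clt_bounded_range\<close> asks for a bound at every point.\<close>

definition sample_weight :: "nat \<Rightarrow> real \<Rightarrow> real" where
  "sample_weight i x = indicator {0..} x * poisson_weight a i x"

lemma borel_measurable_sample_weight [measurable]: "sample_weight i \<in> borel_measurable borel"
  unfolding sample_weight_def by measurable

lemma sample_weight_bounds: "0 \<le> sample_weight i x" "sample_weight i x \<le> 1"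
  using rate by (auto simp: sample_weight_def indicator_def poisson_weight_nonneg poisson_weight_le_1)

lemma abs_sample_weight: "\<bar>sample_weight i x - 1 / 2\<bar> \<le> 1 / 2"
  using sample_weight_bounds[of i x] by linarith

lemma integrable_sample_weight: "integrable G (sample_weight i)"
  by (rule integrable_const_bound[where B=1]) (auto simp: sample_weight_bounds)

lemma expectation_sample_weight: "expectation (sample_weight i) = rho i"
  unfolding rho_def
  by (rule integral_cong_AE) (use input_pos in \<open>auto elim!: eventually_mono simp: sample_weight_def\<close>)

definition fluctuation :: "(nat \<Rightarrow> 'w \<Rightarrow> real) \<Rightarrow> nat \<Rightarrow> 'w \<Rightarrow> nat \<Rightarrow> real" where
  "fluctuation X N w i = (\<Sum>k<N. sample_weight i (X k w) - rho i) / sqrt (real N)"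

lemma emp_coeff_fluctuation:
  assumes "1 \<le> N"
  shows "emp_coeff a X N w i = rho i + 1 / sqrt (real N) * fluctuation X N w i"
proof -
  have "1 / sqrt (real N) * fluctuation X N w i = (\<Sum>k<N. sample_weight i (X k w) - rho i) / real N"
    by (simp add: fluctuation_def)
  then show ?thesis using assms
    unfolding emp_coeff_eq[OF assms] sample_weight_def[symmetric]
    by (simp add: sum_subtractf field_simps)
qed

text \<open>The functional is a normalised sum of the variables \<open>\<phi> (X k x)\<close>. Each
  sample weight is within 1/2 of the value 1/2, so the hypothesis on \<open>b\<close>, taken at
  \<open>v i = sample_weight i (X k x) - 1 / 2\<close>, places them within \<open>w / 2\<close> of a
  constant.\<close>

lemma clt_linear_functional:
  fixes M :: "'w measure" and X :: "nat \<Rightarrow> 'w \<Rightarrow> real" and b :: "nat \<Rightarrow> real"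
  assumes "prob_space M" "prob_space.indep_vars M (\<lambda>_. borel) X UNIV" "\<And>k. distr M borel (X k) = G"
    and b: "\<And>v. (\<And>i. i < n \<Longrightarrow> \<bar>v i\<bar> \<le> 1 / 2) \<Longrightarrow> \<bar>\<Sum>i<n. b i * v i\<bar> \<le> w / 2"
    and "0 < w" "0 \<le> y" "0 < \<delta>"
  shows "\<forall>\<^sub>F N in sequentially. 1 - exp (- 2 * (y / w)\<^sup>2) - \<delta> \<le>
    measure M {x \<in> space M. \<bar>\<Sum>i<n. b i * fluctuation X N x i\<bar> \<le> y}"
proof -
  interpret M: prob_space M by fact
  have [measurable]: "X k \<in> borel_measurable M" for k using assms(2) by (auto simp: M.indep_vars_def)
  define \<phi> where "\<phi> x = (\<Sum>i<n. b i * (sample_weight i x - rho i))" for x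
  have [measurable]: "\<phi> \<in> borel_measurable borel" unfolding \<phi>_def by measurable
  have "\<forall>\<^sub>F N in sequentially. 1 - exp (- 2 * (y / w)\<^sup>2) - \<delta> \<le>
      M.prob {x \<in> space M. \<bar>(\<Sum>k<N. \<phi> (X k x)) / sqrt (real N)\<bar> \<le> y}"
  proof (rule M.clt_bounded_range[where \<nu>="distr G borel \<phi>" and m="\<Sum>i<n. b i * (1 / 2 - rho i)"])
    show "M.indep_vars (\<lambda>_. borel) (\<lambda>k x. \<phi> (X k x)) UNIV"
      by (rule M.indep_vars_compose2[OF assms(2)]) measurable
    show "distr M borel (\<lambda>x. \<phi> (X k x)) = distr G borel \<phi>" for k
      unfolding assms(3)[of k, symmetric] by (subst distr_distr) (auto simp: comp_def)
    show "M.expectation (\<lambda>x. \<phi> (X k x)) = 0" for k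
    proof -
      have "M.expectation (\<lambda>x. \<phi> (X k x)) = (\<integral>x. \<phi> x \<partial>distr M borel (X k))"
        by (rule integral_distr[symmetric]) measurable
      also have "\<dots> = expectation \<phi>" unfolding assms(3) ..
      also have "\<dots> = 0"
        unfolding \<phi>_def by (simp add: integrable_sample_weight expectation_sample_weight prob_space[simplified])
      finally show ?thesis .
    qed
    show "\<bar>\<phi> (X k x) - (\<Sum>i<n. b i * (1 / 2 - rho i))\<bar> \<le> w / 2" for k x
    proof -
      have "\<phi> (X k x) - (\<Sum>i<n. b i * (1 / 2 - rho i)) = (\<Sum>i<n. b i * (sample_weight i (X k x) - 1 / 2))"
        unfolding \<phi>_def sum_subtractf[symmetric] by (intro sum.cong) (auto simp: algebra_simps)
      also have "\<bar>\<dots>\<bar> \<le> w / 2" by (rule b) (rule abs_sample_weight)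
      finally show ?thesis .
    qed
  qed fact+
  moreover have "(\<Sum>k<N. \<phi> (X k x)) / sqrt (real N) = (\<Sum>i<n. b i * fluctuation X N x i)" for N x
    unfolding \<phi>_def fluctuation_def
    by (subst sum.swap) (simp add: sum_divide_distrib sum_distrib_left)
  ultimately show ?thesis by (simp only:)
qed

lemma recurrence_characteristic:
  assumes "queueing_characteristic a G Q" "0 < Q 0"
  shows "recurrence rho Q"
proof
  show "rho 1 < 1" using sum_rho_le_1[of "{0, 1}"] rho_pos_0 by simp
  have Q: "Q n = Q 0 * char_seq rho n" for n by (rule characteristic_eq[OF assms(1)])
  show "0 < Q n" for n
    using char_seq_rho_mono[of n] assms(2) by (subst Q) (auto intro!: mult_pos_pos)
  show "Q n = (\<Sum>i\<le>n. rho i * Q (Suc n - i))" for n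
  proof -
    have "Q n = Q 0 * (\<Sum>i\<le>n. rho i * char_seq rho (Suc n - i))"
      using char_seq_rec[of rho n] rho_pos_0 by (subst Q) simp
    also have "\<dots> = (\<Sum>i\<le>n. rho i * Q (Suc n - i))"
      unfolding sum_distrib_left by (intro sum.cong refl) (subst (2) Q, simp)
    finally show ?thesis .
  qed
qed (use rho_pos_0 rho_nonneg in auto)

end

text \<open>What holds eventually along the product of \<open>sequentially\<close> and the principal
  filter of the box holds on a tail of the integers times the whole box, which makes
  \<open>eventually_between\<close> uniform. Thus \<open>z\<close> may be the random fluctuation,
  and \<open>d\<close> may depend on \<open>N\<close>.\<close>

lemma eventually_uniform_between:
  assumes "recurrence r Q" "1 \<le> n" "0 < \<eta>" "0 \<le> K" "\<bar>c\<bar> \<le> K"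
  shows "\<forall>\<^sub>F N in sequentially. \<forall>z d. (\<forall>i<n. \<bar>z i\<bar> \<le> K) \<longrightarrow> \<bar>d\<bar> \<le> K \<longrightarrow>
    \<bar>linear_error r Q z n\<bar> < half_width r Q c d n - \<eta> \<longrightarrow>
    lower_est (\<lambda>i. r i + 1 / sqrt (real N) * z i) (1 / sqrt (real N) * c) (1 / sqrt (real N) * d) (Q 0) n < ereal (Q n) \<and>
    ereal (Q n) < upper_est (\<lambda>i. r i + 1 / sqrt (real N) * z i) (1 / sqrt (real N) * c) (1 / sqrt (real N) * d) (Q 0) n"
proof -
  interpret recurrence r Q by fact
  let ?B = "{(z, d) | z d. (\<forall>i<n. \<bar>z i\<bar> \<le> K) \<and> \<bar>d\<bar> \<le> K}"
  let ?\<Phi> = "sequentially \<times>\<^sub>F principal ?B :: (nat \<times> ((nat \<Rightarrow> real) \<times> real)) filter"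
  have box: "\<forall>\<^sub>F p in ?\<Phi>. snd p \<in> ?B"
    by (rule eventually_compose_filterlim[OF _ filterlim_snd]) (simp add: eventually_principal)
  have h: "filterlim (\<lambda>N. 1 / sqrt (real N)) (nhds 0) sequentially" by real_asymp
  have h0: "((\<lambda>p. 1 / sqrt (real (fst p))) \<longlongrightarrow> 0) ?\<Phi>"
    by (rule filterlim_compose[OF h filterlim_fst])
  have "\<forall>\<^sub>F N in sequentially. 0 < 1 / sqrt (real N)"
    using eventually_gt_at_top[of 0] by eventually_elim simp
  then have h_pos: "\<forall>\<^sub>F p in ?\<Phi>. 0 < 1 / sqrt (real (fst p))"
    by (rule eventually_compose_filterlim[OF _ filterlim_fst])
  have z: "\<forall>\<^sub>F p in ?\<Phi>. \<bar>fst (snd p) i\<bar> \<le> K" if "i < n" for i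
    using box by eventually_elim (use that in auto)
  have d: "\<forall>\<^sub>F p in ?\<Phi>. \<bar>snd (snd p)\<bar> \<le> K"
    using box by eventually_elim auto
  have c: "\<forall>\<^sub>F p in ?\<Phi>. \<bar>c\<bar> \<le> K" using assms by simp
  from eventually_between[where z="\<lambda>p. fst (snd p)" and d="\<lambda>p. snd (snd p)", OF h0 h_pos z c d assms(2,3)]
  obtain A B where A: "eventually A sequentially" and B: "eventually B (principal ?B)"
    and AB: "\<And>N q. A N \<Longrightarrow> B q \<Longrightarrow> \<bar>linear_error r Q (fst q) n\<bar> < half_width r Q c (snd q) n - \<eta> \<longrightarrow>
    lower_est (\<lambda>i. r i + 1 / sqrt (real N) * fst q i) (1 / sqrt (real N) * c) (1 / sqrt (real N) * snd q) (Q 0) n < ereal (Q n) \<and>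
    ereal (Q n) < upper_est (\<lambda>i. r i + 1 / sqrt (real N) * fst q i) (1 / sqrt (real N) * c) (1 / sqrt (real N) * snd q) (Q 0) n"
    unfolding eventually_prod_filter by auto
  from A show ?thesis
  proof eventually_elim
    case (elim N)
    show ?case
    proof (intro allI impI)
      fix z :: "nat \<Rightarrow> real" and d assume "\<forall>i<n. \<bar>z i\<bar> \<le> K" "\<bar>d\<bar> \<le> K"
        and less: "\<bar>linear_error r Q z n\<bar> < half_width r Q c d n - \<eta>"
      then have "B (z, d)" using B by (auto simp: eventually_principal)
      from AB[OF elim this] less show "lower_est (\<lambda>i. r i + 1 / sqrt (real N) * z i) (1 / sqrt (real N) * c) (1 / sqrt (real N) * d) (Q 0) n < ereal (Q n) \<and>
        ereal (Q n) < upper_est (\<lambda>i. r i + 1 / sqrt (real N) * z i) (1 / sqrt (real N) * c) (1 / sqrt (real N) * d) (Q 0) n"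
        by simp
    qed
  qed
qed

theorem theorem4p4:
  fixes M :: "'w measure" and X :: "nat \<Rightarrow> 'w \<Rightarrow> real"
    and G :: "real measure" and \<alpha> P :: real and Q \<epsilon> \<gamma> :: "nat \<Rightarrow> real" and n :: nat
  assumes input: "real_distribution G" "AE x in G. 0 < x"
    and rate: "0 < \<alpha>"
    and char: "queueing_characteristic \<alpha> G Q"
    and pos: "0 < Q 0"
    and observations: "prob_space M" "prob_space.indep_vars M (\<lambda>_. borel) X UNIV"
      "\<And>k. distr M borel (X k) = G"
    and P: "0 < P" "P < 1"
    and eps: "\<And>N. 1 \<le> N \<Longrightarrow> 0 < \<epsilon> N \<and> 1 - exp (- 2 * real N * (\<epsilon> N)\<^sup>2) = P"
    and gam: "\<And>N. 1 \<le> N \<Longrightarrow> 0 < \<gamma> N \<and>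
      1 - exp (- 2 * real N * (\<gamma> N)\<^sup>2)
        - sqrt (pi * real N) * \<gamma> N * exp (- real N * (\<gamma> N)\<^sup>2) * (2 * Phi (sqrt (2 * real N) * \<gamma> N) - 1) = P"
    and n: "1 \<le> n"
  shows "ereal P \<le> liminf (\<lambda>N. ereal (measure M {\<omega> \<in> space M.
      lower_est (emp_coeff \<alpha> X N \<omega>) (\<epsilon> N) (\<gamma> N) (Q 0) n < ereal (Q n) \<and>
      ereal (Q n) < upper_est (emp_coeff \<alpha> X N \<omega>) (\<epsilon> N) (\<gamma> N) (Q 0) n}))"
    (is "_ \<le> liminf (\<lambda>N. ereal (measure M (?E N)))")
proof -
  interpret law: input_law G \<alpha>
    using input rate by (simp add: input_law_def input_law_axioms_def)
  interpret M: prob_space M by (rule observations)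
  have "recurrence law.rho Q" by (rule law.recurrence_characteristic[OF char pos])
  then interpret rec: recurrence law.rho Q .
  have X [measurable]: "X k \<in> borel_measurable M" for k
    using observations(2) by (auto simp: M.indep_vars_def)
  let ?z = "law.fluctuation X"
  have [measurable]: "(\<lambda>x. ?z N x i) \<in> borel_measurable M" for N i
    unfolding law.fluctuation_def by measurable
  \<comment> \<open>The value of \<open>sqrt N * \<epsilon> N\<close>, which is the same for all
    \<open>N \<ge> 1\<close>.\<close>
  define c where "c = sqrt (- ln (1 - P) / 2)"
  have c0: "0 < c" using P by (simp add: c_def)
  have c2: "exp (- 2 * c\<^sup>2) = 1 - P" using P by (simp add: c_def)
  obtain T where T: "\<And>N. 1 \<le> N \<Longrightarrow> sqrt (real N) * \<gamma> N \<le> T"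
    using gamma_bounded[OF P(2)] gam by blast
  define w where "w = half_width law.rho Q 1 1 n"
  have w: "0 < w" unfolding w_def by (rule rec.half_width_pos) (use n in auto)
  obtain b where b: "\<And>v. linear_error law.rho Q v n = (\<Sum>i<n. b i * v i)"
    using rec.linear_error_repr[of n n] by auto
  \<comment> \<open>The bound on the linear error at radius 1/2; homogeneity of the half width turns
    it into half of \<open>w\<close>.\<close>
  have b_le: "\<bar>\<Sum>i<n. b i * v i\<bar> \<le> w / 2" if "\<And>i. i < n \<Longrightarrow> \<bar>v i\<bar> \<le> 1 / 2" for v
    using rec.abs_linear_error_le[of n v "1 / 2" n] that rec.half_width_scale[of "1 / 2" 1 1 n]
    by (simp add: b w_def)
  have E_sets: "?E N \<in> sets M" if "1 \<le> N" for N
  proof -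
    have "(\<lambda>x. emp_coeff \<alpha> X N x i) \<in> borel_measurable M" for i
      unfolding law.emp_coeff_fluctuation[OF that] by measurable
    from measurable_est[OF this] have [measurable]:
      "(\<lambda>x. lower_est (emp_coeff \<alpha> X N x) (\<epsilon> N) (\<gamma> N) (Q 0) n) \<in> borel_measurable M"
      "(\<lambda>x. upper_est (emp_coeff \<alpha> X N x) (\<epsilon> N) (\<gamma> N) (Q 0) n) \<in> borel_measurable M" by auto
    show ?thesis by measurable
  qed
  \<comment> \<open>The loss consists of one \<open>\<delta>\<close> for shrinking \<open>c\<close>
    to \<open>s * c\<close>, one for the central limit theorem, and \<open>2 * \<delta>\<close> for
    each of the \<open>n\<close> coordinates that may leave the box.\<close>
  have main: "ereal (P - (2 + 2 * real n) * \<delta>) \<le> liminf (\<lambda>N. ereal (measure M (?E N)))" if \<delta>: "0 < \<delta>" for \<delta>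
  proof (rule Liminf_bounded)
    have "((\<lambda>s. 1 - exp (- 2 * (s * c)\<^sup>2)) \<longlongrightarrow> 1 - exp (- 2 * (1 * c)\<^sup>2)) (at_left 1)"
      by (intro tendsto_intros)
    then have "\<forall>\<^sub>F s in at_left 1. P - \<delta> < 1 - exp (- 2 * (s * c)\<^sup>2)"
      by (rule order_tendstoD) (use c2 \<delta> in simp)
    moreover have "\<forall>\<^sub>F s in at_left (1::real). s \<in> {0<..<1}"
      by (rule eventually_at_leftI[of 0]) auto
    ultimately have "\<forall>\<^sub>F s in at_left 1. P - \<delta> < 1 - exp (- 2 * (s * c)\<^sup>2) \<and> 0 < s \<and> s < 1"
      by eventually_elim auto
    then obtain s where s: "P - \<delta> < 1 - exp (- 2 * (s * c)\<^sup>2)" "0 < s" "s < 1"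
      using eventually_happens'[of "at_left (1::real)"] by auto
    have "((\<lambda>K::real. exp (- 2 * K\<^sup>2)) \<longlongrightarrow> 0) at_top" by real_asymp
    then have "\<forall>\<^sub>F K::real in at_top. exp (- 2 * K\<^sup>2) < \<delta>" by (rule order_tendstoD) fact
    moreover have "\<forall>\<^sub>F K in at_top. max c T \<le> K" by (rule eventually_ge_at_top)
    ultimately have "\<forall>\<^sub>F K::real in at_top. exp (- 2 * K\<^sup>2) < \<delta> \<and> max c T \<le> K" by eventually_elim simp
    \<comment> \<open>The box has to hold most of the fluctuations and also the scaled radii, which
      are at most \<open>c\<close> and \<open>T\<close>.\<close>
    then obtain K where K: "exp (- 2 * K\<^sup>2) < \<delta>" "c \<le> K" "T \<le> K"
      by (auto dest!: eventually_happens'[rotated])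
    \<comment> \<open>The level \<open>y\<close> lies below \<open>c * w\<close> by
      \<open>2 * \<eta>\<close>: one \<open>\<eta>\<close> is the margin for the remainder, the
      other makes the inequality strict.\<close>
    define y where "y = s * c * w"
    define \<eta> where "\<eta> = (1 - s) * c * w / 2"
    have y: "0 \<le> y" and \<eta>: "0 < \<eta>" using s c0 w by (auto simp: y_def \<eta>_def)
    have y_less: "y < c * w - \<eta>"
    proof -
      have "c * w - \<eta> - y = \<eta>" by (simp add: \<eta>_def y_def field_simps)
      with \<eta> show ?thesis by linarith
    qed
    have A: "\<forall>\<^sub>F N in sequentially. 1 - exp (- 2 * (y / w)\<^sup>2) - \<delta> \<le>
        M.prob {x \<in> space M. \<bar>\<Sum>i<n. b i * ?z N x i\<bar> \<le> y}"
      by (rule law.clt_linear_functional[OF observations b_le w y \<delta>])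
    have B: "\<forall>\<^sub>F N in sequentially. 1 - exp (- 2 * K\<^sup>2) - \<delta> \<le> M.prob {x \<in> space M. \<bar>?z N x i\<bar> \<le> K}"
      if i: "i < n" for i
    proof -
      \<comment> \<open>A single coordinate is the functional whose coefficients form a unit vector,
        for which the range has length 1.\<close>
      have one: "(\<Sum>j<n. of_bool (j = i) * v j) = v i" for v :: "nat \<Rightarrow> real"
        using i by (simp add: of_bool_def if_distrib if_distribR sum.delta cong: if_cong)
      have "\<forall>\<^sub>F N in sequentially. 1 - exp (- 2 * (K / 1)\<^sup>2) - \<delta> \<le>
          M.prob {x \<in> space M. \<bar>\<Sum>j<n. of_bool (j = i) * ?z N x j\<bar> \<le> K}"
        by (rule law.clt_linear_functional[OF observations _ zero_less_one _ \<delta>])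
          (unfold one, use i K c0 in auto)
      then show ?thesis unfolding one by simp
    qed
    have B': "\<forall>\<^sub>F N in sequentially. \<forall>i<n. 1 - exp (- 2 * K\<^sup>2) - \<delta> \<le> M.prob {x \<in> space M. \<bar>?z N x i\<bar> \<le> K}"
    proof -
      have "\<forall>\<^sub>F N in sequentially. \<forall>i\<in>{..<n}. 1 - exp (- 2 * K\<^sup>2) - \<delta> \<le> M.prob {x \<in> space M. \<bar>?z N x i\<bar> \<le> K}"
        by (rule eventually_ball_finite) (use B in auto)
      then show ?thesis by (simp only: Ball_def lessThan_iff)
    qed
    have U: "\<forall>\<^sub>F N in sequentially. \<forall>v d. (\<forall>i<n. \<bar>v i\<bar> \<le> K) \<longrightarrow> \<bar>d\<bar> \<le> K \<longrightarrow>
      \<bar>linear_error law.rho Q v n\<bar> < half_width law.rho Q c d n - \<eta> \<longrightarrow>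
      lower_est (\<lambda>i. law.rho i + 1 / sqrt (real N) * v i) (1 / sqrt (real N) * c) (1 / sqrt (real N) * d) (Q 0) n < ereal (Q n) \<and>
      ereal (Q n) < upper_est (\<lambda>i. law.rho i + 1 / sqrt (real N) * v i) (1 / sqrt (real N) * c) (1 / sqrt (real N) * d) (Q 0) n"
      by (rule eventually_uniform_between[OF rec.recurrence_axioms n \<eta>]) (use c0 K in auto)
    show "\<forall>\<^sub>F N in sequentially. ereal (P - (2 + 2 * real n) * \<delta>) \<le> ereal (measure M (?E N))"
      using A B' U eventually_ge_at_top[of 1]
    proof eventually_elim
      case (elim N)
      define d where "d = sqrt (real N) * \<gamma> N"
      let ?A = "{x \<in> space M. \<bar>\<Sum>i<n. b i * ?z N x i\<bar> \<le> y}"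
      let ?C = "\<lambda>i. {x \<in> space M. \<not> \<bar>?z N x i\<bar> \<le> K}"
      have N: "0 < sqrt (real N)" using elim(4) by simp
      have eps_N: "1 / sqrt (real N) * c = \<epsilon> N"
        using radius_scale[of N "\<epsilon> N" P] eps[OF elim(4)] elim(4) N unfolding c_def[symmetric]
        by (auto simp: field_simps)
      have gam_N: "1 / sqrt (real N) * d = \<gamma> N" using N by (simp add: d_def)
      have "\<epsilon> N \<le> \<gamma> N"
        by (rule gamma_ge[of N _ _ P]) (use eps[OF elim(4)] gam[OF elim(4)] elim(4) in auto)
      then have cd: "c \<le> d"
        using N unfolding eps_N[symmetric] gam_N[symmetric] by (simp add: divide_le_cancel)
      have dK: "\<bar>d\<bar> \<le> K" using T[OF elim(4)] K cd c0 by (simp add: d_def[symmetric])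
      \<comment> \<open>Here \<open>\<epsilon> \<le> \<gamma>\<close> enters: the actual half width
        is at least \<open>c\<close> times the one for unit radii.\<close>
      have "c * w \<le> half_width law.rho Q c d n"
        using rec.half_width_scale[of c 1 1 n] rec.half_width_mono[OF cd, of c n] by (simp add: w_def)
      then have y_d: "y < half_width law.rho Q c d n - \<eta>" using y_less by simp
      have sub: "?A \<subseteq> ?E N \<union> (\<Union>i<n. ?C i)"
      proof
        fix x assume x: "x \<in> ?A"
        show "x \<in> ?E N \<union> (\<Union>i<n. ?C i)"
        proof (cases "\<forall>i<n. \<bar>?z N x i\<bar> \<le> K")
          case True
          have "\<bar>linear_error law.rho Q (?z N x) n\<bar> < half_width law.rho Q c d n - \<eta>"
            using x y_d by (simp add: b)
          moreover have "(\<lambda>i. law.rho i + 1 / sqrt (real N) * ?z N x i) = emp_coeff \<alpha> X N x"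
            by (rule ext) (rule law.emp_coeff_fluctuation[OF elim(4), symmetric])
          ultimately have "x \<in> ?E N"
            using elim(3)[rule_format, of "?z N x" d] True dK x unfolding eps_N gam_N by simp
          then show ?thesis by simp
        next
          case False
          then show ?thesis using x by auto
        qed
      qed
      \<comment> \<open>One \<open>\<delta>\<close> bounds the tail term at \<open>K\<close>, the
        other the error of the normal approximation.\<close>
      have C: "M.prob (?C i) \<le> 2 * \<delta>" if "i < n" for i
      proof -
        have "M.prob (?C i) = 1 - M.prob {x \<in> space M. \<bar>?z N x i\<bar> \<le> K}"
          by (rule M.prob_neg) measurable
        then show ?thesis using elim(2) that K(1) by force
      qed
      have C_sets: "(\<Union>i<n. ?C i) \<in> sets M" by measurable
      have yw: "(y / w)\<^sup>2 = (s * c)\<^sup>2" using w by (simp add: y_def)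
      have "P - 2 * \<delta> \<le> M.prob ?A" using elim(1) s(1) unfolding yw by linarith
      also have "\<dots> \<le> M.prob (?E N \<union> (\<Union>i<n. ?C i))"
        by (intro M.finite_measure_mono[OF sub] sets.Un E_sets elim(4) C_sets)
      also have "\<dots> \<le> M.prob (?E N) + M.prob (\<Union>i<n. ?C i)"
        by (intro measure_Un_le E_sets elim(4) C_sets)
      also have "M.prob (\<Union>i<n. ?C i) \<le> (\<Sum>i<n. M.prob (?C i))"
        by (rule M.finite_measure_subadditive_finite) (auto, measurable)
      also have "\<dots> \<le> (\<Sum>i<n. 2 * \<delta>)" by (intro sum_mono C) simp
      finally show ?case by (simp add: algebra_simps)
    qed
  qed
  show ?thesis
  proof (rule ereal_le_epsilon2)
    fix e :: real assume e: "0 < e"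
    have "ereal (P - e) \<le> liminf (\<lambda>N. ereal (measure M (?E N)))"
    proof -
      have "(2 + 2 * real n) * (e / (2 + 2 * real n)) = e" by (simp add: add_nonneg_eq_0_iff)
      moreover have "0 < e / (2 + 2 * real n)" using e by (intro divide_pos_pos) auto
      ultimately show ?thesis using main[of "e / (2 + 2 * real n)"] by (simp only:)
    qed
    then have "ereal (P - e) + ereal e \<le> liminf (\<lambda>N. ereal (measure M (?E N))) + ereal e"
      by (rule add_right_mono)
    then show "ereal P \<le> liminf (\<lambda>N. ereal (measure M (?E N))) + ereal e" by simp
  qed
qed

end
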